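(* (1) The optimal fibrum type cylinder packing densities in the spaces $\mathbf{H}^3$, $\mathbf{H}^2\times\mathbf{R}$ and $\widetilde{\mathbf{SL}_2\mathbf{R}}$ are all equal to the densest hyperbolic circle packing density related to the regular mosaics with Schl\"afli symbol $\{p,q\}$, and the common value is $$\delta_c=\frac{3}{\pi}.$$ (2) The optimal fibrum type cylinder covering densities in the spaces $\mathbf{H}^3$, $\mathbf{H}^2\times\mathbf{R}$ and $\widetilde{\mathbf{SL}_2\mathbf{R}}$ are all equal to the thinnest hyperbolic circle covering density related to the regular mosaics with Schl\"afli symbol $\{p,q\}$, and the common value is $$\Delta_c=\frac{\sqrt{12}}{\pi}.$$ Here "optimal", "densest" and "thinnest" mean the supremum (for packings), respectively infimum (for coverings), over all integers $p\ge3$, $q>\frac{2p}{p-2}$, of the density related to $\{p,q\}$.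
   Context: Hyperbolic circles: $M_p^q$ is a tile of the regular tessellation of the hyperbolic plane $\mathbf{H}^2$ (curvature $-1$) with Schl\"afli symbol $\{p,q\}$, $p\ge3$, $q>\frac{2p}{p-2}$. $C(r^h(p,q))$ and $C(R^h(p,q))$ are its inscribed and circumscribed discs, with radii $r^h(p,q)=\mathrm{arccosh}\Bigl(\frac{\cos(\pi/q)}{\sin(\pi/p)}\Bigr)$, $R^h(p,q)=\mathrm{arccosh}\bigl(\cot\frac\pi p\cot\frac\pi q\bigr)$, and $\mathrm{Area}(M_p^q)=2p\bigl(\frac\pi2-\frac\pi p-\frac\pi q\bigr)$. The circle packing (covering) density related to $\{p,q\}$ is $\mathrm{Area}(C(r^h(p,q)))/\mathrm{Area}(M_p^q)$ (respectively $\mathrm{Area}(C(R^h(p,q)))/\mathrm{Area}(M_p^q)$). Fibrum type circular cylinders: in each space there is a base plane and a family of fibre lines; an infinite fibrum type circular cylinder (prism) is the union of the fibre lines through the points of a disc (tile) of the base plane. In $\mathbf{H}^2\times\mathbf{R}$ the fibres are the lines $\{P\}\times\mathbf{R}$ and the base plane is $\mathbf{H}^2\times\{0\}$. In $\mathbf{H}^3$ the axes are parallel, in the sense that the fibres are the geodesics orthogonal to a fixed base plane $\mathbf{H}^2$. In these two spaces the cylinder packing (covering) related to $\{p,q\}$ consists of the cylinders over the inscribed (circumscribed) discs of the tiles; its density is the ratio, for any $h>0$, of the volume of the part of the cylinder over the disc at heights from $0$ to $h$ (along fibres, measured from the base plane on one side) to the volume of the corresponding part of the prism over the tile $M_p^q$.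 $\widetilde{\mathbf{SL}_2\mathbf{R}}$: the metric in hyperboloid coordinates $(r,\theta,\phi)$ is $(\mathrm{d}s)^2=(\mathrm{d}r)^2+\cosh^2r\sinh^2r(\mathrm{d}\theta)^2+[\mathrm{d}\phi+\sinh^2r\,\mathrm{d}\theta]^2$, with volume element $\frac12\sinh(2r)\,\mathrm{d}r\,\mathrm{d}\theta\,\mathrm{d}\phi$. Fibres are the curves $r,\theta$ constant; the base plane is $\phi=0$, which in the projective model is the open unit disc with Euclidean coordinates $y=\tanh r\cos\theta$, $z=\tanh r\sin\theta$. The area of a region $D$ of the base plane is the volume of the solid of fibre height $1$ over it: $\mathrm{Area}(D)=\int_D\frac12\sinh(2r)\,\mathrm{d}r\,\mathrm{d}\theta$. $\mathcal{C}^b(r)$ is the disc of radius $r$ about the origin. $\mathcal{P}(p,q)$ is the base figure of the infinite regular $p$-sided prism, centred at the origin, of the regular infinite prism tiling $\mathcal{T}^i_p(q)$ with $q$ prisms meeting at each side edge. Explicitly: its vertices $A_1,\dots,A_p$ form a regular Euclidean $p$-gon centred at the origin with circumradius $b=\sqrt{\frac{1-\tan\frac\pi p\tan\frac\pi q}{1+\tan\frac\pi p\tan\frac\pi q}}$, and it is the region containing the origin bounded by the side curves $c_{A_iA_{i+1}}$ (indices mod $p$), each the minor circular arc from $A_i$ to $A_{i+1}$, curved towards the origin, of a Euclidean circle of radius $1/C_p(q)$, where $$C_p(q)=\sqrt{\frac{\cos\left(\frac{\pi}{p}+\frac{\pi}{q}\right)\left(\sin\frac{2\pi}{p}+\sin\frac{2\pi}{q}\right)}{\sin\left(\frac{\pi}{p}+\frac{\pi}{q}\right)\left(1-\cos\frac{2\pi}{p}\right)}}.$$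 $r_{opt}(p,q)$ is the radius (in the $\widetilde{\mathbf{SL}_2\mathbf{R}}$ sense) of the circle about the origin touching all side curves, and $R_{opt}(p,q)=\mathrm{arctanh}(b)$ that of the circle about the origin through the vertices. The cylinder packing and covering densities related to $\{p,q\}$ are $$\delta_p^{opt}(q)=\frac{\mathrm{Area}(\mathcal{C}^b(r_{opt}(p,q)))}{\mathrm{Area}(\mathcal{P}(p,q))},\qquad \Delta_p^{opt}(q)=\frac{\mathrm{Area}(\mathcal{C}^b(R_{opt}(p,q)))}{\mathrm{Area}(\mathcal{P}(p,q))}.$$ *)

theory Defs
  imports "HOL-Analysis.Analysis"
begin

section \<open>Hyperbolic space\<close>

text \<open>
  The hyperboloid model over a Euclidean space: a point of hyperbolic \<open>n\<close>-space (curvature \<open>-1\<close>)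
  is represented by its space component \<open>x\<close>, and \<^term>\<open>lift x\<close> is the corresponding point
  \<open>(x\<^sub>0, x)\<close> of the upper sheet \<open>x\<^sub>0\<^sup>2 - x \<bullet> x = 1\<close> in Minkowski space.  The hyperbolic plane is
  the type \<^typ>\<open>complex\<close> and hyperbolic 3-space the type \<^typ>\<open>complex \<times> real\<close>.
\<close>

definition lift :: "'a::euclidean_space \<Rightarrow> real \<times> 'a" where
  "lift x = (sqrt (1 + (norm x)\<^sup>2), x)"

definition mink :: "real \<times> 'a::euclidean_space \<Rightarrow> real \<times> 'a \<Rightarrow> real" where
  "mink u v = snd u \<bullet> snd v - fst u * fst v"

lemma mink_lift_self: "mink (lift x) (lift x) = -1"
  by (simp add: mink_def lift_def dot_square_norm)

definition hyp_dist :: "'a::euclidean_space \<Rightarrow> 'a \<Rightarrow> real" where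
  "hyp_dist x y = arcosh (- mink (lift x) (lift y))"

text \<open>The component of \<^term>\<open>lift y\<close> tangent to the hyperboloid at \<^term>\<open>lift x\<close>; it points in the
  direction of the geodesic from \<open>x\<close> to \<open>y\<close>.\<close>

definition hyp_dir :: "'a::euclidean_space \<Rightarrow> 'a \<Rightarrow> real \<times> 'a" where
  "hyp_dir x y = lift y + mink (lift x) (lift y) *\<^sub>R lift x"

lemma hyp_dir_tangent: "mink (lift x) (hyp_dir x y) = 0"
proof -
  have "mink (lift x) (hyp_dir x y)
      = mink (lift x) (lift y) + mink (lift x) (lift y) * mink (lift x) (lift x)"
    by (simp add: mink_def hyp_dir_def algebra_simps inner_add_right)
  thus ?thesis by (simp add: mink_lift_self)
qed

text \<open>The angle at \<open>x\<close> between the geodesics from \<open>x\<close> to \<open>y\<close> and from \<open>x\<close> to \<open>z\<close>.\<close>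

definition hyp_angle :: "'a::euclidean_space \<Rightarrow> 'a \<Rightarrow> 'a \<Rightarrow> real" where
  "hyp_angle x y z =
     arccos (mink (hyp_dir x y) (hyp_dir x z) /
       (sqrt (mink (hyp_dir x y) (hyp_dir x y)) * sqrt (mink (hyp_dir x z) (hyp_dir x z))))"

text \<open>Geodesic convex hull: geodesics are the intersections of the hyperboloid with planes through
  the origin of Minkowski space, so convex sets are its intersections with convex cones.\<close>

definition hyp_hull :: "'a::euclidean_space set \<Rightarrow> 'a set" where
  "hyp_hull V = {x. lift x \<in> convex_cone hull (lift ` V)}"

text \<open>Area or volume.  The metric in the coordinate \<open>x\<close> is
  \<open>dx \<bullet> dx - (x \<bullet> dx)\<^sup>2 / (1 + \<parallel>x\<parallel>\<^sup>2)\<close>, whose determinant is \<open>1 / (1 + \<parallel>x\<parallel>\<^sup>2)\<close>.\<close>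

definition hyp_vol :: "'a::euclidean_space set \<Rightarrow> real" where
  "hyp_vol S = set_lebesgue_integral lborel S (\<lambda>x. 1 / sqrt (1 + (norm x)\<^sup>2))"


section \<open>Regular mosaics and circles in the hyperbolic plane\<close>

definition schlaefli :: "(nat \<times> nat) set" where
  "schlaefli = {(p, q). p \<ge> 3 \<and> real q > 2 * real p / (real p - 2)}"

text \<open>The radius of the circle about a centre that touches every member of a family of curves from
  inside, where \<open>d x\<close> is the distance of \<open>x\<close> from the centre: the circle meets each curve and no
  curve enters the open disc.\<close>

definition touching_radius :: "('a \<Rightarrow> real) \<Rightarrow> 'a set set \<Rightarrow> real" where
  "touching_radius d \<S> =
     (THE r. r > 0 \<and> (\<forall>S\<in>\<S>. (\<exists>x\<in>S. d x = r) \<and> (\<forall>x\<in>S. r \<le> d x)))"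

text \<open>Vertices of the regular \<open>p\<close>-gon with centre \<open>0\<close> and hyperbolic circumradius \<open>R\<close>; the index
  is to be read modulo \<open>p\<close>.  A point at distance \<open>R\<close> from \<open>0\<close> has Euclidean norm \<open>sinh R\<close>.\<close>

definition ngon_vertex :: "nat \<Rightarrow> real \<Rightarrow> nat \<Rightarrow> complex" where
  "ngon_vertex p R i = of_real (sinh R) * cis (2 * pi * real i / real p)"

text \<open>The tile of \<open>{p,q}\<close> is the regular \<open>p\<close>-gon with all interior angles equal to \<open>2\<pi>/q\<close>
  (\<open>q\<close> of them meet at a vertex); it is placed with its centre at \<open>0\<close>.\<close>

definition tile_circumradius :: "nat \<Rightarrow> nat \<Rightarrow> real" where
  "tile_circumradius p q =
     (THE R. R > 0 \<and> (\<forall>i<p. hyp_angle (ngon_vertex p R (i + 1))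
        (ngon_vertex p R i) (ngon_vertex p R (i + 2)) = 2 * pi / real q))"

definition tile_vertex :: "nat \<Rightarrow> nat \<Rightarrow> nat \<Rightarrow> complex" where
  "tile_vertex p q = ngon_vertex p (tile_circumradius p q)"

definition tile_side :: "nat \<Rightarrow> nat \<Rightarrow> nat \<Rightarrow> complex set" where
  "tile_side p q i = hyp_hull {tile_vertex p q i, tile_vertex p q (i + 1)}"

definition tile :: "nat \<Rightarrow> nat \<Rightarrow> complex set" where
  "tile p q = hyp_hull (tile_vertex p q ` {..<p})"

definition tile_inradius :: "nat \<Rightarrow> nat \<Rightarrow> real" where
  "tile_inradius p q = touching_radius (hyp_dist 0) (tile_side p q ` {..<p})"

definition hyp_disc :: "real \<Rightarrow> complex set" where
  "hyp_disc r = {x. hyp_dist 0 x \<le> r}"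

definition inscribed_disc :: "nat \<Rightarrow> nat \<Rightarrow> complex set" where
  "inscribed_disc p q = hyp_disc (tile_inradius p q)"

definition circumscribed_disc :: "nat \<Rightarrow> nat \<Rightarrow> complex set" where
  "circumscribed_disc p q = hyp_disc (tile_circumradius p q)"

definition circle_packing_density :: "nat \<Rightarrow> nat \<Rightarrow> real" where
  "circle_packing_density p q = hyp_vol (inscribed_disc p q) / hyp_vol (tile p q)"

definition circle_covering_density :: "nat \<Rightarrow> nat \<Rightarrow> real" where
  "circle_covering_density p q = hyp_vol (circumscribed_disc p q) / hyp_vol (tile p q)"


section \<open>Fibrum type cylinders in the product of the hyperbolic plane and the line\<close>

definition h2r_vol :: "(complex \<times> real) set \<Rightarrow> real" where
  "h2r_vol S = set_lebesgue_integral lborel S (\<lambda>(x, t). 1 / sqrt (1 + (norm x)\<^sup>2))"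

definition h2r_solid :: "complex set \<Rightarrow> real \<Rightarrow> (complex \<times> real) set" where
  "h2r_solid D h = D \<times> {0..h}"

text \<open>The density is the common value, for all heights \<open>h > 0\<close>, of the volume ratio.\<close>

definition h2r_density :: "complex set \<Rightarrow> complex set \<Rightarrow> real" where
  "h2r_density D M = (THE d. \<forall>h>0. h2r_vol (h2r_solid D h) / h2r_vol (h2r_solid M h) = d)"

definition h2r_packing_density :: "nat \<Rightarrow> nat \<Rightarrow> real" where
  "h2r_packing_density p q = h2r_density (inscribed_disc p q) (tile p q)"

definition h2r_covering_density :: "nat \<Rightarrow> nat \<Rightarrow> real" where
  "h2r_covering_density p q = h2r_density (circumscribed_disc p q) (tile p q)"


section \<open>Fibrum type cylinders in hyperbolic 3-space\<close>

text \<open>The base plane is \<open>{(P, 0) | P}\<close>.  The fibre through \<open>(P, 0)\<close> is the geodesic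
  orthogonal to it, parametrised by arc length \<open>t\<close> from the base plane: its lift is
  \<open>cosh t\<close> times the lift of \<open>(P, 0)\<close> plus \<open>sinh t\<close> times the unit normal \<open>(0, 0, 1)\<close>
  of the base plane.\<close>

definition h3_fibre :: "complex \<Rightarrow> real \<Rightarrow> complex \<times> real" where
  "h3_fibre P t = (cosh t *\<^sub>R P, sinh t)"

lemma lift_h3_fibre:
  "lift (h3_fibre P t) = cosh t *\<^sub>R lift (P, 0) + sinh t *\<^sub>R (0, (0, 1))"
proof -
  have "1 + (norm (h3_fibre P t))\<^sup>2 = (cosh t)\<^sup>2 * (1 + (norm P)\<^sup>2)"
    by (simp add: h3_fibre_def norm_Pair power_mult_distrib cosh_square_eq algebra_simps)
  hence "sqrt (1 + (norm (h3_fibre P t))\<^sup>2) = cosh t * sqrt (1 + (norm P)\<^sup>2)"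
    by (simp add: real_sqrt_mult)
  thus ?thesis by (simp add: lift_def h3_fibre_def norm_Pair)
qed

lemma h3_normal:
  "mink (0, (0 :: complex, 1 :: real)) (0, (0, 1)) = 1"
  "mink (lift (P :: complex, 0 :: real)) (0, (0, 1)) = 0"
  by (simp_all add: mink_def lift_def)

definition h3_solid :: "complex set \<Rightarrow> real \<Rightarrow> (complex \<times> real) set" where
  "h3_solid D h = {h3_fibre P t | P t. P \<in> D \<and> 0 \<le> t \<and> t \<le> h}"

definition h3_density :: "complex set \<Rightarrow> complex set \<Rightarrow> real" where
  "h3_density D M = (THE d. \<forall>h>0. hyp_vol (h3_solid D h) / hyp_vol (h3_solid M h) = d)"

definition h3_packing_density :: "nat \<Rightarrow> nat \<Rightarrow> real" where
  "h3_packing_density p q = h3_density (inscribed_disc p q) (tile p q)"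

definition h3_covering_density :: "nat \<Rightarrow> nat \<Rightarrow> real" where
  "h3_covering_density p q = h3_density (circumscribed_disc p q) (tile p q)"


section \<open>Fibrum type cylinders in the universal cover of \<open>SL(2,R)\<close>\<close>

text \<open>Volume of a set given in the hyperboloid coordinates \<open>(r, \<theta>, \<phi>)\<close>.  The metric
  \<open>dr\<^sup>2 + cosh\<^sup>2 r sinh\<^sup>2 r d\<theta>\<^sup>2 + (d\<phi> + sinh\<^sup>2 r d\<theta>)\<^sup>2\<close> has determinant \<open>(sinh r cosh r)\<^sup>2\<close>.\<close>

definition sl_vol :: "(real \<times> real \<times> real) set \<Rightarrow> real" where
  "sl_vol S = set_lebesgue_integral lborel S (\<lambda>(r, \<theta>, \<phi>). sinh (2 * r) / 2)"

text \<open>The base plane \<open>\<phi> = 0\<close> in the projective model is the open unit disc of \<^typ>\<open>complex\<close>, with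
  \<open>y + \<i>z = tanh r (cos \<theta> + \<i> sin \<theta>)\<close>.\<close>

definition sl_point :: "real \<Rightarrow> real \<Rightarrow> complex" where
  "sl_point r \<theta> = of_real (tanh r) * cis \<theta>"

definition sl_solid :: "complex set \<Rightarrow> real \<Rightarrow> (real \<times> real \<times> real) set" where
  "sl_solid D h = {(r, \<theta>, \<phi>). 0 \<le> r \<and> 0 \<le> \<theta> \<and> \<theta> < 2 * pi \<and> 0 \<le> \<phi> \<and> \<phi> \<le> h \<and> sl_point r \<theta> \<in> D}"

definition sl_area :: "complex set \<Rightarrow> real" where
  "sl_area D = sl_vol (sl_solid D 1)"

definition sl_disc :: "real \<Rightarrow> complex set" where
  "sl_disc R = {sl_point r \<theta> | r \<theta>. 0 \<le> r \<and> r \<le> R}"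

definition sl_b :: "nat \<Rightarrow> nat \<Rightarrow> real" where
  "sl_b p q = sqrt ((1 - tan (pi / real p) * tan (pi / real q)) /
                    (1 + tan (pi / real p) * tan (pi / real q)))"

definition sl_C :: "nat \<Rightarrow> nat \<Rightarrow> real" where
  "sl_C p q = sqrt (cos (pi / real p + pi / real q) * (sin (2 * pi / real p) + sin (2 * pi / real q)) /
                    (sin (pi / real p + pi / real q) * (1 - cos (2 * pi / real p))))"

definition sl_vertex :: "nat \<Rightarrow> nat \<Rightarrow> nat \<Rightarrow> complex" where
  "sl_vertex p q i = of_real (sl_b p q) * cis (2 * pi * real i / real p)"

text \<open>For \<open>A\<close>, \<open>B\<close> at the same distance from \<open>0\<close>: the minor arc from \<open>A\<close> to \<open>B\<close> of a circle of
  radius \<open>\<rho>\<close>, curved towards \<open>0\<close>.  With \<open>m\<close> the midpoint of the chord, the centre \<open>c\<close> of the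
  circle lies on the ray from \<open>0\<close> through \<open>m\<close>, beyond \<open>m\<close>; the minor arc is the part of the circle
  on the other side of the chord, which is the side of \<open>0\<close>.\<close>

definition inward_arc :: "real \<Rightarrow> complex \<Rightarrow> complex \<Rightarrow> complex set" where
  "inward_arc \<rho> A B =
     (let m = midpoint A B;
          c = m + sqrt (\<rho>\<^sup>2 - (dist m A)\<^sup>2) *\<^sub>R sgn m
      in {z \<in> sphere c \<rho>. z \<bullet> m \<le> m \<bullet> m})"

definition sl_side :: "nat \<Rightarrow> nat \<Rightarrow> nat \<Rightarrow> complex set" where
  "sl_side p q i = inward_arc (1 / sl_C p q) (sl_vertex p q i) (sl_vertex p q (i + 1))"

definition sl_base_figure :: "nat \<Rightarrow> nat \<Rightarrow> complex set" where
  "sl_base_figure p q = connected_component_set (- (\<Union>i<p. sl_side p q i)) 0"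

text \<open>The point \<open>z\<close> of the base plane has radial coordinate \<open>artanh \<bar>z\<bar>\<close>.\<close>

definition sl_r_opt :: "nat \<Rightarrow> nat \<Rightarrow> real" where
  "sl_r_opt p q = touching_radius (\<lambda>z. artanh (cmod z)) (sl_side p q ` {..<p})"

definition sl_R_opt :: "nat \<Rightarrow> nat \<Rightarrow> real" where
  "sl_R_opt p q = artanh (sl_b p q)"

definition sl_packing_density :: "nat \<Rightarrow> nat \<Rightarrow> real" where
  "sl_packing_density p q = sl_area (sl_disc (sl_r_opt p q)) / sl_area (sl_base_figure p q)"

definition sl_covering_density :: "nat \<Rightarrow> nat \<Rightarrow> real" where
  "sl_covering_density p q = sl_area (sl_disc (sl_R_opt p q)) / sl_area (sl_base_figure p q)"


section \<open>Optimal densities\<close>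

text \<open>Taken in the extended reals, where suprema and infima always exist.\<close>

definition optimal_packing :: "(nat \<Rightarrow> nat \<Rightarrow> real) \<Rightarrow> ereal" where
  "optimal_packing \<delta> = (SUP (p, q)\<in>schlaefli. ereal (\<delta> p q))"

definition optimal_covering :: "(nat \<Rightarrow> nat \<Rightarrow> real) \<Rightarrow> ereal" where
  "optimal_covering \<delta> = (INF (p, q)\<in>schlaefli. ereal (\<delta> p q))"

end

theory Submission
  imports Defs "HOL-Real_Asymp.Real_Asymp"
begin

text \<open>
  In each of the three spaces the volume over a region of the base plane is its hyperbolic area times
  a factor independent of the region: the height in \<open>H\<^sup>2 \<times> R\<close>, \<open>\<integral> cosh\<^sup>2\<close> in \<open>H\<^sup>3\<close>, and \<open>1/4\<close> in the
  universal cover of \<open>SL(2,R)\<close>, whose base plane is the Poincare disc with all lengths halved and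
  where the side curves are hyperbolic geodesics.  All densities are therefore the planar ones.
  With \<open>a = \<pi>/p\<close> and \<open>c = \<pi>/2 - \<pi>/q\<close> these are \<open>a (sin c - sin a) / (sin a (c - a))\<close> and
  \<open>a (tan c - tan a) / (tan a (c - a))\<close>.  Concavity of the sine and convexity of the tangent reduce
  the extremal problem to \<open>c = \<pi>/6\<close>, that is \<open>q = 3\<close>, and the bound is approached as \<open>p \<rightarrow> \<infinity>\<close>.
\<close>

section \<open>Polar coordinates\<close>

text \<open>In polar coordinates a region that is star-shaped about its centre contributes
  \<open>cosh d - 1\<close> in each direction, where \<open>d\<close> is the hyperbolic distance to
  the boundary. One function, \<open>reach\<close>, with values \<open>sinh d\<close>, describes the
  tile and, with the radial coordinate doubled, also the base figure, so one integral yields both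
  areas. The constants are the values at c = pi/6 as a tends to 0: (1/2) / (pi/6) = 3/pi for the
  sine, (1 / sqrt 3) / (pi/6) = sqrt 12 / pi for the tangent. At c = pi/6 both inequalities, cleared
  of denominators, become equalities for a = 0 and for a = pi/6. The integrality of p keeps a away
  from pi/6 on the lower side, which leaves room for Taylor bounds of low degree.\<close>

lemma nn_integral_complex:
  fixes f :: "complex \<Rightarrow> ennreal"
  assumes [measurable]: "f \<in> borel_measurable borel"
  shows "(\<integral>\<^sup>+z. f z \<partial>lborel) = (\<integral>\<^sup>+x. \<integral>\<^sup>+y. f (Complex x y) \<partial>lborel \<partial>lborel)"
proof -
  let ?g = "\<lambda>(x, y). Complex x y"
  have "continuous_on UNIV (\<lambda>p::real \<times> real. Complex (fst p) (snd p))"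
    unfolding Complex_eq by (intro continuous_intros)
  hence g: "?g \<in> borel_measurable borel"
    by (simp add: case_prod_beta' borel_measurable_continuous_onI)
  hence [measurable]: "?g \<in> borel_measurable (lborel \<Otimes>\<^sub>M lborel)"
    by (simp add: lborel_prod)
  have "lborel = distr (lborel \<Otimes>\<^sub>M lborel) borel ?g"
  proof (rule lborel_eqI)
    fix l u :: complex assume "\<And>b. b \<in> Basis \<Longrightarrow> l \<bullet> b \<le> u \<bullet> b"
    from this[of 1] this[of \<i>] have le: "Re l \<le> Re u" "Im l \<le> Im u"
      by (simp_all add: Basis_complex_def)
    have "?g -` box l u \<inter> space (lborel \<Otimes>\<^sub>M lborel) = {Re l<..<Re u} \<times> {Im l<..<Im u}"
      by (auto simp: space_pair_measure box_def Basis_complex_def inner_complex_def)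
    hence "emeasure (distr (lborel \<Otimes>\<^sub>M lborel) borel ?g) (box l u)
        = ennreal (Re u - Re l) * ennreal (Im u - Im l)"
      using le by (simp add: emeasure_distr lborel.emeasure_pair_measure_Times)
    thus "emeasure (distr (lborel \<Otimes>\<^sub>M lborel) borel ?g) (box l u) = (\<Prod>b\<in>Basis. (u - l) \<bullet> b)"
      using le by (simp add: Basis_complex_def inner_complex_def ennreal_mult)
  qed simp
  hence "(\<integral>\<^sup>+z. f z \<partial>lborel) = (\<integral>\<^sup>+z. f z \<partial>distr (lborel \<Otimes>\<^sub>M lborel) borel ?g)"
    by (rule arg_cong)
  also have "\<dots> = (\<integral>\<^sup>+p. f (?g p) \<partial>(lborel \<Otimes>\<^sub>M lborel))"
    by (rule nn_integral_distr) auto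
  also have "\<dots> = (\<integral>\<^sup>+x. \<integral>\<^sup>+y. f (Complex x y) \<partial>lborel \<partial>lborel)"
    by (subst lborel.nn_integral_fst[symmetric]) auto
  finally show ?thesis .
qed

text \<open>The substitution rule works on compact intervals, while the tangent is unbounded on the
  open one. The line is therefore exhausted by images of compact intervals, and monotone convergence
  is applied on both sides.\<close>

lemma nn_integral_tan:
  fixes G :: "real \<Rightarrow> ennreal"
  assumes [measurable]: "G \<in> borel_measurable borel"
  shows "(\<integral>\<^sup>+t. G t \<partial>lborel) =
    (\<integral>\<^sup>+\<alpha>. G (tan \<alpha>) * ennreal (inverse ((cos \<alpha>)\<^sup>2)) * indicator {-(pi/2)<..<pi/2} \<alpha> \<partial>lborel)"
proof -
  \<comment> \<open>The summand 1 keeps the interval nondegenerate for \<open>n = 0\<close>.\<close>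
  let ?a = "\<lambda>n::nat. arctan (real n + 1)"
  let ?H = "\<lambda>\<alpha>. G (tan \<alpha>) * ennreal (inverse ((cos \<alpha>)\<^sup>2))"
  have mono: "?a m \<le> ?a n" if "m \<le> n" for m n
    using that by (simp add: arctan_monotone')
  have [measurable]: "(tan :: real \<Rightarrow> real) \<in> borel_measurable borel"
    unfolding tan_def[abs_def]
    by (intro borel_measurable_divide borel_measurable_continuous_onI continuous_intros)
  have sub: "(\<integral>\<^sup>+t. G t * indicator {- (real n + 1)..real n + 1} t \<partial>lborel) =
    (\<integral>\<^sup>+\<alpha>. ?H \<alpha> * indicator {- ?a n..?a n} \<alpha> \<partial>lborel)" for n
  proof -
    have c: "cos x \<noteq> 0" if "x \<in> {- ?a n..?a n}" for x
    proof -
      have "- (pi/2) < x \<and> x < pi/2"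
        using that arctan_bounded[of "real n + 1"] by auto
      thus ?thesis using cos_gt_zero_pi[of x] by auto
    qed
    have "0 < ?a n" by simp
    hence "- ?a n < ?a n" by linarith
    moreover have "continuous_on {- ?a n..?a n} (\<lambda>x. inverse ((cos x)\<^sup>2))"
      using c by (intro continuous_intros) auto
    ultimately have "(\<integral>\<^sup>+t. G t * indicator {tan (- ?a n)..tan (?a n)} t \<partial>lborel) =
        (\<integral>\<^sup>+\<alpha>. ?H \<alpha> * indicator {- ?a n..?a n} \<alpha> \<partial>lborel)"
      using c by (intro nn_integral_substitution_aux DERIV_tan) auto
    thus ?thesis by (simp only: tan_minus tan_arctan)
  qed
  have "(\<integral>\<^sup>+t. G t \<partial>lborel) = (\<integral>\<^sup>+t. (SUP n::nat. G t * indicator {- (real n + 1)..real n + 1} t) \<partial>lborel)"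
  proof (intro nn_integral_cong antisym)
    fix t :: real
    obtain n :: nat where "\<bar>t\<bar> \<le> real n" using real_arch_simple by blast
    thus "G t \<le> (SUP n::nat. G t * indicator {- (real n + 1)..real n + 1} t)"
      by (intro SUP_upper2[of n]) (auto simp: indicator_def)
  qed (auto intro!: SUP_least simp: indicator_def)
  also have "\<dots> = (SUP n::nat. \<integral>\<^sup>+t. G t * indicator {- (real n + 1)..real n + 1} t \<partial>lborel)"
    by (intro nn_integral_monotone_convergence_SUP) (auto simp: incseq_def le_fun_def indicator_def)
  also have "\<dots> = (SUP n::nat. \<integral>\<^sup>+\<alpha>. ?H \<alpha> * indicator {- ?a n..?a n} \<alpha> \<partial>lborel)"
    by (simp only: sub)
  also have "\<dots> = (\<integral>\<^sup>+\<alpha>. (SUP n::nat. ?H \<alpha> * indicator {- ?a n..?a n} \<alpha>) \<partial>lborel)"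
  proof (intro nn_integral_monotone_convergence_SUP[symmetric])
    have "indicator {- ?a m..?a m} x \<le> (indicator {- ?a n..?a n} x :: ennreal)" if "m \<le> n" for m n x
      using mono[OF that] by (auto simp: indicator_def)
    thus "incseq (\<lambda>n x. ?H x * indicator {- ?a n..?a n} x)"
      by (auto simp: incseq_def le_fun_def intro!: mult_left_mono)
  qed auto
  also have "\<dots> = (\<integral>\<^sup>+\<alpha>. ?H \<alpha> * indicator {-(pi/2)<..<pi/2} \<alpha> \<partial>lborel)"
  proof (intro nn_integral_cong antisym)
    fix \<alpha> :: real
    show "?H \<alpha> * indicator {-(pi/2)<..<pi/2} \<alpha> \<le> (SUP n::nat. ?H \<alpha> * indicator {- ?a n..?a n} \<alpha>)"
    proof (cases "\<alpha> \<in> {-(pi/2)<..<pi/2}")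
      case True
      obtain n :: nat where n: "\<bar>tan \<alpha>\<bar> \<le> real n" using real_arch_simple by blast
      have "\<alpha> = arctan (tan \<alpha>)" using True by (simp add: arctan_tan)
      moreover have "arctan (tan \<alpha>) \<le> ?a n" "arctan (- (real n + 1)) \<le> arctan (tan \<alpha>)"
        using n by (auto simp only: arctan_le_iff)
      ultimately have "\<alpha> \<in> {- ?a n..?a n}" unfolding arctan_minus by simp
      thus ?thesis using True by (intro SUP_upper2[of n]) auto
    qed auto
    have "{- ?a n..?a n} \<subseteq> {-(pi/2)<..<pi/2}" for n
      using arctan_bounded[of "real n + 1"] by auto
    hence "indicator {- ?a n..?a n} \<alpha> \<le> (indicator {-(pi/2)<..<pi/2} \<alpha> :: ennreal)" for n
      using subsetD[of "{- ?a n..?a n}" "{-(pi/2)<..<pi/2}" \<alpha>] by (simp add: indicator_def)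
    thus "(SUP n::nat. ?H \<alpha> * indicator {- ?a n..?a n} \<alpha>) \<le> ?H \<alpha> * indicator {-(pi/2)<..<pi/2} \<alpha>"
      by (intro SUP_least mult_left_mono) auto
  qed
  finally show ?thesis .
qed

text \<open>\<open>ennreal\<close> sends negative reals to 0, so \<open>ennreal s\<close> and
  \<open>ennreal (- s)\<close> are the restrictions of the weight to the two rays; reflection moves
  the negative ray to the positive one.\<close>

lemma nn_integral_abs_split:
  fixes f :: "real \<Rightarrow> ennreal"
  assumes [measurable]: "f \<in> borel_measurable borel"
  shows "(\<integral>\<^sup>+s. ennreal \<bar>s\<bar> * f s \<partial>lborel) =
    (\<integral>\<^sup>+s. ennreal s * f s \<partial>lborel) + (\<integral>\<^sup>+s. ennreal s * f (- s) \<partial>lborel)"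
proof -
  have "ennreal \<bar>s\<bar> * f s = ennreal s * f s + ennreal (- s) * f s" for s
    by (cases "s \<ge> 0") (auto simp: ennreal_neg)
  hence "(\<integral>\<^sup>+s. ennreal \<bar>s\<bar> * f s \<partial>lborel) =
      (\<integral>\<^sup>+s. ennreal s * f s \<partial>lborel) + (\<integral>\<^sup>+s. ennreal (- s) * f s \<partial>lborel)"
    by (simp add: nn_integral_add)
  also have "(\<integral>\<^sup>+s. ennreal (- s) * f s \<partial>lborel) = (\<integral>\<^sup>+s. ennreal s * f (- s) \<partial>lborel)"
    by (subst nn_integral_real_affine[where c = "-1" and t = 0]) auto
  finally show ?thesis .
qed

text \<open>The open half circle and its translate by \<open>pi\<close> cover the circle except for
  the two vertical directions, which form a null set. Periodicity moves the piece at negative angles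
  to the end of the standard interval.\<close>

lemma nn_integral_periodic:
  fixes F :: "real \<Rightarrow> ennreal"
  assumes [measurable]: "F \<in> borel_measurable borel" and per: "\<And>x. F (x + 2 * pi) = F x"
  shows "(\<integral>\<^sup>+\<alpha>. (F \<alpha> + F (\<alpha> + pi)) * indicator {-(pi/2)<..<pi/2} \<alpha> \<partial>lborel)
      = (\<integral>\<^sup>+\<theta>. F \<theta> * indicator {0..<2*pi} \<theta> \<partial>lborel)"
proof -
  let ?I = "\<lambda>S. \<integral>\<^sup>+x. F x * indicator S x \<partial>lborel"
  have "(\<integral>\<^sup>+\<alpha>. F (\<alpha> + pi) * indicator {-(pi/2)<..<pi/2} \<alpha> \<partial>lborel) = ?I {pi/2<..<3*pi/2}"
    by (subst nn_integral_real_affine[where c = 1 and t = pi and f = "\<lambda>x. F x * indicator {pi/2<..<3*pi/2} x"])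
       (auto intro!: nn_integral_cong simp: indicator_def add.commute)
  moreover have "?I {-(pi/2)<..<0} = ?I {3*pi/2<..<2*pi}"
    by (subst nn_integral_real_affine[where c = 1 and t = "2*pi" and f = "\<lambda>x. F x * indicator {3*pi/2<..<2*pi} x"])
       (auto intro!: nn_integral_cong simp: indicator_def per add.commute)
  moreover have "?I {-(pi/2)<..<pi/2} = ?I {-(pi/2)<..<0} + ?I {0..<pi/2}"
    by (subst nn_integral_add[symmetric]) (auto intro!: nn_integral_cong simp: indicator_def)
  moreover have "?I {0..<2*pi} = ?I {0..<pi/2} + (?I {pi/2<..<3*pi/2} + ?I {3*pi/2<..<2*pi})"
  proof -
    have "AE x in lborel. x \<noteq> pi/2 \<and> x \<noteq> 3*pi/2"
      using AE_lborel_singleton[of "pi/2"] AE_lborel_singleton[of "3*pi/2"] by eventually_elim auto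
    thus ?thesis
      by (subst nn_integral_add[symmetric], simp, simp, subst nn_integral_add[symmetric], simp, simp,
          intro nn_integral_cong_AE, eventually_elim) (auto simp: indicator_def)
  qed
  ultimately show ?thesis
    by (simp add: distrib_right nn_integral_add ac_simps)
qed

text \<open>The substitution \<open>y = x t\<close> leaves, for each slope \<open>t\<close>, an integral along the line of slope \<open>t\<close>;
  then \<open>t = tan \<alpha>\<close> turns slopes into angles.  Each line contributes its two rays, at \<open>\<alpha>\<close> and \<open>\<alpha> + \<pi>\<close>.\<close>

theorem nn_integral_polar:
  fixes f :: "complex \<Rightarrow> ennreal"
  assumes [measurable]: "f \<in> borel_measurable borel"
  shows "(\<integral>\<^sup>+z. f z \<partial>lborel) =
    (\<integral>\<^sup>+\<theta>. (\<integral>\<^sup>+s. ennreal s * f (of_real s * cis \<theta>) \<partial>lborel) * indicator {0..<2*pi} \<theta> \<partial>lborel)"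
proof -
  have C: "continuous_on UNIV (\<lambda>p::real \<times> real. Complex (fst p) (snd p))"
    unfolding Complex_eq by (intro continuous_intros)
  have [measurable]: "(\<lambda>p. Complex (fst p) (snd p)) \<in> borel_measurable (borel \<Otimes>\<^sub>M borel)"
    using C by (simp add: borel_prod borel_measurable_continuous_onI)
  have [measurable]: "(\<lambda>x. Complex (g x) (h x)) \<in> borel_measurable M"
    if [measurable]: "g \<in> borel_measurable M" "h \<in> borel_measurable M" for g h and M :: "'x measure"
  proof -
    have "(\<lambda>x. (\<lambda>p. Complex (fst p) (snd p)) (g x, h x)) \<in> borel_measurable M"
      by measurable
    thus ?thesis by simp
  qed
  have cis: "of_real s * cis \<theta> = Complex (s * cos \<theta>) (s * sin \<theta>)" for s \<theta>
    by (simp add: complex_eq_iff)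
  define F where "F \<theta> = (\<integral>\<^sup>+s. ennreal s * f (of_real s * cis \<theta>) \<partial>lborel)" for \<theta>
  have [measurable]: "F \<in> borel_measurable borel"
    unfolding F_def[abs_def] cis by measurable
  define G where "G t = (\<integral>\<^sup>+x. ennreal \<bar>x\<bar> * f (Complex x (x * t)) \<partial>lborel)" for t
  have [measurable]: "G \<in> borel_measurable borel"
    unfolding G_def[abs_def] by measurable
  have "(\<integral>\<^sup>+z. f z \<partial>lborel) = (\<integral>\<^sup>+x. \<integral>\<^sup>+y. f (Complex x y) \<partial>lborel \<partial>lborel)"
    by (rule nn_integral_complex) fact
  also have "\<dots> = (\<integral>\<^sup>+x. \<integral>\<^sup>+t. ennreal \<bar>x\<bar> * f (Complex x (x * t)) \<partial>lborel \<partial>lborel)"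
  proof (rule nn_integral_cong_AE)
    show "AE x in lborel. (\<integral>\<^sup>+y. f (Complex x y) \<partial>lborel)
        = (\<integral>\<^sup>+t. ennreal \<bar>x\<bar> * f (Complex x (x * t)) \<partial>lborel)"
      \<comment> \<open>At \<open>x = 0\<close> the substitution \<open>y = x t\<close> collapses; a
        single abscissa is negligible.\<close>
      using AE_lborel_singleton[of 0]
    proof eventually_elim
      case (elim x)
      thus ?case
        by (subst nn_integral_real_affine[where c = x and t = 0]) (auto simp: nn_integral_cmult)
    qed
  qed
  also have "\<dots> = (\<integral>\<^sup>+t. G t \<partial>lborel)"
    unfolding G_def by (rule lborel_pair.Fubini') measurable
  also have "\<dots> = (\<integral>\<^sup>+\<alpha>. G (tan \<alpha>) * ennreal (inverse ((cos \<alpha>)\<^sup>2)) * indicator {-(pi/2)<..<pi/2} \<alpha> \<partial>lborel)"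
    by (rule nn_integral_tan) measurable
  also have "\<dots> = (\<integral>\<^sup>+\<alpha>. (F \<alpha> + F (\<alpha> + pi)) * indicator {-(pi/2)<..<pi/2} \<alpha> \<partial>lborel)"
  proof (rule nn_integral_cong)
    fix \<alpha> :: real
    have "G (tan \<alpha>) * ennreal (inverse ((cos \<alpha>)\<^sup>2)) = F \<alpha> + F (\<alpha> + pi)" if \<alpha>: "\<alpha> \<in> {-(pi/2)<..<pi/2}"
    proof -
      have c: "cos \<alpha> > 0" using that by (intro cos_gt_zero_pi) auto
      have "G (tan \<alpha>) = ennreal (cos \<alpha>) *
          (\<integral>\<^sup>+s. ennreal \<bar>cos \<alpha> * s\<bar> * f (Complex (cos \<alpha> * s) (cos \<alpha> * s * tan \<alpha>)) \<partial>lborel)"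
        unfolding G_def using c
        by (subst nn_integral_real_affine[where c = "cos \<alpha>" and t = 0]) auto
      also have "\<dots> = ennreal (cos \<alpha>) *
          (\<integral>\<^sup>+s. ennreal (cos \<alpha>) * (ennreal \<bar>s\<bar> * f (of_real s * cis \<alpha>)) \<partial>lborel)"
      proof -
        have "ennreal \<bar>cos \<alpha> * s\<bar> * f (Complex (cos \<alpha> * s) (cos \<alpha> * s * tan \<alpha>))
            = ennreal (cos \<alpha>) * (ennreal \<bar>s\<bar> * f (of_real s * cis \<alpha>))" for s
        proof -
          have "Complex (cos \<alpha> * s) (cos \<alpha> * s * tan \<alpha>) = of_real s * cis \<alpha>"
            using c by (simp add: cis tan_def)
          moreover have "ennreal \<bar>cos \<alpha> * s\<bar> = ennreal (cos \<alpha>) * ennreal \<bar>s\<bar>"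
            using c by (simp add: abs_mult ennreal_mult)
          ultimately show ?thesis by (simp only: mult.assoc)
        qed
        thus ?thesis by simp
      qed
      \<comment> \<open>One factor \<open>cos \<alpha>\<close> is the Jacobian of
        \<open>x = s cos \<alpha>\<close>, the other comes from the weight
        \<open>\<bar>x\<bar>\<close>. Together they cancel the derivative of the tangent.\<close>
      also have "\<dots> = ennreal ((cos \<alpha>)\<^sup>2) * (\<integral>\<^sup>+s. ennreal \<bar>s\<bar> * f (of_real s * cis \<alpha>) \<partial>lborel)"
        using c unfolding cis
        by (subst nn_integral_cmult) (auto simp: power2_eq_square ennreal_mult mult.assoc)
      also have "(\<integral>\<^sup>+s. ennreal \<bar>s\<bar> * f (of_real s * cis \<alpha>) \<partial>lborel) = F \<alpha> + F (\<alpha> + pi)"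
      proof -
        have m: "of_real (- s) * cis \<alpha> = of_real s * cis (\<alpha> + pi)" for s
          by (simp add: complex_eq_iff)
        have [measurable]: "(\<lambda>s. f (of_real s * cis \<alpha>)) \<in> borel_measurable borel"
          unfolding cis by measurable
        show ?thesis
          unfolding F_def m[symmetric] by (rule nn_integral_abs_split) measurable
      qed
      finally have "G (tan \<alpha>) * ennreal (inverse ((cos \<alpha>)\<^sup>2))
          = (ennreal ((cos \<alpha>)\<^sup>2) * ennreal (inverse ((cos \<alpha>)\<^sup>2))) * (F \<alpha> + F (\<alpha> + pi))"
        by (simp add: mult_ac)
      also have "ennreal ((cos \<alpha>)\<^sup>2) * ennreal (inverse ((cos \<alpha>)\<^sup>2)) = 1"
        using c by (simp flip: ennreal_mult)
      finally show ?thesis by simp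
    qed
    thus "G (tan \<alpha>) * ennreal (inverse ((cos \<alpha>)\<^sup>2)) * indicator {-(pi/2)<..<pi/2} \<alpha>
        = (F \<alpha> + F (\<alpha> + pi)) * indicator {-(pi/2)<..<pi/2} \<alpha>"
      by (auto simp: indicator_def)
  qed
  also have "\<dots> = (\<integral>\<^sup>+\<theta>. F \<theta> * indicator {0..<2*pi} \<theta> \<partial>lborel)"
  proof (rule nn_integral_periodic)
    have "cis (\<theta> + 2 * pi) = cis \<theta>" for \<theta>
      by (simp add: complex_eq_iff)
    thus "F (\<theta> + 2 * pi) = F \<theta>" for \<theta>
      by (simp only: F_def)
  qed fact
  finally show ?thesis by (simp add: F_def)
qed

section \<open>Areas of star-shaped regions\<close>

lemma sqrt_1_plus_sinh_square: "sqrt (1 + (sinh x)\<^sup>2) = cosh (x::real)"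
  by (rule real_sqrt_unique) (simp_all add: cosh_square_eq)

lemma borel_measurable_sinh [measurable]: "(sinh :: real \<Rightarrow> real) \<in> borel_measurable borel"
  by (intro borel_measurable_continuous_onI continuous_intros)

text \<open>The polar Jacobian \<open>s\<close> makes the density exact, with primitive
  \<open>sqrt (1 + s^2)\<close>. Nothing is asked of \<open>P\<close> at \<open>\<sigma>\<close>, a
  null point, so open and closed regions are treated alike.\<close>

lemma nn_integral_hyp_radial:
  fixes P :: "real \<Rightarrow> bool"
  assumes "0 \<le> \<sigma>" and "\<And>s. 0 \<le> s \<Longrightarrow> s < \<sigma> \<Longrightarrow> P s" and "\<And>s. \<sigma> < s \<Longrightarrow> \<not> P s"
  shows "(\<integral>\<^sup>+s. ennreal s * ennreal (of_bool (P s) / sqrt (1 + s\<^sup>2)) \<partial>lborel) = ennreal (sqrt (1 + \<sigma>\<^sup>2) - 1)"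
proof -
  have "(\<integral>\<^sup>+s. ennreal s * ennreal (of_bool (P s) / sqrt (1 + s\<^sup>2)) \<partial>lborel)
      = (\<integral>\<^sup>+s. ennreal (s / sqrt (1 + s\<^sup>2)) * indicator {0..\<sigma>} s \<partial>lborel)"
  proof (rule nn_integral_cong_AE)
    show "AE s in lborel. ennreal s * ennreal (of_bool (P s) / sqrt (1 + s\<^sup>2))
        = ennreal (s / sqrt (1 + s\<^sup>2)) * indicator {0..\<sigma>} s"
      using AE_lborel_singleton[of \<sigma>]
    proof eventually_elim
      case (elim s)
      consider "s < 0" | "0 \<le> s" "s < \<sigma>" | "\<sigma> < s" using elim by fastforce
      thus ?case
        using assms by cases (simp_all add: ennreal_neg flip: ennreal_mult)
    qed
  qed
  also have "\<dots> = ennreal (sqrt (1 + \<sigma>\<^sup>2) - sqrt (1 + 0\<^sup>2))"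
  proof (rule nn_integral_FTC_Icc)
    fix x :: real
    have "0 < 1 + x\<^sup>2" by (simp add: add_pos_nonneg)
    thus "((\<lambda>s. sqrt (1 + s\<^sup>2)) has_real_derivative x / sqrt (1 + x\<^sup>2)) (at x)"
      by (auto intro!: derivative_eq_intros simp: field_simps)
  qed (use assms in auto)
  finally show ?thesis by simp
qed

text \<open>The radial coordinate \<open>u\<close> is half the hyperbolic distance, so the threshold
  is put on \<open>sinh (2 * u)\<close>: the same boundary function then serves here and in
  \<open>nn_integral_hyp_radial\<close>. The primitive \<open>cosh (2 * u) / 4\<close> is the origin
  of the factor 1/4.\<close>

lemma nn_integral_sl_radial:
  fixes P :: "real \<Rightarrow> bool"
  assumes "0 \<le> \<sigma>" and "\<And>u. 0 \<le> u \<Longrightarrow> sinh (2 * u) < \<sigma> \<Longrightarrow> P u" and "\<And>u. 0 \<le> u \<Longrightarrow> \<sigma> < sinh (2 * u) \<Longrightarrow> \<not> P u"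
  shows "(\<integral>\<^sup>+u. ennreal (of_bool (0 \<le> u \<and> P u) * (sinh (2 * u) / 2)) \<partial>lborel)
    = ennreal ((sqrt (1 + \<sigma>\<^sup>2) - 1) / 4)"
proof -
  define v where "v = arsinh \<sigma> / 2"
  have v: "sinh (2 * v) = \<sigma>" "0 \<le> v"
    using assms(1) sinh_real_nonneg_iff[of "arsinh \<sigma>"] by (simp_all add: v_def)
  have "(\<integral>\<^sup>+u. ennreal (of_bool (0 \<le> u \<and> P u) * (sinh (2 * u) / 2)) \<partial>lborel)
      = (\<integral>\<^sup>+u. ennreal (sinh (2 * u) / 2) * indicator {0..v} u \<partial>lborel)"
  proof (rule nn_integral_cong_AE)
    show "AE u in lborel. ennreal (of_bool (0 \<le> u \<and> P u) * (sinh (2 * u) / 2))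
        = ennreal (sinh (2 * u) / 2) * indicator {0..v} u"
      using AE_lborel_singleton[of v]
    proof eventually_elim
      case (elim u)
      consider "u < 0" | "0 \<le> u" "u < v" | "v < u" "0 \<le> u" using elim v by fastforce
      thus ?case
      proof cases
        case 2
        hence "sinh (2 * u) < \<sigma>" by (simp flip: v(1))
        thus ?thesis using 2 assms by simp
      next
        case 3
        hence "\<sigma> < sinh (2 * u)" by (simp flip: v(1))
        thus ?thesis using 3 assms by simp
      qed simp
    qed
  qed
  also have "\<dots> = ennreal (cosh (2 * v) / 4 - cosh (2 * 0) / 4)"
  proof (rule nn_integral_FTC_Icc)
    show "((\<lambda>u. cosh (2 * u) / 4) has_real_derivative sinh (2 * x) / 2) (at x)" for x :: real
      by (auto intro!: derivative_eq_intros)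
  qed (use v in auto)
  also have "cosh (2 * v) = sqrt (1 + \<sigma>\<^sup>2)"
    using sqrt_1_plus_sinh_square[of "2 * v"] v(1) by simp
  finally show ?thesis by (simp add: diff_divide_distrib)
qed

lemma nn_integral_angular:
  fixes h :: "real \<Rightarrow> real"
  assumes "(h has_integral I) {0..2*pi}" and "\<And>\<theta>. \<theta> \<in> {0..2*pi} \<Longrightarrow> 0 \<le> h \<theta>"
  shows "(\<integral>\<^sup>+\<theta>. ennreal (h \<theta>) * indicator {0..<2*pi} \<theta> \<partial>lborel) = ennreal I"
proof -
  have "(\<integral>\<^sup>+\<theta>. ennreal (h \<theta>) * indicator {0..<2*pi} \<theta> \<partial>lborel)
      = (\<integral>\<^sup>+\<theta>. ennreal (h \<theta>) * indicator {0..2*pi} \<theta> \<partial>lborel)"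
  proof (rule nn_integral_cong_AE)
    show "AE \<theta> in lborel. ennreal (h \<theta>) * indicator {0..<2*pi} \<theta> = ennreal (h \<theta>) * indicator {0..2*pi} \<theta>"
      using AE_lborel_singleton[of "2*pi"] by eventually_elim (auto simp: indicator_def)
  qed
  thus ?thesis using nn_integral_has_integral_lebesgue'[OF assms(2,1)] by simp
qed

text \<open>Tonelli and polar coordinates apply to this extended nonnegative version before
  finiteness of the volume is known.\<close>

definition hyp_nn :: "'a::euclidean_space set \<Rightarrow> ennreal" where
  "hyp_nn S = (\<integral>\<^sup>+x. ennreal (indicator S x / sqrt (1 + (norm x)\<^sup>2)) \<partial>lborel)"

lemma hyp_vol_eq_hyp_nn:
  assumes [measurable]: "S \<in> sets borel"
  shows "hyp_vol S = enn2real (hyp_nn S)"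
  unfolding hyp_vol_def hyp_nn_def set_lebesgue_integral_def
  by (subst integral_eq_nn_integral) auto

text \<open>A point of Euclidean norm \<open>g \<theta>\<close> has hyperbolic distance
  \<open>arsinh (g \<theta>)\<close> from the centre, so the integrand is \<open>cosh - 1\<close> of
  the distance to the boundary. The behaviour on the boundary itself is left open.\<close>

theorem hyp_nn_star:
  fixes S :: "complex set"
  assumes S [measurable]: "S \<in> sets borel"
    and g: "\<And>\<theta>. \<theta> \<in> {0..2*pi} \<Longrightarrow> 0 \<le> g \<theta>"
    and star: "\<And>\<theta> s. \<theta> \<in> {0..2*pi} \<Longrightarrow> 0 \<le> s \<Longrightarrow> s < g \<theta> \<Longrightarrow> of_real s * cis \<theta> \<in> S"
              "\<And>\<theta> s. \<theta> \<in> {0..2*pi} \<Longrightarrow> 0 \<le> s \<Longrightarrow> g \<theta> < s \<Longrightarrow> of_real s * cis \<theta> \<notin> S"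
    and I: "((\<lambda>\<theta>. sqrt (1 + (g \<theta>)\<^sup>2) - 1) has_integral I) {0..2*pi}"
  shows "hyp_nn S = ennreal I"
proof -
  have "hyp_nn S = (\<integral>\<^sup>+\<theta>. (\<integral>\<^sup>+s. ennreal s * ennreal (indicator S (of_real s * cis \<theta>) /
      sqrt (1 + (norm (of_real s * cis \<theta>))\<^sup>2)) \<partial>lborel) * indicator {0..<2*pi} \<theta> \<partial>lborel)"
    unfolding hyp_nn_def by (rule nn_integral_polar) measurable
  also have "\<dots> = (\<integral>\<^sup>+\<theta>. ennreal (sqrt (1 + (g \<theta>)\<^sup>2) - 1) * indicator {0..<2*pi} \<theta> \<partial>lborel)"
  proof (rule nn_integral_cong)
    fix \<theta> :: real
    have "(\<integral>\<^sup>+s. ennreal s * ennreal (indicator S (of_real s * cis \<theta>) /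
        sqrt (1 + (norm (of_real s * cis \<theta>))\<^sup>2)) \<partial>lborel) = ennreal (sqrt (1 + (g \<theta>)\<^sup>2) - 1)"
      if "\<theta> \<in> {0..<2*pi}"
    proof -
      have "indicator S (of_real s * cis \<theta>) / sqrt (1 + (norm (of_real s * cis \<theta>))\<^sup>2)
          = of_bool (of_real s * cis \<theta> \<in> S) / sqrt (1 + s\<^sup>2)" for s
        by (simp add: norm_mult)
      thus ?thesis
        using that g[of \<theta>] star[of \<theta>]
        by (simp only:) (intro nn_integral_hyp_radial, auto)
    qed
    thus "(\<integral>\<^sup>+s. ennreal s * ennreal (indicator S (of_real s * cis \<theta>) /
        sqrt (1 + (norm (of_real s * cis \<theta>))\<^sup>2)) \<partial>lborel) * indicator {0..<2*pi} \<theta>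
        = ennreal (sqrt (1 + (g \<theta>)\<^sup>2) - 1) * indicator {0..<2*pi} \<theta>"
      by (auto simp: indicator_def)
  qed
  also have "\<dots> = ennreal I"
    using I by (rule nn_integral_angular) simp
  finally show ?thesis .
qed

text \<open>The coordinates are polar from the outset, so Tonelli suffices: the fibre coordinate
  integrates to 1, and exchanging \<open>r\<close> and \<open>\<theta>\<close> reduces the rest to
  the radial integral. Sharing \<open>g\<close> and \<open>I\<close> with \<open>hyp_nn_star\<close>
  is what makes the two areas comparable.\<close>

theorem sl_area_star:
  assumes D [measurable]: "D \<in> sets borel"
    and g: "\<And>\<theta>. \<theta> \<in> {0..2*pi} \<Longrightarrow> 0 \<le> g \<theta>"
    and star: "\<And>\<theta> u. \<theta> \<in> {0..2*pi} \<Longrightarrow> 0 \<le> u \<Longrightarrow> sinh (2 * u) < g \<theta> \<Longrightarrow> sl_point u \<theta> \<in> D"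
              "\<And>\<theta> u. \<theta> \<in> {0..2*pi} \<Longrightarrow> 0 \<le> u \<Longrightarrow> g \<theta> < sinh (2 * u) \<Longrightarrow> sl_point u \<theta> \<notin> D"
    and I: "((\<lambda>\<theta>. sqrt (1 + (g \<theta>)\<^sup>2) - 1) has_integral I) {0..2*pi}" and "0 \<le> I"
  shows "sl_area D = I / 4"
proof -
  have "continuous_on UNIV (\<lambda>p::real \<times> real. sl_point (fst p) (snd p))"
    unfolding sl_point_def by (intro continuous_intros) auto
  hence [measurable]: "(\<lambda>p. sl_point (fst p) (snd p)) \<in> borel_measurable (borel \<Otimes>\<^sub>M borel)"
    by (simp add: borel_prod borel_measurable_continuous_onI)
  have [measurable]: "(\<lambda>x. sl_point (a x) (b x)) \<in> borel_measurable M"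
    if [measurable]: "a \<in> borel_measurable M" "b \<in> borel_measurable M" for a b and M :: "'x measure"
  proof -
    have "(\<lambda>x. (\<lambda>p. sl_point (fst p) (snd p)) (a x, b x)) \<in> borel_measurable M"
      by measurable
    thus ?thesis by simp
  qed
  let ?f = "\<lambda>(r, \<theta>, \<phi>::real). of_bool (0 \<le> r \<and> sl_point r \<theta> \<in> D) * (sinh (2 * r) / 2) *
    (indicator {0..<2*pi} \<theta> * indicator {0..1} \<phi>) :: real"
  have f [measurable]: "?f \<in> borel_measurable (lborel \<Otimes>\<^sub>M (lborel \<Otimes>\<^sub>M lborel))"
    by measurable
  have "sl_area D = integral\<^sup>L (lborel \<Otimes>\<^sub>M (lborel \<Otimes>\<^sub>M lborel)) ?f"
    unfolding sl_area_def sl_vol_def set_lebesgue_integral_def lborel_prod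
    by (intro Bochner_Integration.integral_cong) (auto simp: sl_solid_def indicator_def)
  also have "\<dots> = enn2real (\<integral>\<^sup>+x. ennreal (?f x) \<partial>(lborel \<Otimes>\<^sub>M (lborel \<Otimes>\<^sub>M lborel)))"
    by (rule integral_eq_nn_integral[OF f]) auto
  also have "(\<integral>\<^sup>+x. ennreal (?f x) \<partial>(lborel \<Otimes>\<^sub>M (lborel \<Otimes>\<^sub>M lborel)))
      = (\<integral>\<^sup>+r. \<integral>\<^sup>+\<theta>. \<integral>\<^sup>+\<phi>. ennreal (?f (r, \<theta>, \<phi>)) \<partial>lborel \<partial>lborel \<partial>lborel)"
  proof -
    have "(\<integral>\<^sup>+x. ennreal (?f x) \<partial>(lborel \<Otimes>\<^sub>M (lborel \<Otimes>\<^sub>M lborel)))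
        = (\<integral>\<^sup>+r. \<integral>\<^sup>+y. ennreal (?f (r, y)) \<partial>(lborel \<Otimes>\<^sub>M lborel) \<partial>lborel)"
      by (rule sigma_finite_measure.nn_integral_fst[symmetric])
         (simp add: lborel_prod sigma_finite_lborel, rule measurable_compose[OF f measurable_ennreal])
    also have "\<dots> = (\<integral>\<^sup>+r. \<integral>\<^sup>+\<theta>. \<integral>\<^sup>+\<phi>. ennreal (?f (r, \<theta>, \<phi>)) \<partial>lborel \<partial>lborel \<partial>lborel)"
      by (intro nn_integral_cong lborel.nn_integral_fst[symmetric]) simp
    finally show ?thesis .
  qed
  also have "\<dots> = (\<integral>\<^sup>+r. \<integral>\<^sup>+\<theta>. ennreal (of_bool (0 \<le> r \<and> sl_point r \<theta> \<in> D) * (sinh (2 * r) / 2)) *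
      indicator {0..<2*pi} \<theta> \<partial>lborel \<partial>lborel)"
  proof (intro nn_integral_cong)
    fix r \<theta> :: real
    have "(\<integral>\<^sup>+\<phi>. ennreal (?f (r, \<theta>, \<phi>)) \<partial>lborel) = (\<integral>\<^sup>+\<phi>. ennreal (of_bool (0 \<le> r \<and> sl_point r \<theta> \<in> D) *
        (sinh (2 * r) / 2)) * indicator {0..<2*pi} \<theta> * indicator {0..1::real} \<phi> \<partial>lborel)"
      by (intro nn_integral_cong) (auto simp: indicator_def)
    also have "\<dots> = ennreal (of_bool (0 \<le> r \<and> sl_point r \<theta> \<in> D) * (sinh (2 * r) / 2)) * indicator {0..<2*pi} \<theta>"
      by (subst nn_integral_cmult) auto
    finally show "(\<integral>\<^sup>+\<phi>. ennreal (?f (r, \<theta>, \<phi>)) \<partial>lborel)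
      = ennreal (of_bool (0 \<le> r \<and> sl_point r \<theta> \<in> D) * (sinh (2 * r) / 2)) * indicator {0..<2*pi} \<theta>" .
  qed
  also have "\<dots> = (\<integral>\<^sup>+\<theta>. \<integral>\<^sup>+r. ennreal (of_bool (0 \<le> r \<and> sl_point r \<theta> \<in> D) * (sinh (2 * r) / 2)) *
      indicator {0..<2*pi} \<theta> \<partial>lborel \<partial>lborel)"
    by (rule lborel_pair.Fubini') measurable
  also have "\<dots> = (\<integral>\<^sup>+\<theta>. ennreal ((sqrt (1 + (g \<theta>)\<^sup>2) - 1) / 4) * indicator {0..<2*pi} \<theta> \<partial>lborel)"
  proof (intro nn_integral_cong)
    fix \<theta> :: real
    have "(\<integral>\<^sup>+r. ennreal (of_bool (0 \<le> r \<and> sl_point r \<theta> \<in> D) * (sinh (2 * r) / 2)) \<partial>lborel)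
        = ennreal ((sqrt (1 + (g \<theta>)\<^sup>2) - 1) / 4)" if "\<theta> \<in> {0..<2*pi}"
      using that g[of \<theta>] star[of \<theta>] by (intro nn_integral_sl_radial) auto
    thus "(\<integral>\<^sup>+r. ennreal (of_bool (0 \<le> r \<and> sl_point r \<theta> \<in> D) * (sinh (2 * r) / 2)) *
        indicator {0..<2*pi} \<theta> \<partial>lborel) = ennreal ((sqrt (1 + (g \<theta>)\<^sup>2) - 1) / 4) * indicator {0..<2*pi} \<theta>"
      by (auto simp: indicator_def)
  qed
  also have "\<dots> = ennreal (I / 4)"
    using has_integral_divide[OF I, of 4] by (intro nn_integral_angular) auto
  finally show ?thesis using \<open>0 \<le> I\<close> by simp
qed

section \<open>Distance from the centre and areas of discs\<close>

lemma hyp_dist_0: "hyp_dist 0 x = arcosh (sqrt (1 + (norm x)\<^sup>2))"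
  by (simp add: hyp_dist_def mink_def lift_def)

lemma hyp_dist_0_eq_arsinh: "hyp_dist 0 x = arsinh (norm x)"
proof -
  have "cosh (arsinh (norm x)) = sqrt (1 + (norm x)\<^sup>2)"
    by (simp add: cosh_arsinh_real add.commute)
  moreover have "0 \<le> arsinh (norm x)"
    using sinh_real_nonneg_iff[of "arsinh (norm x)"] by simp
  ultimately show ?thesis
    by (metis arcosh_cosh_real hyp_dist_0)
qed

lemma hyp_disc_eq_cball: "hyp_disc \<rho> = cball 0 (sinh \<rho>)"
proof -
  have "arsinh (cmod x) \<le> \<rho> \<longleftrightarrow> cmod x \<le> sinh \<rho>" for x
    using sinh_real_le_iff[of "arsinh (cmod x)" \<rho>] by simp
  thus ?thesis by (simp add: set_eq_iff hyp_disc_def hyp_dist_0_eq_arsinh)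
qed

lemma hyp_vol_disc:
  assumes "0 \<le> \<rho>"
  shows "hyp_vol (hyp_disc \<rho>) = 2 * pi * (cosh \<rho> - 1)"
proof -
  have "((\<lambda>\<theta>. sqrt (1 + (sinh \<rho>)\<^sup>2) - 1) has_integral (2 * pi - 0) *\<^sub>R (cosh \<rho> - 1)) {0..2*pi}"
    using has_integral_const_real[of "cosh \<rho> - 1" 0 "2*pi"] by (simp add: sqrt_1_plus_sinh_square)
  moreover have "0 \<le> cosh \<rho> - 1" by (simp add: cosh_real_ge_1)
  ultimately show ?thesis
    using assms hyp_nn_star[of "cball 0 (sinh \<rho>)" "\<lambda>_. sinh \<rho>" "2 * pi * (cosh \<rho> - 1)"]
    by (simp add: hyp_disc_eq_cball hyp_vol_eq_hyp_nn norm_mult)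
qed

lemma tanh_artanh_real:
  assumes "\<bar>x::real\<bar> < 1"
  shows "tanh (artanh x) = x"
proof -
  define y where "y = (1 + x) / (1 - x)"
  have y: "0 < y" using assms by (simp add: y_def)
  hence "artanh x = ln (sqrt y)" by (simp add: artanh_def y_def ln_sqrt)
  hence "tanh (artanh x) = (y - 1) / (y + 1)" using y by (simp add: tanh_ln_real)
  also have "\<dots> = x" using assms by (simp add: y_def field_simps)
  finally show ?thesis .
qed

lemma sl_disc_eq:
  assumes "0 \<le> \<rho>"
  shows "sl_disc \<rho> = cball 0 (tanh \<rho>)"
proof (intro equalityI subsetI)
  fix z :: complex assume "z \<in> sl_disc \<rho>"
  thus "z \<in> cball 0 (tanh \<rho>)" by (auto simp: sl_disc_def sl_point_def norm_mult)
next
  fix z :: complex assume "z \<in> cball 0 (tanh \<rho>)"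
  hence z: "cmod z \<le> tanh \<rho>" by simp
  moreover have "tanh \<rho> < 1" by (rule tanh_real_lt_1)
  ultimately have t: "tanh (artanh (cmod z)) = cmod z" by (intro tanh_artanh_real) simp
  have "z = sl_point (artanh (cmod z)) (Arg z)"
    unfolding sl_point_def t by (metis cis_conv_exp rcis_cmod_Arg rcis_def)
  moreover have "0 \<le> artanh (cmod z)" "artanh (cmod z) \<le> \<rho>"
    using z t tanh_real_le_iff[of "artanh (cmod z)" \<rho>] tanh_real_nonneg_iff[of "artanh (cmod z)"] by simp_all
  ultimately show "z \<in> sl_disc \<rho>" unfolding sl_disc_def by blast
qed

lemma sl_area_disc:
  assumes "0 \<le> \<rho>"
  shows "sl_area (sl_disc \<rho>) = 2 * pi * (cosh (2 * \<rho>) - 1) / 4"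
proof -
  have "((\<lambda>\<theta>. sqrt (1 + (sinh (2 * \<rho>))\<^sup>2) - 1) has_integral (2 * pi - 0) *\<^sub>R (cosh (2 * \<rho>) - 1)) {0..2*pi}"
    using has_integral_const_real[of "cosh (2 * \<rho>) - 1" 0 "2*pi"] by (simp add: sqrt_1_plus_sinh_square)
  moreover have "0 \<le> cosh (2 * \<rho>) - 1" by (simp add: cosh_real_ge_1)
  ultimately show ?thesis
    using assms sl_area_star[of "cball 0 (tanh \<rho>)" "\<lambda>_. sinh (2 * \<rho>)" "2 * pi * (cosh (2 * \<rho>) - 1)"]
    by (simp add: sl_disc_eq norm_mult sl_point_def)
qed

lemma cos_le_outside:
  fixes x a :: real
  assumes "a \<le> x" "x \<le> 2 * pi - a" "0 \<le> a"
  shows "cos x \<le> cos a"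
proof (cases "x \<le> pi")
  case True
  thus ?thesis using assms by (intro cos_monotone_0_pi_le) auto
next
  case False
  have "cos x = cos (2 * pi - x)" by simp
  also have "\<dots> \<le> cos a" using assms False by (intro cos_monotone_0_pi_le) auto
  finally show ?thesis .
qed

text \<open>The inequality compares the Klein norm \<open>s / sqrt (1 + s^2)\<close> with
  \<open>t / m\<close>; both sides are nonnegative, so squaring solves it for \<open>s\<close>. It
  is used with \<open>m = width \<theta>\<close> and \<open>t = \<tau>\<close> to locate the
  boundary of the tile on a ray.\<close>

lemma threshold_iff:
  fixes s m t :: real
  assumes "0 < t" "t < m" "0 \<le> s"
  shows "s * m < t * sqrt (1 + s\<^sup>2) \<longleftrightarrow> s < t / sqrt (m\<^sup>2 - t\<^sup>2)"
    and "t * sqrt (1 + s\<^sup>2) < s * m \<longleftrightarrow> t / sqrt (m\<^sup>2 - t\<^sup>2) < s"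
proof -
  have d: "0 < m\<^sup>2 - t\<^sup>2" using assms by (simp add: power_strict_mono)
  hence sd: "0 < sqrt (m\<^sup>2 - t\<^sup>2)" by simp
  have sq: "x < y \<longleftrightarrow> x\<^sup>2 < y\<^sup>2" if "0 \<le> x" "0 \<le> y" for x y :: real
    using that by (metis abs_of_nonneg abs_square_less_1 power2_less_imp_less power_strict_mono zero_less_numeral)
  have e: "(s * m)\<^sup>2 = s\<^sup>2 * m\<^sup>2" "(t * sqrt (1 + s\<^sup>2))\<^sup>2 = t\<^sup>2 + s\<^sup>2 * t\<^sup>2"
    "(s * sqrt (m\<^sup>2 - t\<^sup>2))\<^sup>2 = s\<^sup>2 * m\<^sup>2 - s\<^sup>2 * t\<^sup>2"
    using d by (simp_all add: power_mult_distrib algebra_simps)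
  have "s < t / sqrt (m\<^sup>2 - t\<^sup>2) \<longleftrightarrow> s * sqrt (m\<^sup>2 - t\<^sup>2) < t"
    using sd by (simp add: pos_less_divide_eq)
  also have "\<dots> \<longleftrightarrow> s * m < t * sqrt (1 + s\<^sup>2)"
    using assms sd by (subst (1 2) sq) (auto simp only: e intro!: mult_nonneg_nonneg less_imp_le[OF d] real_sqrt_ge_zero add_nonneg_nonneg zero_le_one zero_le_power2)
  finally show "s * m < t * sqrt (1 + s\<^sup>2) \<longleftrightarrow> s < t / sqrt (m\<^sup>2 - t\<^sup>2)" ..
  have "t / sqrt (m\<^sup>2 - t\<^sup>2) < s \<longleftrightarrow> t < s * sqrt (m\<^sup>2 - t\<^sup>2)"
    using sd by (simp add: pos_divide_less_eq)
  also have "\<dots> \<longleftrightarrow> t * sqrt (1 + s\<^sup>2) < s * m"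
    using assms sd by (subst (1 2) sq) (auto simp only: e intro!: mult_nonneg_nonneg less_imp_le[OF d] real_sqrt_ge_zero add_nonneg_nonneg zero_le_one zero_le_power2)
  finally show "t * sqrt (1 + s\<^sup>2) < s * m \<longleftrightarrow> t / sqrt (m\<^sup>2 - t\<^sup>2) < s" ..
qed

section \<open>Solids over plane regions\<close>

lemma h2r_vol_solid:
  assumes [measurable]: "D \<in> sets borel" and "0 \<le> h"
  shows "h2r_vol (h2r_solid D h) = hyp_vol D * h"
proof -
  have m: "h2r_solid D h \<in> sets (borel \<Otimes>\<^sub>M borel)"
    unfolding h2r_solid_def by measurable
  let ?f = "\<lambda>(x, t). indicator D x / sqrt (1 + (norm x)\<^sup>2) * indicator {0..h} t :: real"
  have f: "?f \<in> borel_measurable (lborel \<Otimes>\<^sub>M lborel)"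
    by measurable
  have "h2r_vol (h2r_solid D h) = integral\<^sup>L (lborel \<Otimes>\<^sub>M lborel) ?f"
    unfolding h2r_vol_def set_lebesgue_integral_def lborel_prod
    by (intro Bochner_Integration.integral_cong) (auto simp: h2r_solid_def indicator_def)
  also have "\<dots> = enn2real (\<integral>\<^sup>+x. ennreal (?f x) \<partial>(lborel \<Otimes>\<^sub>M lborel))"
    by (rule integral_eq_nn_integral[OF f]) auto
  also have "(\<integral>\<^sup>+x. ennreal (?f x) \<partial>(lborel \<Otimes>\<^sub>M lborel)) = (\<integral>\<^sup>+x. \<integral>\<^sup>+t. ennreal (?f (x, t)) \<partial>lborel \<partial>lborel)"
    by (rule lborel.nn_integral_fst[symmetric], rule measurable_compose[OF f measurable_ennreal])
  also have "\<dots> = (\<integral>\<^sup>+x. ennreal (indicator D x / sqrt (1 + (norm x)\<^sup>2)) * ennreal h \<partial>lborel)"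
  proof (rule nn_integral_cong)
    fix x :: complex
    have "(\<integral>\<^sup>+t. ennreal (?f (x, t)) \<partial>lborel)
        = (\<integral>\<^sup>+t. ennreal (indicator D x / sqrt (1 + (norm x)\<^sup>2)) * indicator {0..h} t \<partial>lborel)"
      by (intro nn_integral_cong) (auto simp: indicator_def)
    also have "\<dots> = ennreal (indicator D x / sqrt (1 + (norm x)\<^sup>2)) * ennreal h"
      using \<open>0 \<le> h\<close> by (subst nn_integral_cmult) auto
    finally show "(\<integral>\<^sup>+t. ennreal (?f (x, t)) \<partial>lborel)
      = ennreal (indicator D x / sqrt (1 + (norm x)\<^sup>2)) * ennreal h" .
  qed
  also have "\<dots> = hyp_nn D * ennreal h"
    unfolding hyp_nn_def by (rule nn_integral_multc) measurable
  finally show ?thesis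
    using \<open>0 \<le> h\<close> by (simp add: hyp_vol_eq_hyp_nn enn2real_mult)
qed

lemma nn_integral_scale:
  fixes f :: "'a::euclidean_space \<Rightarrow> ennreal"
  assumes [measurable]: "f \<in> borel_measurable borel" and c: "c \<noteq> 0"
  shows "(\<integral>\<^sup>+x. f x \<partial>lborel) = ennreal (\<bar>c\<bar> ^ DIM('a)) * (\<integral>\<^sup>+x. f (c *\<^sub>R x) \<partial>lborel)"
  by (subst lborel_affine[OF c, of 0])
     (simp add: nn_integral_density nn_integral_distr nn_integral_cmult)

text \<open>With \<open>z = sinh t\<close> as height, the slice of the solid is \<open>D\<close>
  enlarged by \<open>cosh t = sqrt (1 + z^2)\<close>. This removes the fibre parameter and makes
  measurability and slicing immediate.\<close>

lemma h3_solid_eq: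
  "h3_solid D h = {(x, z). 0 \<le> z \<and> z \<le> sinh h \<and> (1 / sqrt (1 + z\<^sup>2)) *\<^sub>R x \<in> D}"
proof (intro equalityI subsetI)
  note c = sqrt_1_plus_sinh_square
  fix y :: "complex \<times> real"
  {
    assume "y \<in> h3_solid D h"
    thus "y \<in> {(x, z). 0 \<le> z \<and> z \<le> sinh h \<and> (1 / sqrt (1 + z\<^sup>2)) *\<^sub>R x \<in> D}"
      by (auto simp: h3_solid_def h3_fibre_def c)
  next
    assume y: "y \<in> {(x, z). 0 \<le> z \<and> z \<le> sinh h \<and> (1 / sqrt (1 + z\<^sup>2)) *\<^sub>R x \<in> D}"
    define t where "t = arsinh (snd y)"
    have t: "sinh t = snd y" by (simp add: t_def)
    have "y = h3_fibre ((1 / cosh t) *\<^sub>R fst y) t"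
      by (simp add: h3_fibre_def t)
    moreover have "(1 / cosh t) *\<^sub>R fst y \<in> D" using y by (auto simp: c[symmetric] t)
    moreover have "0 \<le> t" "t \<le> h"
      using y t sinh_real_le_iff[of t h] sinh_real_nonneg_iff[of t] by (auto simp del: sinh_real_le_iff sinh_real_nonneg_iff)
    ultimately show "y \<in> h3_solid D h" unfolding h3_solid_def by blast
  }
qed

text \<open>Write \<open>w = sqrt (1 + z^2)\<close>. Rescaling the slice by \<open>w\<close> brings
  the Jacobian \<open>w^2\<close>, while the density at the rescaled point is \<open>1 / w\<close>
  times the planar one, so each slice contributes \<open>w\<close> times the planar area. With
  \<open>z = sinh t\<close> the remaining integral is that of \<open>cosh^2\<close>.\<close>

lemma h3_vol_solid:
  assumes D [measurable]: "D \<in> sets borel" and "0 < h"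
  shows "hyp_vol (h3_solid D h) = hyp_vol D * integral {0..sinh h} (\<lambda>z. sqrt (1 + z\<^sup>2))"
proof -
  let ?w = "\<lambda>z::real. sqrt (1 + z\<^sup>2)"
  have w: "?w z > 0" "?w z \<noteq> 0" for z by (simp_all add: add_pos_nonneg sum_squares_eq_zero_iff add_nonneg_eq_0_iff)
  let ?W = "{p \<in> space (borel \<Otimes>\<^sub>M borel). 0 \<le> snd p \<and> snd p \<le> sinh h \<and> (1 / ?w (snd p)) *\<^sub>R fst p \<in> D}"
  have "?W \<in> sets (borel \<Otimes>\<^sub>M borel)" by measurable
  also have "?W = h3_solid D h"
    by (auto simp: h3_solid_eq space_pair_measure)
  finally have S: "h3_solid D h \<in> sets borel" unfolding borel_prod .
  let ?f = "\<lambda>(x, z). indicator D ((1 / ?w z) *\<^sub>R x) / sqrt (1 + ((norm x)\<^sup>2 + z\<^sup>2)) * indicator {0..sinh h} z :: real"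
  have f: "?f \<in> borel_measurable (lborel \<Otimes>\<^sub>M lborel)"
    by measurable
  have "hyp_nn (h3_solid D h) = (\<integral>\<^sup>+x. ennreal (?f x) \<partial>(lborel \<Otimes>\<^sub>M lborel))"
    unfolding hyp_nn_def lborel_prod
    by (intro nn_integral_cong) (auto simp: h3_solid_eq indicator_def norm_Pair)
  also have "\<dots> = (\<integral>\<^sup>+z. \<integral>\<^sup>+x. ennreal (?f (x, z)) \<partial>lborel \<partial>lborel)"
    by (rule lborel_pair.nn_integral_snd[symmetric], rule measurable_compose[OF f measurable_ennreal])
  also have "\<dots> = (\<integral>\<^sup>+z. hyp_nn D * (ennreal (?w z) * indicator {0..sinh h} z) \<partial>lborel)"
  proof (rule nn_integral_cong)
    fix z :: real
    have "(\<integral>\<^sup>+x. ennreal (?f (x, z)) \<partial>lborel) = hyp_nn D * ennreal (?w z)" if z: "z \<in> {0..sinh h}"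
    proof -
      have "(\<integral>\<^sup>+x. ennreal (?f (x, z)) \<partial>lborel)
          = (\<integral>\<^sup>+x. ennreal (indicator D ((1 / ?w z) *\<^sub>R x) / sqrt (1 + ((norm x)\<^sup>2 + z\<^sup>2))) \<partial>lborel)"
        using z by simp
      also have "\<dots> = ennreal ((?w z)\<^sup>2) * (\<integral>\<^sup>+x. ennreal (indicator D ((1 / ?w z) *\<^sub>R (?w z *\<^sub>R x)) /
          sqrt (1 + ((norm (?w z *\<^sub>R x))\<^sup>2 + z\<^sup>2))) \<partial>lborel)"
        using w(1)[of z] by (subst nn_integral_scale[where c = "?w z"]) auto
      also have "\<dots> = ennreal ((?w z)\<^sup>2) *
          (\<integral>\<^sup>+x. ennreal (1 / ?w z) * ennreal (indicator D x / sqrt (1 + (norm x)\<^sup>2)) \<partial>lborel)"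
      proof -
        have "1 + ((norm (?w z *\<^sub>R x))\<^sup>2 + z\<^sup>2) = (?w z)\<^sup>2 * (1 + (norm x)\<^sup>2)" for x :: complex
          by (simp add: power_mult_distrib algebra_simps)
        hence "sqrt (1 + ((norm (?w z *\<^sub>R x))\<^sup>2 + z\<^sup>2)) = ?w z * sqrt (1 + (norm x)\<^sup>2)" for x :: complex
          using w(1)[of z] by (simp only: real_sqrt_mult real_sqrt_abs abs_of_pos)
        moreover have "(1 / ?w z) *\<^sub>R (?w z *\<^sub>R x) = x" for x :: complex
          using w[of z] by simp
        ultimately show ?thesis using w[of z] by (simp only:) (simp flip: ennreal_mult)
      qed
      also have "\<dots> = ennreal ((?w z)\<^sup>2 * (1 / ?w z)) * hyp_nn D"
        unfolding hyp_nn_def using w(1)[of z]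
        by (subst nn_integral_cmult) (simp_all only: ennreal_mult mult.assoc zero_le_power2 zero_le_divide_1_iff less_imp_le, measurable)
      also have "(?w z)\<^sup>2 * (1 / ?w z) = ?w z" using w(1)[of z] by (simp add: real_div_sqrt)
      finally show ?thesis by (simp add: mult.commute)
    qed
    thus "(\<integral>\<^sup>+x. ennreal (?f (x, z)) \<partial>lborel) = hyp_nn D * (ennreal (?w z) * indicator {0..sinh h} z)"
      by (auto simp: indicator_def)
  qed
  also have "\<dots> = hyp_nn D * (\<integral>\<^sup>+z. ennreal (?w z) * indicator {0..sinh h} z \<partial>lborel)"
    by (rule nn_integral_cmult) measurable
  also have "(\<integral>\<^sup>+z. ennreal (?w z) * indicator {0..sinh h} z \<partial>lborel) = ennreal (integral {0..sinh h} ?w)"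
    by (intro nn_integral_has_integral_lebesgue' integrable_integral integrable_continuous_real continuous_intros) simp
  finally have "hyp_nn (h3_solid D h) = hyp_nn D * ennreal (integral {0..sinh h} ?w)" .
  moreover have "0 \<le> integral {0..sinh h} ?w"
    by (intro integral_nonneg integrable_continuous_real continuous_intros) simp
  ultimately show ?thesis
    using S D by (simp add: hyp_vol_eq_hyp_nn enn2real_mult)
qed

lemma h3_height_factor_pos:
  assumes "0 < h"
  shows "0 < integral {0..sinh h} (\<lambda>z. sqrt (1 + z\<^sup>2))"
proof -
  have "0 < sinh h" using assms by simp
  also have "sinh h = integral {0..sinh h} (\<lambda>z. 1)" using assms by simp
  also have "\<dots> \<le> integral {0..sinh h} (\<lambda>z. sqrt (1 + z\<^sup>2))"
    by (intro integral_le integrable_continuous_real continuous_intros) auto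
  finally show ?thesis .
qed

lemma h2r_density_eq:
  assumes "D \<in> sets borel" "M \<in> sets borel"
  shows "h2r_density D M = hyp_vol D / hyp_vol M"
proof -
  have "h2r_vol (h2r_solid D h) / h2r_vol (h2r_solid M h) = hyp_vol D / hyp_vol M" if "0 < h" for h
    using that assms by (simp add: h2r_vol_solid)
  note eq = this
  show ?thesis unfolding h2r_density_def
  proof (rule the_equality)
    fix d assume "\<forall>h>0. h2r_vol (h2r_solid D h) / h2r_vol (h2r_solid M h) = d"
    thus "d = hyp_vol D / hyp_vol M" using eq[of 1] by (auto dest: spec[of _ 1])
  qed (use eq in simp)
qed

lemma h3_density_eq:
  assumes "D \<in> sets borel" "M \<in> sets borel"
  shows "h3_density D M = hyp_vol D / hyp_vol M"
proof -
  have "hyp_vol (h3_solid D h) / hyp_vol (h3_solid M h) = hyp_vol D / hyp_vol M" if "0 < h" for h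
    using that assms h3_height_factor_pos[OF that] by (simp add: h3_vol_solid)
  note eq = this
  show ?thesis unfolding h3_density_def
  proof (rule the_equality)
    fix d assume "\<forall>h>0. hyp_vol (h3_solid D h) / hyp_vol (h3_solid M h) = d"
    thus "d = hyp_vol D / hyp_vol M" using eq[of 1] by (auto dest: spec[of _ 1])
  qed (use eq in simp)
qed

section \<open>Regular mosaics\<close>

locale mosaic =
  fixes p q :: nat
  assumes mosaic: "(p, q) \<in> schlaefli"
begin

text \<open>Twice \<open>A\<close> is the angle under which a side is seen from the centre, twice \<open>B\<close> the interior angle;
  \<open>R\<close> and \<open>r\<close> are the hyperbolic circumradius and inradius.  In the Klein model the sides lie on the
  lines at Euclidean distance \<open>\<tau>\<close> from the centre.\<close>

definition A :: real where "A = pi / real p"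
definition B :: real where "B = pi / real q"
definition R :: real where "R = arcosh (cot A * cot B)"
definition r :: real where "r = arcosh (cos B / sin A)"
definition \<tau> :: real where "\<tau> = tanh r"

lemma p_ge_3: "3 \<le> p" and q_gr_0: "0 < q" and pq: "1 / real p + 1 / real q < 1 / 2"
proof -
  show p: "3 \<le> p" using mosaic by (simp add: schlaefli_def)
  have q: "2 * real p / (real p - 2) < real q" using mosaic by (simp add: schlaefli_def)
  moreover have "0 < 2 * real p / (real p - 2)" using p by simp
  ultimately show "0 < q" by linarith
  have "2 * real p < real q * (real p - 2)" using q p by (simp add: pos_divide_less_eq)
  thus "1 / real p + 1 / real q < 1 / 2" using p \<open>0 < q\<close> by (simp add: field_simps)
qed

lemma A_pos: "0 < A" and B_pos: "0 < B" and A_le: "A \<le> pi / 3" and AB: "A + B < pi / 2"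
  and p_A: "real p * A = pi"
proof -
  show "0 < A" "0 < B" "A \<le> pi / 3" "real p * A = pi"
    using p_ge_3 q_gr_0 by (auto simp: A_def B_def field_simps)
  have "A + B = pi * (1 / real p + 1 / real q)" by (simp add: A_def B_def algebra_simps)
  also have "\<dots> < pi * (1 / 2)" using pq by (intro mult_strict_left_mono) auto
  finally show "A + B < pi / 2" by simp
qed

lemma B_le: "B \<le> pi / 3"
proof -
  have "1 / real q < 1 / 2" using pq by (smt (verit) divide_nonneg_nonneg of_nat_0_le_iff)
  hence "2 < q" using q_gr_0 by (simp add: field_simps)
  hence "3 \<le> q" by simp
  thus "B \<le> pi / 3" using q_gr_0 by (simp add: B_def field_simps)
qed

lemma trig_pos: "0 < sin A" "0 < cos A" "0 < sin B" "0 < cos B" "sin A < cos B" "sin B < cos A"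
proof -
  show "0 < sin A" "0 < sin B" using A_pos B_pos AB by (auto intro!: sin_gt_zero)
  show "0 < cos A" "0 < cos B" using A_pos B_pos AB by (auto intro!: cos_gt_zero)
  have "sin A < sin (pi / 2 - B)" using A_pos B_pos AB by (subst sin_mono_less_eq) auto
  thus "sin A < cos B" by (simp add: sin_cos_eq)
  have "sin B < sin (pi / 2 - A)" using A_pos B_pos AB by (subst sin_mono_less_eq) auto
  thus "sin B < cos A" by (simp add: sin_cos_eq)
qed

lemma cosh_R: "cosh R = cot A * cot B" and R_pos: "0 < R"
proof -
  have "sin A * sin B < cos B * cos A" using trig_pos by (intro mult_strict_mono) auto
  hence gt: "1 < cot A * cot B" using trig_pos by (simp add: cot_def field_simps)
  thus "cosh R = cot A * cot B" by (simp add: R_def)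
  thus "0 < R" using gt by (simp add: R_def arcosh_real_gt_1_iff)
qed

lemma cosh_r: "cosh r = cos B / sin A" and r_pos: "0 < r"
proof -
  have gt: "1 < cos B / sin A" using trig_pos by simp
  thus "cosh r = cos B / sin A" by (simp add: r_def)
  show "0 < r" using gt trig_pos by (simp add: r_def arcosh_real_gt_1_iff)
qed

lemma tau_square: "\<tau>\<^sup>2 = 1 - (sin A / cos B)\<^sup>2" and tau_pos: "0 < \<tau>" and tau_less_1: "\<tau> < 1"
proof -
  show "0 < \<tau>" "\<tau> < 1" using r_pos by (simp_all add: \<tau>_def tanh_real_lt_1)
  have "\<tau>\<^sup>2 = (sinh r)\<^sup>2 / (cosh r)\<^sup>2" by (simp add: \<tau>_def tanh_def power_divide)
  also have "(sinh r)\<^sup>2 = (cosh r)\<^sup>2 - 1" by (simp add: cosh_square_eq)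
  also have "((cosh r)\<^sup>2 - 1) / (cosh r)\<^sup>2 = 1 - (1 / cosh r)\<^sup>2"
    by (simp add: diff_divide_distrib power_divide)
  finally show "\<tau>\<^sup>2 = 1 - (sin A / cos B)\<^sup>2" by (simp add: cosh_r)
qed

text \<open>This is the right triangle formed by the centre, the midpoint of a side and a vertex,
  with angle \<open>A\<close> at the centre. In the Klein model its sides at the centre have
  Euclidean lengths \<open>tanh r\<close> and \<open>tanh R\<close>.\<close>

lemma tau_eq: "\<tau> = tanh R * cos A"
proof -
  have c: "cosh R \<noteq> 0" by simp
  have "(tanh R * cos A)\<^sup>2 = (cos A)\<^sup>2 * ((cosh R)\<^sup>2 - 1) / (cosh R)\<^sup>2"
    by (simp add: tanh_def power_mult_distrib power_divide cosh_square_eq)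
  also have "\<dots> = (cos A)\<^sup>2 - (cos A)\<^sup>2 / (cosh R)\<^sup>2"
    using c by (simp add: field_simps)
  also have "\<dots> = (cos A)\<^sup>2 - (sin A)\<^sup>2 * (sin B)\<^sup>2 / (cos B)\<^sup>2"
    using trig_pos by (simp add: cosh_R cot_def field_simps)
  also have "\<dots> = 1 - (sin A / cos B)\<^sup>2"
    using trig_pos by (simp add: cos_squared_eq[of A] sin_squared_eq[of B] power_divide field_simps)
  also have "\<dots> = \<tau>\<^sup>2" by (simp add: tau_square)
  finally show ?thesis
    using tau_pos R_pos trig_pos by (simp add: power2_eq_iff_nonneg)
qed

lemma tau_less: "\<tau> < cos A"
  using trig_pos tanh_real_lt_1[of R] by (simp add: tau_eq)

text \<open>The direction of the midpoint of the side from vertex \<open>i\<close> to vertex \<open>i + 1\<close>.\<close>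

definition mid :: "nat \<Rightarrow> real" where "mid i = (2 * real i + 1) * A"

text \<open>Midpoint directions are spaced by \<open>2 * A\<close>, so a direction within
  \<open>A\<close> of one of them is at least \<open>A\<close> away from all others. The bound
  \<open>k \<le> real p - 1\<close> keeps this true around the circle: the difference is also at
  most \<open>2 * pi - A\<close>.\<close>

lemma cos_shift_le:
  assumes "i < p" "j < p" "\<bar>\<theta> - mid i\<bar> \<le> A"
  shows "cos (\<theta> - mid j) \<le> cos (\<theta> - mid i)"
proof (cases "i = j")
  case False
  define k :: real where "k = \<bar>real i - real j\<bar>"
  have k: "1 \<le> k" "k \<le> real p - 1" using assms False by (auto simp: k_def abs_if)
  have kA: "1 * A \<le> k * A" "k * A \<le> (real p - 1) * A"
    using k A_pos by (auto intro!: mult_right_mono)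
  define x where "x = (if j < i then \<theta> - mid j else mid j - \<theta>)"
  have "A \<le> x" "x \<le> 2 * pi - A"
    using kA assms(3) p_A by (auto simp: x_def k_def mid_def abs_if algebra_simps split: if_splits)
  hence "cos x \<le> cos A" using A_pos by (intro cos_le_outside) auto
  also have "cos A \<le> cos \<bar>\<theta> - mid i\<bar>"
    using assms(3) A_pos AB B_pos by (intro cos_monotone_0_pi_le) auto
  also have "cos x = cos (\<theta> - mid j)"
    using cos_minus[of "\<theta> - mid j"] by (auto simp: x_def)
  finally show ?thesis by simp
qed simp

lemma sector_exists:
  assumes "\<theta> \<in> {0..2*pi}"
  obtains i where "i < p" "\<bar>\<theta> - mid i\<bar> \<le> A"
\<comment> \<open>The full turn closes the last sector; the floor used in the other case would
  return the invalid index \<open>p\<close> here.\<close>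
proof (cases "\<theta> = 2 * pi")
  case True
  show thesis
  proof (rule that)
    show "p - 1 < p" using p_ge_3 by simp
    have "real (p - 1) = real p - 1" using p_ge_3 by simp
    hence "mid (p - 1) = 2 * (real p * A) - A" unfolding mid_def by (simp add: algebra_simps)
    thus "\<bar>\<theta> - mid (p - 1)\<bar> \<le> A" using True A_pos by (simp add: p_A)
  qed
next
  case False
  define i where "i = nat \<lfloor>\<theta> / (2 * A)\<rfloor>"
  have x: "0 \<le> \<theta> / (2 * A)" "\<theta> / (2 * A) < real p"
    using assms False A_pos p_A by (auto simp: field_simps)
  have i: "real i \<le> \<theta> / (2 * A)" "\<theta> / (2 * A) < real i + 1"
    using x by (auto simp: i_def)
  show thesis
  proof (rule that)
    show "i < p" using i x by linarith
    have "real i * (2 * A) \<le> \<theta>" "\<theta> < (real i + 1) * (2 * A)"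
      using i A_pos by (auto simp: pos_le_divide_eq pos_divide_less_eq)
    thus "\<bar>\<theta> - mid i\<bar> \<le> A" by (auto simp: mid_def abs_if algebra_simps)
  qed
qed

text \<open>Along a ray the conditions of all \<open>p\<close> sides have the same right-hand side,
  so only the largest cosine matters.\<close>

definition width :: "real \<Rightarrow> real" where
  "width \<theta> = Max ((\<lambda>i. cos (\<theta> - mid i)) ` {..<p})"

lemma width_sector:
  assumes "i < p" "\<bar>\<theta> - mid i\<bar> \<le> A"
  shows "width \<theta> = cos (\<theta> - mid i)"
  unfolding width_def using assms cos_shift_le[OF assms(1) _ assms(2)] by (intro Max_eqI) auto

text \<open>The smallest value occurs in the directions of the vertices. Together with
  \<open>tau_less\<close> it keeps the radicand in \<open>reach\<close> positive.\<close>

lemma width_ge: "\<theta> \<in> {0..2*pi} \<Longrightarrow> cos A \<le> width \<theta>"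
proof -
  assume "\<theta> \<in> {0..2*pi}"
  then obtain i where i: "i < p" "\<bar>\<theta> - mid i\<bar> \<le> A" by (rule sector_exists)
  have "cos A \<le> cos \<bar>\<theta> - mid i\<bar>"
    using i A_pos AB B_pos by (intro cos_monotone_0_pi_le) auto
  thus ?thesis using i by (simp add: width_sector)
qed

lemma width_iff:
  assumes "0 \<le> s"
  shows "(\<forall>i<p. s * cos (\<theta> - mid i) < X) \<longleftrightarrow> s * width \<theta> < X"
    and "(\<forall>i<p. s * cos (\<theta> - mid i) \<le> X) \<longleftrightarrow> s * width \<theta> \<le> X"
proof -
  have fin: "finite ((\<lambda>i. cos (\<theta> - mid i)) ` {..<p})" "(\<lambda>i. cos (\<theta> - mid i)) ` {..<p} \<noteq> {}"
    using p_ge_3 by (auto simp: lessThan_empty_iff)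
  obtain j where j: "j < p" "width \<theta> = cos (\<theta> - mid j)"
    using Max_in[OF fin] unfolding width_def by auto
  have "cos (\<theta> - mid i) \<le> width \<theta>" if "i < p" for i
    unfolding width_def using that fin by (intro Max_ge) auto
  hence "s * cos (\<theta> - mid i) \<le> s * width \<theta>" if "i < p" for i
    using that assms by (intro mult_left_mono) auto
  thus "(\<forall>i<p. s * cos (\<theta> - mid i) < X) \<longleftrightarrow> s * width \<theta> < X"
    "(\<forall>i<p. s * cos (\<theta> - mid i) \<le> X) \<longleftrightarrow> s * width \<theta> \<le> X"
    using j by (metis order_le_less_trans, metis order_trans)
qed

text \<open>The norm, in the hyperboloid coordinate, of the boundary point of the tile in direction \<open>\<theta>\<close>.\<close>

definition reach :: "real \<Rightarrow> real" where
  "reach \<theta> = \<tau> / sqrt ((width \<theta>)\<^sup>2 - \<tau>\<^sup>2)"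

text \<open>The polygon consists of \<open>2 * p\<close> right triangles with the further angles
  \<open>A\<close> and \<open>B\<close>, each having area equal to its angle defect.\<close>

definition area :: real where "area = 2 * real p * (pi / 2 - A - B)"

lemma area_pos: "0 < area"
  using p_ge_3 AB by (simp add: area_def)

lemma reach_integrand:
  assumes "\<theta> \<in> {0..2*pi}"
  shows "sqrt (1 + (reach \<theta>)\<^sup>2) - 1 = width \<theta> / sqrt ((width \<theta>)\<^sup>2 - \<tau>\<^sup>2) - 1"
proof -
  have w: "\<tau> < width \<theta>" using width_ge[OF assms] tau_less by simp
  hence d: "0 < (width \<theta>)\<^sup>2 - \<tau>\<^sup>2" using tau_pos by (simp add: power_strict_mono)
  have "1 + (reach \<theta>)\<^sup>2 = (width \<theta> / sqrt ((width \<theta>)\<^sup>2 - \<tau>\<^sup>2))\<^sup>2"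
    using d by (simp add: reach_def power_divide field_simps)
  thus ?thesis using d w tau_pos by simp
qed

text \<open>Put \<open>\<kappa> = sin A / cos B\<close>, which is \<open>1 / cosh r\<close>. Then
  \<open>cos^2 - \<tau>^2 = \<kappa>^2 - sin^2\<close>, so the integrand has the primitive
  \<open>arcsin (sin \<phi> / \<kappa>) - \<theta>\<close>. At the ends
  \<open>sin A / \<kappa> = cos B\<close> turns the arcsine into \<open>pi / 2 - B\<close>: the
  sector is a pair of right triangles.\<close>

lemma sector_integral:
  assumes "i < p"
  shows "((\<lambda>\<theta>. sqrt (1 + (reach \<theta>)\<^sup>2) - 1) has_integral 2 * (pi / 2 - A - B)) {mid i - A..mid i + A}"
proof -
  define \<kappa> where "\<kappa> = sin A / cos B"
  have \<kappa>: "0 < \<kappa>" "\<tau>\<^sup>2 = 1 - \<kappa>\<^sup>2" using trig_pos by (simp_all add: \<kappa>_def tau_square)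
  define F where "F \<theta> = arcsin (sin (\<theta> - mid i) / \<kappa>) - \<theta>" for \<theta>
  have "((\<lambda>\<theta>. sqrt (1 + (reach \<theta>)\<^sup>2) - 1) has_integral F (mid i + A) - F (mid i - A)) {mid i - A..mid i + A}"
  proof (rule fundamental_theorem_of_calculus)
    fix \<theta> assume \<theta>: "\<theta> \<in> {mid i - A..mid i + A}"
    define \<phi> where "\<phi> = \<theta> - mid i"
    have \<phi>: "\<bar>\<phi>\<bar> \<le> A" using \<theta> by (auto simp: \<phi>_def abs_if)
    have "0 \<le> mid i - A" using A_pos by (simp add: mid_def algebra_simps)
    moreover have "mid i + A \<le> 2 * pi"
    proof -
      have "(2 * real i + 2) * A \<le> (2 * real p) * A" using assms A_pos by (intro mult_right_mono) auto
      thus ?thesis using p_A by (simp add: mid_def algebra_simps)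
    qed
    ultimately have \<theta>': "\<theta> \<in> {0..2*pi}" using \<theta> by auto
    have w: "width \<theta> = cos \<phi>" using assms \<phi> by (simp add: \<phi>_def width_sector)
    have lt: "\<tau> < cos \<phi>" using width_ge[OF \<theta>'] tau_less by (simp add: w)
    hence d: "0 < (cos \<phi>)\<^sup>2 - \<tau>\<^sup>2" using tau_pos by (simp add: power_strict_mono)
    have e: "1 - (sin \<phi> / \<kappa>)\<^sup>2 = ((cos \<phi>)\<^sup>2 - \<tau>\<^sup>2) / \<kappa>\<^sup>2"
      using \<kappa> by (simp add: cos_squared_eq power_divide field_simps)
    have "0 < 1 - (sin \<phi> / \<kappa>)\<^sup>2" unfolding e using d \<kappa> by simp
    hence "\<bar>sin \<phi> / \<kappa>\<bar> < 1" by (simp add: abs_square_less_1)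
    hence b: "-1 < sin \<phi> / \<kappa>" "sin \<phi> / \<kappa> < 1" by linarith+
    have "(F has_real_derivative inverse (sqrt (1 - (sin \<phi> / \<kappa>)\<^sup>2)) * (cos \<phi> / \<kappa>) - 1) (at \<theta>)"
      unfolding F_def[abs_def] using b \<kappa>(1) unfolding \<phi>_def
      by (auto intro!: derivative_eq_intros DERIV_arcsin)
    also have "inverse (sqrt (1 - (sin \<phi> / \<kappa>)\<^sup>2)) * (cos \<phi> / \<kappa>) = cos \<phi> / sqrt ((cos \<phi>)\<^sup>2 - \<tau>\<^sup>2)"
      unfolding e real_sqrt_divide using \<kappa>(1) by simp
    also have "cos \<phi> / sqrt ((cos \<phi>)\<^sup>2 - \<tau>\<^sup>2) - 1 = sqrt (1 + (reach \<theta>)\<^sup>2) - 1"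
      by (simp add: reach_integrand[OF \<theta>'] w)
    finally show "(F has_vector_derivative sqrt (1 + (reach \<theta>)\<^sup>2) - 1) (at \<theta> within {mid i - A..mid i + A})"
      by (simp add: has_real_derivative_iff_has_vector_derivative has_vector_derivative_at_within)
  qed (use A_pos in simp)
  also have "F (mid i + A) - F (mid i - A) = 2 * (pi / 2 - A - B)"
  proof -
    have "sin A / \<kappa> = cos B" using trig_pos by (simp add: \<kappa>_def)
    also have "\<dots> = sin (pi / 2 - B)" by (simp add: sin_cos_eq)
    finally have "arcsin (sin A / \<kappa>) = pi / 2 - B"
      using B_pos AB A_pos by (simp add: arcsin_sin)
    moreover have "arcsin (- (sin A / \<kappa>)) = - arcsin (sin A / \<kappa>)"
      using \<open>sin A / \<kappa> = cos B\<close> by (intro arcsin_minus) (auto simp: abs_le_iff)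
    ultimately show ?thesis by (simp add: F_def algebra_simps)
  qed
  finally show ?thesis .
qed

lemma reach_integral: "((\<lambda>\<theta>. sqrt (1 + (reach \<theta>)\<^sup>2) - 1) has_integral area) {0..2*pi}"
proof -
  let ?h = "\<lambda>\<theta>. sqrt (1 + (reach \<theta>)\<^sup>2) - 1"
  have "(?h has_integral real n * (2 * (pi / 2 - A - B))) {0..2 * real n * A}" if "n \<le> p" for n
    using that
  proof (induction n)
    case 0
    show ?case using has_integral_refl(2)[of ?h 0] by simp
  next
    case (Suc n)
    have "(?h has_integral 2 * (pi / 2 - A - B)) {2 * real n * A..2 * real (Suc n) * A}"
      using sector_integral[of n] Suc.prems by (simp add: mid_def algebra_simps)
    from has_integral_combine[OF _ _ Suc.IH this] show ?case
      using Suc.prems A_pos by (simp add: algebra_simps)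
  qed
  from this[of p] have "(?h has_integral real p * (2 * (pi / 2 - A - B))) {0..2 * (real p * A)}"
    by (simp only: mult.assoc order_refl)
  thus ?thesis by (simp only: p_A area_def mult_ac)
qed

lemma reach_nonneg: "\<theta> \<in> {0..2*pi} \<Longrightarrow> 0 \<le> reach \<theta>"
  using tau_pos tau_less width_ge[of \<theta>] by (simp add: reach_def)

text \<open>The strict form describes the open base figure, the weak form the closed tile.\<close>

lemma reach_iff:
  assumes "\<theta> \<in> {0..2*pi}" "0 \<le> s"
  shows "s < reach \<theta> \<longleftrightarrow> (\<forall>i<p. s * cos (\<theta> - mid i) < \<tau> * sqrt (1 + s\<^sup>2))"
    and "s \<le> reach \<theta> \<longleftrightarrow> (\<forall>i<p. s * cos (\<theta> - mid i) \<le> \<tau> * sqrt (1 + s\<^sup>2))"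
proof -
  have w: "\<tau> < width \<theta>" using width_ge[OF assms(1)] tau_less by simp
  note th = threshold_iff[OF tau_pos w \<open>0 \<le> s\<close>]
  show "s < reach \<theta> \<longleftrightarrow> (\<forall>i<p. s * cos (\<theta> - mid i) < \<tau> * sqrt (1 + s\<^sup>2))"
    unfolding width_iff[OF \<open>0 \<le> s\<close>] reach_def th(1) ..
  show "s \<le> reach \<theta> \<longleftrightarrow> (\<forall>i<p. s * cos (\<theta> - mid i) \<le> \<tau> * sqrt (1 + s\<^sup>2))"
    using th(2) unfolding width_iff[OF \<open>0 \<le> s\<close>] reach_def by (simp only: not_less[symmetric])
qed

end

section \<open>The tile\<close>

lemma inner_polar_cis: "(of_real s * cis \<theta>) \<bullet> cis \<phi> = s * cos (\<theta> - \<phi>)"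
  by (simp add: inner_complex_def cos_diff algebra_simps)

lemma lift_ngon_vertex: "lift (ngon_vertex n \<rho> i) = (cosh \<rho>, ngon_vertex n \<rho> i)"
  by (simp add: lift_def ngon_vertex_def norm_mult sqrt_1_plus_sinh_square)

lemma mink_hyp_dir:
  "mink (hyp_dir x y) (hyp_dir x z)
    = mink (lift y) (lift z) + mink (lift x) (lift y) * mink (lift x) (lift z)"
proof -
  have "mink (hyp_dir x y) (hyp_dir x z) = mink (lift y) (lift z)
      + 2 * mink (lift x) (lift y) * mink (lift x) (lift z)
      + mink (lift x) (lift y) * mink (lift x) (lift z) * mink (lift x) (lift x)"
    by (simp add: mink_def hyp_dir_def algebra_simps inner_add_left inner_add_right inner_commute)
  thus ?thesis by (simp add: mink_lift_self)
qed

text \<open>Up to sign this is \<open>cosh\<close> of the distance between two vertices. The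
  half-angle form makes the later angle computation polynomial in
  \<open>(sinh \<rho> sin A)^2\<close> and \<open>cos A\<close>.\<close>

lemma mink_ngon_vertex:
  "mink (lift (ngon_vertex n \<rho> i)) (lift (ngon_vertex n \<rho> j))
    = - (1 + 2 * (sinh \<rho>)\<^sup>2 * (sin ((real i - real j) * (pi / real n)))\<^sup>2)"
proof -
  have "ngon_vertex n \<rho> i \<bullet> ngon_vertex n \<rho> j
      = (sinh \<rho>)\<^sup>2 * cos (2 * pi * real i / real n - 2 * pi * real j / real n)"
    unfolding ngon_vertex_def
    by (simp add: inner_complex_def cos_diff power2_eq_square algebra_simps)
  also have "2 * pi * real i / real n - 2 * pi * real j / real n = 2 * ((real i - real j) * (pi / real n))"
    by (simp add: algebra_simps diff_divide_distrib)
  also have "cos \<dots> = 1 - 2 * (sin ((real i - real j) * (pi / real n)))\<^sup>2"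
    by (rule cos_double_sin)
  finally have "ngon_vertex n \<rho> i \<bullet> ngon_vertex n \<rho> j
      = (sinh \<rho>)\<^sup>2 * (1 - 2 * (sin ((real i - real j) * (pi / real n)))\<^sup>2)" .
  moreover have "cosh \<rho> * cosh \<rho> = (sinh \<rho>)\<^sup>2 + 1"
    by (simp add: cosh_square_eq flip: power2_eq_square)
  ultimately show ?thesis
    unfolding mink_def lift_ngon_vertex fst_conv snd_conv by (simp only:) (simp add: algebra_simps)
qed

lemma convex_cone_hull_doubleton:
  "convex_cone hull {u, v} = {a *\<^sub>R u + b *\<^sub>R v | a b. 0 \<le> a \<and> 0 \<le> b}"
proof (intro equalityI hull_minimal subsetI)
  fix x assume "x \<in> {u, v}"
  moreover have "u = 1 *\<^sub>R u + 0 *\<^sub>R v" "v = 0 *\<^sub>R u + 1 *\<^sub>R v" by simp_all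
  ultimately show "x \<in> {a *\<^sub>R u + b *\<^sub>R v | a b. 0 \<le> a \<and> 0 \<le> b}"
    using zero_le_one[where 'a=real] by blast
next
  show "convex_cone {a *\<^sub>R u + b *\<^sub>R v | a b. 0 \<le> a \<and> 0 \<le> b}"
    unfolding convex_cone_iff
  proof (intro conjI ballI allI impI)
    have "0 = 0 *\<^sub>R u + 0 *\<^sub>R v" by simp
    thus "0 \<in> {a *\<^sub>R u + b *\<^sub>R v | a b. 0 \<le> a \<and> 0 \<le> b}" by blast
  next
    fix x y assume "x \<in> {a *\<^sub>R u + b *\<^sub>R v | a b. 0 \<le> a \<and> 0 \<le> b}"
      and "y \<in> {a *\<^sub>R u + b *\<^sub>R v | a b. 0 \<le> a \<and> 0 \<le> b}"
    then obtain a b a' b' where "0 \<le> a" "0 \<le> b" "0 \<le> a'" "0 \<le> b'"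
      "x = a *\<^sub>R u + b *\<^sub>R v" "y = a' *\<^sub>R u + b' *\<^sub>R v"
      by blast
    hence "0 \<le> a + a'" "0 \<le> b + b'" "x + y = (a + a') *\<^sub>R u + (b + b') *\<^sub>R v"
      by (simp_all add: algebra_simps)
    thus "x + y \<in> {a *\<^sub>R u + b *\<^sub>R v | a b. 0 \<le> a \<and> 0 \<le> b}" by blast
  next
    fix x and c :: real assume "0 \<le> c" "x \<in> {a *\<^sub>R u + b *\<^sub>R v | a b. 0 \<le> a \<and> 0 \<le> b}"
    then obtain a b where "0 \<le> a" "0 \<le> b" "x = a *\<^sub>R u + b *\<^sub>R v"
      by blast
    hence "0 \<le> c * a" "0 \<le> c * b" "c *\<^sub>R x = (c * a) *\<^sub>R u + (c * b) *\<^sub>R v"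
      using \<open>0 \<le> c\<close> by (simp_all add: algebra_simps)
    thus "c *\<^sub>R x \<in> {a *\<^sub>R u + b *\<^sub>R v | a b. 0 \<le> a \<and> 0 \<le> b}" by blast
  qed
next
  fix x assume "x \<in> {a *\<^sub>R u + b *\<^sub>R v | a b. 0 \<le> a \<and> 0 \<le> b}"
  then obtain a b where ab: "0 \<le> a" "0 \<le> b" "x = a *\<^sub>R u + b *\<^sub>R v"
    by blast
  have "u \<in> convex_cone hull {u, v}" "v \<in> convex_cone hull {u, v}"
    by (simp_all add: hull_inc)
  thus "x \<in> convex_cone hull {u, v}"
    unfolding ab(3) using ab by (intro convex_cone_hull_add convex_cone_hull_mul)
qed

text \<open>An admissible radius is the attained minimum of \<open>d\<close> on each curve, so a
  single curve already determines it; hence the family must be nonempty.\<close>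

lemma touching_radius_unique:
  assumes "\<S> \<noteq> {}" "0 < \<rho>" and "\<And>S. S \<in> \<S> \<Longrightarrow> \<exists>x\<in>S. d x = \<rho>" and "\<And>S x. S \<in> \<S> \<Longrightarrow> x \<in> S \<Longrightarrow> \<rho> \<le> d x"
  shows "touching_radius d \<S> = \<rho>"
  unfolding touching_radius_def
proof (rule the_equality)
  show "0 < \<rho> \<and> (\<forall>S\<in>\<S>. (\<exists>x\<in>S. d x = \<rho>) \<and> (\<forall>x\<in>S. \<rho> \<le> d x))"
    using assms by blast
  fix r' assume r': "0 < r' \<and> (\<forall>S\<in>\<S>. (\<exists>x\<in>S. d x = r') \<and> (\<forall>x\<in>S. r' \<le> d x))"
  obtain S where S: "S \<in> \<S>" using assms(1) by blast
  obtain x y where "x \<in> S" "d x = \<rho>" "y \<in> S" "d y = r'" using assms(3)[OF S] r' S by blast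
  thus "r' = \<rho>" using assms(4)[OF S \<open>y \<in> S\<close>] r' S by force
qed

section \<open>The circumradius determined by the interior angle\<close>

context mosaic
begin

lemma hyp_angle_ngon:
  assumes "0 < \<rho>"
  shows "hyp_angle (ngon_vertex p \<rho> (i + 1)) (ngon_vertex p \<rho> i) (ngon_vertex p \<rho> (i + 2))
    = arccos (1 - 2 * (cos A)\<^sup>2 / (1 + (sinh \<rho>)\<^sup>2 * (sin A)\<^sup>2))"
proof -
  \<comment> \<open>Since \<open>1 + 2 * k\<close> is \<open>cosh\<close> of the side length
    \<open>L\<close>, this is \<open>sinh (L / 2)\<close> squared.\<close>
  define k where "k = (sinh \<rho>)\<^sup>2 * (sin A)\<^sup>2"
  have k: "0 < k" using assms trig_pos by (simp add: k_def)
  let ?v = "\<lambda>i. ngon_vertex p \<rho> i" and ?m = "\<lambda>x y. mink (lift x) (lift y)"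
  have m1: "?m (?v (i + 1)) (?v i) = - (1 + 2 * k)" "?m (?v (i + 1)) (?v (i + 2)) = - (1 + 2 * k)"
    "?m (?v i) (?v i) = - 1" "?m (?v (i + 2)) (?v (i + 2)) = - 1"
    by (simp_all add: mink_ngon_vertex k_def A_def)
  have "(sin ((real i - real (i + 2)) * (pi / real p)))\<^sup>2 = (sin (2 * A))\<^sup>2"
    by (simp add: A_def)
  also have "\<dots> = 4 * (sin A)\<^sup>2 * (cos A)\<^sup>2"
    by (simp add: sin_double power_mult_distrib)
  finally have m2: "?m (?v i) (?v (i + 2)) = - (1 + 8 * k * (cos A)\<^sup>2)"
    by (simp add: mink_ngon_vertex k_def)
  have n: "mink (hyp_dir (?v (i + 1)) (?v i)) (hyp_dir (?v (i + 1)) (?v i)) = 4 * k * (1 + k)"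
    "mink (hyp_dir (?v (i + 1)) (?v (i + 2))) (hyp_dir (?v (i + 1)) (?v (i + 2))) = 4 * k * (1 + k)"
    unfolding mink_hyp_dir m1 by (simp_all add: algebra_simps power2_eq_square)
  have "mink (hyp_dir (?v (i + 1)) (?v i)) (hyp_dir (?v (i + 1)) (?v (i + 2)))
      = 4 * k * ((1 + k) - 2 * (cos A)\<^sup>2)"
    unfolding mink_hyp_dir m1 m2 by (simp add: algebra_simps power2_eq_square)
  moreover have "sqrt (4 * k * (1 + k)) * sqrt (4 * k * (1 + k)) = 4 * k * (1 + k)"
    using k by simp
  moreover have "4 * k * ((1 + k) - 2 * (cos A)\<^sup>2) / (4 * k * (1 + k)) = 1 - 2 * (cos A)\<^sup>2 / (1 + k)"
    using k by (simp add: diff_divide_distrib)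
  ultimately show ?thesis unfolding hyp_angle_def n by (simp add: k_def)
qed

text \<open>By \<open>1 - cos (2 * B) = 2 * (sin B)^2\<close> the angle condition is the square of
  \<open>cos A = sin B * cosh (L / 2)\<close>, with \<open>L\<close> the side length: a relation in
  the right triangle over half a side. Expressing \<open>L\<close> by \<open>\<rho>\<close> leaves
  \<open>cosh \<rho> = cot A * cot B\<close>, and \<open>cosh\<close> is injective on positive
  numbers.\<close>

lemma angle_eq_iff:
  assumes "0 < \<rho>"
  shows "arccos (1 - 2 * (cos A)\<^sup>2 / (1 + (sinh \<rho>)\<^sup>2 * (sin A)\<^sup>2)) = 2 * pi / real q \<longleftrightarrow> \<rho> = R"
proof -
  define X where "X = 1 - 2 * (cos A)\<^sup>2 / (1 + (sinh \<rho>)\<^sup>2 * (sin A)\<^sup>2)"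
  have d: "1 \<le> 1 + (sinh \<rho>)\<^sup>2 * (sin A)\<^sup>2" by simp
  have "(cos A)\<^sup>2 \<le> 1" by (simp add: abs_square_le_1)
  hence "(cos A)\<^sup>2 / (1 + (sinh \<rho>)\<^sup>2 * (sin A)\<^sup>2) \<le> 1" using d by (subst divide_le_eq_1_pos) linarith+
  moreover have "0 \<le> (cos A)\<^sup>2 / (1 + (sinh \<rho>)\<^sup>2 * (sin A)\<^sup>2)" by simp
  moreover have "X = 1 - 2 * ((cos A)\<^sup>2 / (1 + (sinh \<rho>)\<^sup>2 * (sin A)\<^sup>2))" by (simp add: X_def)
  ultimately have X: "-1 \<le> X" "X \<le> 1" by linarith+
  have q: "2 * pi / real q = 2 * B" by (simp add: B_def)
  have "arccos (cos (2 * B)) = 2 * B"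
    using B_pos AB A_pos by (intro arccos_cos) auto
  hence "arccos X = 2 * pi / real q \<longleftrightarrow> X = cos (2 * B)"
    using cos_arccos[OF X] unfolding q by auto
  also have "\<dots> \<longleftrightarrow> (cos A)\<^sup>2 = (sin B)\<^sup>2 * (1 + (sinh \<rho>)\<^sup>2 * (sin A)\<^sup>2)"
  proof -
    have "X = cos (2 * B) \<longleftrightarrow> (cos A)\<^sup>2 / (1 + (sinh \<rho>)\<^sup>2 * (sin A)\<^sup>2) = (sin B)\<^sup>2"
      unfolding X_def cos_double_sin times_divide_eq_right[symmetric] by linarith
    thus ?thesis using d by (simp add: divide_eq_eq)
  qed
  also have "\<dots> \<longleftrightarrow> (cosh \<rho>)\<^sup>2 = (cot A * cot B)\<^sup>2"
  proof -
    have "(cosh \<rho>)\<^sup>2 = (cot A * cot B)\<^sup>2 \<longleftrightarrow> (sin A)\<^sup>2 * (sin B)\<^sup>2 * (cosh \<rho>)\<^sup>2 = (cos A)\<^sup>2 * (cos B)\<^sup>2"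
      using trig_pos by (auto simp: cot_def power_mult_distrib power_divide field_simps)
    also have "\<dots> \<longleftrightarrow> (cos A)\<^sup>2 = (sin B)\<^sup>2 * (1 + (sinh \<rho>)\<^sup>2 * (sin A)\<^sup>2)"
      by (auto simp: cosh_square_eq cos_squared_eq algebra_simps)
    finally show ?thesis by simp
  qed
  also have "\<dots> \<longleftrightarrow> cosh \<rho> = cosh R"
    by (metis cosh_R cosh_real_nonneg power2_eq_iff_nonneg)
  also have "\<dots> \<longleftrightarrow> \<rho> = R" using assms R_pos by simp
  finally show ?thesis by (simp add: X_def)
qed

lemma tile_circumradius: "tile_circumradius p q = R"
  unfolding tile_circumradius_def
proof (rule the_equality)
  show "0 < R \<and> (\<forall>i<p. hyp_angle (ngon_vertex p R (i + 1)) (ngon_vertex p R i) (ngon_vertex p R (i + 2))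
      = 2 * pi / real q)"
    using R_pos by (simp only: hyp_angle_ngon angle_eq_iff) simp
  fix \<rho> assume "0 < \<rho> \<and> (\<forall>i<p. hyp_angle (ngon_vertex p \<rho> (i + 1)) (ngon_vertex p \<rho> i) (ngon_vertex p \<rho> (i + 2))
      = 2 * pi / real q)"
  moreover have "0 < p" using p_ge_3 by simp
  ultimately have "0 < \<rho>" "hyp_angle (ngon_vertex p \<rho> (0 + 1)) (ngon_vertex p \<rho> 0) (ngon_vertex p \<rho> (0 + 2)) = 2 * pi / real q"
    by blast+
  thus "\<rho> = R" by (simp only: hyp_angle_ngon angle_eq_iff)
qed

lemma tile_vertex_eq: "tile_vertex p q i = of_real (sinh R) * cis (2 * real i * A)"
  by (simp add: tile_vertex_def ngon_vertex_def tile_circumradius A_def mult_ac)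

lemma lift_tile_vertex: "lift (tile_vertex p q i) = (cosh R, of_real (sinh R) * cis (2 * real i * A))"
  using lift_ngon_vertex[of p R i]
  by (simp add: tile_vertex_eq[symmetric]) (simp add: tile_vertex_def tile_circumradius)

section \<open>The tile as an intersection of half-planes, and its inradius\<close>

lemma tile_vertex_p: "tile_vertex p q p = tile_vertex p q 0"
proof -
  have "2 * real p * A = 2 * pi" using p_A by simp
  thus ?thesis by (simp only: tile_vertex_eq) simp
qed

text \<open>The powers of the primitive root \<open>cis (2 * A)\<close> sum to 0, so the lifted
  vertices add up to a positive multiple of \<open>(1, 0)\<close>. This vector takes up the slack in
  \<open>tile_eq\<close>.\<close>

lemma lift_0_in_hull: "(1, 0) \<in> convex_cone hull (lift ` tile_vertex p q ` {..<p})"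
proof -
  define z where "z = cis (2 * A)"
  have "Im z > 0" using trig_pos by (simp add: z_def sin_double)
  hence "z \<noteq> 1" by auto
  moreover have "z ^ p = 1"
  proof -
    have "z ^ p = cis (real p * (2 * A))" unfolding z_def by (rule Complex.DeMoivre)
    also have "real p * (2 * A) = 2 * pi" using p_A by simp
    finally show ?thesis by simp
  qed
  ultimately have "(\<Sum>i<p. z ^ i) = 0" by (simp add: geometric_sum)
  moreover have "of_real (sinh R) * cis (2 * real i * A) = of_real (sinh R) * z ^ i" for i
    unfolding z_def Complex.DeMoivre by (simp only: mult_ac)
  ultimately have s: "(\<Sum>i<p. of_real (sinh R) * cis (2 * real i * A)) = 0"
    by (simp only: sum_distrib_left[symmetric] mult_zero_right)
  have "(\<Sum>i<n. lift (tile_vertex p q i)) \<in> convex_cone hull (lift ` tile_vertex p q ` {..<p})" if "n \<le> p" for n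
    using that
  proof (induction n)
    case (Suc n)
    have "lift (tile_vertex p q n) \<in> convex_cone hull (lift ` tile_vertex p q ` {..<p})"
      using Suc.prems by (intro hull_inc) auto
    thus ?case using Suc by (simp add: convex_cone_hull_add)
  qed (simp add: convex_cone_hull_contains_0)
  from this[of p] have "(\<Sum>i<p. lift (tile_vertex p q i)) \<in> convex_cone hull (lift ` tile_vertex p q ` {..<p})" by simp
  also have "(\<Sum>i<p. lift (tile_vertex p q i)) = (real p * cosh R, 0)"
    unfolding lift_tile_vertex by (rule prod_eqI) (simp_all add: fst_sum snd_sum s)
  finally have "(1 / (real p * cosh R)) *\<^sub>R (real p * cosh R, 0) \<in> convex_cone hull (lift ` tile_vertex p q ` {..<p})"
    by (intro convex_cone_hull_mul) auto
  thus ?thesis using p_ge_3 by simp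
qed

text \<open>Resolving a direction along the two vertex directions of its sector gives weights
  proportional to the sines of the angles to the opposite vertex directions. The sum of the weights
  is recorded because it fixes the time coordinate of the same combination of lifted
  vertices.\<close>

lemma vertices_combination:
  assumes "\<bar>\<theta> - mid i\<bar> \<le> A"
  obtains a b where "0 \<le> a" "0 \<le> b"
    "of_real s * cis \<theta> = (s * a) *\<^sub>R tile_vertex p q i + (s * b) *\<^sub>R tile_vertex p q (i + 1)"
    "a + b = cos (\<theta> - mid i) / (sinh R * cos A)"
proof
  define \<phi> where "\<phi> = \<theta> - mid i"
  define N where "N = sinh R * sin (2 * A)"
  have N': "N = sinh R * (2 * sin A * cos A)" by (simp add: N_def sin_double)
  have N: "0 < N" using R_pos trig_pos by (simp add: N')
  have \<phi>: "0 \<le> A - \<phi>" "A - \<phi> \<le> pi" "0 \<le> A + \<phi>" "A + \<phi> \<le> pi"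
    using assms AB B_pos by (auto simp: \<phi>_def abs_if split: if_splits)
  show "0 \<le> sin (A - \<phi>) / N" "0 \<le> sin (A + \<phi>) / N"
    using \<phi> N by (auto intro!: divide_nonneg_pos sin_ge_zero)
  show "sin (A - \<phi>) / N + sin (A + \<phi>) / N = cos (\<theta> - mid i) / (sinh R * cos A)"
  proof -
    have "sin (A - \<phi>) / N + sin (A + \<phi>) / N = 2 * sin A * cos \<phi> / N"
      by (simp add: sin_add sin_diff add_divide_distrib[symmetric])
    also have "\<dots> = cos \<phi> / (sinh R * cos A)"
      using trig_pos R_pos by (simp add: N')
    finally show ?thesis by (simp add: \<phi>_def)
  qed
  have v: "2 * real i * A = mid i - A" "2 * real (i + 1) * A = mid i + A"
    by (simp_all add: mid_def algebra_simps)
  have key: "sin (A - \<phi>) * cos (mid i - A) + sin (A + \<phi>) * cos (mid i + A) = sin (2 * A) * cos \<theta>"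
    "sin (A - \<phi>) * sin (mid i - A) + sin (A + \<phi>) * sin (mid i + A) = sin (2 * A) * sin \<theta>"
  proof -
    have t: "\<theta> = mid i + \<phi>" by (simp add: \<phi>_def)
    have c: "(cos A)\<^sup>2 = 1 - (sin A)\<^sup>2" by (rule cos_squared_eq)
    show "sin (A - \<phi>) * cos (mid i - A) + sin (A + \<phi>) * cos (mid i + A) = sin (2 * A) * cos \<theta>"
      unfolding t sin_double sin_add sin_diff cos_add cos_diff by algebra
    show "sin (A - \<phi>) * sin (mid i - A) + sin (A + \<phi>) * sin (mid i + A) = sin (2 * A) * sin \<theta>"
      unfolding t sin_double sin_add sin_diff cos_add cos_diff by algebra
  qed
  have N2: "sinh R / N = 1 / sin (2 * A)" using R_pos by (simp add: N_def)
  have s2: "sin (2 * A) \<noteq> 0" using trig_pos by (simp add: sin_double)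
  show "of_real s * cis \<theta> = (s * (sin (A - \<phi>) / N)) *\<^sub>R tile_vertex p q i
      + (s * (sin (A + \<phi>) / N)) *\<^sub>R tile_vertex p q (i + 1)"
  proof (rule complex_eqI)
    have "Re ((s * (sin (A - \<phi>) / N)) *\<^sub>R tile_vertex p q i + (s * (sin (A + \<phi>) / N)) *\<^sub>R tile_vertex p q (i + 1))
        = s * (sinh R / N) * (sin (A - \<phi>) * cos (mid i - A) + sin (A + \<phi>) * cos (mid i + A))"
      unfolding tile_vertex_eq v by (simp add: algebra_simps)
    also have "\<dots> = s * cos \<theta>" unfolding key N2 using s2 by simp
    finally show "Re (of_real s * cis \<theta>) = Re ((s * (sin (A - \<phi>) / N)) *\<^sub>R tile_vertex p q i
      + (s * (sin (A + \<phi>) / N)) *\<^sub>R tile_vertex p q (i + 1))" by simp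
    have "Im ((s * (sin (A - \<phi>) / N)) *\<^sub>R tile_vertex p q i + (s * (sin (A + \<phi>) / N)) *\<^sub>R tile_vertex p q (i + 1))
        = s * (sinh R / N) * (sin (A - \<phi>) * sin (mid i - A) + sin (A + \<phi>) * sin (mid i + A))"
      unfolding tile_vertex_eq v by (simp add: algebra_simps)
    also have "\<dots> = s * sin \<theta>" unfolding key N2 using s2 by simp
    finally show "Im (of_real s * cis \<theta>) = Im ((s * (sin (A - \<phi>) / N)) *\<^sub>R tile_vertex p q i
      + (s * (sin (A + \<phi>) / N)) *\<^sub>R tile_vertex p q (i + 1))" by simp
  qed
qed

lemma polar_form:
  fixes x :: complex
  obtains s \<theta> where "0 \<le> s" "\<theta> \<in> {0..2*pi}" "x = of_real s * cis \<theta>"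
proof (rule that)
  show "x = of_real (norm x) * cis (Arg2pi x)"
    unfolding cis_conv_exp by (rule Arg2pi_eq)
  show "Arg2pi x \<in> {0..2*pi}"
    using Arg2pi_ge_0[of x] Arg2pi_lt_2pi[of x] by simp
qed simp

text \<open>Each side condition is a half-space of Minkowski space with the origin on its boundary,
  hence a convex cone, and it contains all lifted vertices. Conversely, a point satisfying the
  condition of its own sector is obtained from the two vertices of that sector plus a nonnegative
  multiple of \<open>(1, 0)\<close>.\<close>

lemma tile_eq: "tile p q = {x. \<forall>i<p. x \<bullet> cis (mid i) \<le> \<tau> * sqrt (1 + (norm x)\<^sup>2)}"
proof (intro equalityI subsetI)
  fix x assume "x \<in> tile p q"
  hence x: "lift x \<in> convex_cone hull (lift ` tile_vertex p q ` {..<p})"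
    by (simp add: tile_def hyp_hull_def)
  have "convex_cone hull (lift ` tile_vertex p q ` {..<p}) \<subseteq> {y. (- \<tau>, cis (mid i)) \<bullet> y \<le> 0}" if "i < p" for i
  proof (intro hull_minimal convex_cone_halfspace_le subsetI)
    fix y assume "y \<in> lift ` tile_vertex p q ` {..<p}"
    then obtain j where j: "j < p" "y = lift (tile_vertex p q j)" by auto
    have "cos (2 * real j * A - mid i) \<le> cos (2 * real j * A - mid j)"
      using j that A_pos by (intro cos_shift_le) (auto simp: mid_def algebra_simps)
    also have "\<dots> = cos A" by (simp add: mid_def algebra_simps)
    finally have "sinh R * cos (2 * real j * A - mid i) \<le> sinh R * cos A"
      using R_pos by (intro mult_left_mono) auto
    also have "sinh R * cos A = \<tau> * cosh R" by (simp add: tau_eq tanh_def)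
    finally have "(of_real (sinh R) * cis (2 * real j * A)) \<bullet> cis (mid i) \<le> \<tau> * cosh R"
      by (simp only: inner_polar_cis)
    thus "y \<in> {y. (- \<tau>, cis (mid i)) \<bullet> y \<le> 0}"
      by (simp add: j lift_tile_vertex inner_commute)
  qed
  thus "x \<in> {x. \<forall>i<p. x \<bullet> cis (mid i) \<le> \<tau> * sqrt (1 + (norm x)\<^sup>2)}"
    using x by (force simp: lift_def inner_commute)
next
  fix x assume x: "x \<in> {x. \<forall>i<p. x \<bullet> cis (mid i) \<le> \<tau> * sqrt (1 + (norm x)\<^sup>2)}"
  obtain s \<theta> where s: "0 \<le> s" "\<theta> \<in> {0..2*pi}" "x = of_real s * cis \<theta>" by (rule polar_form)
  obtain i where i: "i < p" "\<bar>\<theta> - mid i\<bar> \<le> A" using s by (metis sector_exists)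
  obtain a b where ab: "0 \<le> a" "0 \<le> b"
    "of_real s * cis \<theta> = (s * a) *\<^sub>R tile_vertex p q i + (s * b) *\<^sub>R tile_vertex p q (i + 1)"
    "a + b = cos (\<theta> - mid i) / (sinh R * cos A)"
    using vertices_combination[OF i(2)] by metis
  let ?H = "convex_cone hull (lift ` tile_vertex p q ` {..<p})"
  have v: "lift (tile_vertex p q i) \<in> ?H" "lift (tile_vertex p q (i + 1)) \<in> ?H"
  proof -
    show "lift (tile_vertex p q i) \<in> ?H" using i by (intro hull_inc) auto
    have "tile_vertex p q (i + 1) \<in> tile_vertex p q ` {..<p}"
      using i p_ge_3 tile_vertex_p by (cases "i + 1 = p") auto
    thus "lift (tile_vertex p q (i + 1)) \<in> ?H" by (intro hull_inc) auto
  qed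
  \<comment> \<open>The space coordinates already agree; this is the missing amount of the time
    coordinate, and the side condition says that it is nonnegative.\<close>
  define c where "c = sqrt (1 + s\<^sup>2) - s * (a + b) * cosh R"
  have "s * cos (\<theta> - mid i) \<le> \<tau> * sqrt (1 + s\<^sup>2)"
    using x i s by (auto simp: inner_polar_cis norm_mult)
  hence "s * cos (\<theta> - mid i) / \<tau> \<le> sqrt (1 + s\<^sup>2)" using tau_pos by (simp add: pos_divide_le_eq mult.commute)
  moreover have "s * (a + b) * cosh R = s * cos (\<theta> - mid i) / \<tau>"
    using R_pos by (simp add: ab(4) tau_eq tanh_def)
  ultimately have c: "0 \<le> c" by (simp add: c_def)
  have "(s * a) *\<^sub>R lift (tile_vertex p q i) + (s * b) *\<^sub>R lift (tile_vertex p q (i + 1)) + c *\<^sub>R (1, 0) \<in> ?H"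
    using c ab s v lift_0_in_hull by (intro convex_cone_hull_add convex_cone_hull_mul) auto
  also have "(s * a) *\<^sub>R lift (tile_vertex p q i) + (s * b) *\<^sub>R lift (tile_vertex p q (i + 1)) + c *\<^sub>R (1, 0) = lift x"
  proof -
    have "norm x = s" using s by (simp add: norm_mult)
    moreover have "x = (s * a) *\<^sub>R tile_vertex p q i + (s * b) *\<^sub>R tile_vertex p q (i + 1)"
      unfolding s(3) by (rule ab(3))
    ultimately show ?thesis
      unfolding lift_tile_vertex tile_vertex_eq[symmetric]
      by (auto simp: lift_def c_def algebra_simps)
  qed
  finally show "x \<in> tile p q" by (simp add: tile_def hyp_hull_def)
qed

lemma tile_borel: "tile p q \<in> sets borel"
proof -
  have "closed {x. x \<bullet> cis (mid i) \<le> \<tau> * sqrt (1 + (norm x)\<^sup>2)}" for i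
    by (intro closed_Collect_le continuous_intros)
  moreover have "tile p q = (\<Inter>i\<in>{..<p}. {x. x \<bullet> cis (mid i) \<le> \<tau> * sqrt (1 + (norm x)\<^sup>2)})"
    by (auto simp: tile_eq)
  ultimately have "closed (tile p q)" by auto
  thus ?thesis by simp
qed

lemma hyp_vol_tile: "hyp_vol (tile p q) = area"
proof -
  have "hyp_nn (tile p q) = ennreal area"
  proof (rule hyp_nn_star[OF tile_borel reach_nonneg _ _ reach_integral])
    fix \<theta> s :: real assume \<theta>: "\<theta> \<in> {0..2*pi}" and s: "0 \<le> s"
    have "of_real s * cis \<theta> \<in> tile p q \<longleftrightarrow> s \<le> reach \<theta>"
      using s by (simp add: tile_eq inner_polar_cis norm_mult reach_iff(2)[OF \<theta> s])
    thus "s < reach \<theta> \<Longrightarrow> of_real s * cis \<theta> \<in> tile p q" "reach \<theta> < s \<Longrightarrow> of_real s * cis \<theta> \<notin> tile p q"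
      by auto
  qed
  thus ?thesis using area_pos by (simp add: hyp_vol_eq_hyp_nn tile_borel)
qed

text \<open>On a side \<open>x \<bullet> cis (mid i)\<close> equals \<open>\<tau>\<close> times the
  time coordinate. Cauchy-Schwarz then bounds \<open>tanh\<close> of the distance below by
  \<open>tanh r\<close>, and the foot of the perpendicular, in direction \<open>mid i\<close>,
  attains the bound.\<close>

lemma tile_inradius: "tile_inradius p q = r"
  unfolding tile_inradius_def
proof (rule touching_radius_unique)
  show "tile_side p q ` {..<p} \<noteq> {}" using p_ge_3 by (auto simp: lessThan_empty_iff)
  show "0 < r" by (rule r_pos)
  have side: "x \<in> tile_side p q i \<longleftrightarrow> (\<exists>a b. 0 \<le> a \<and> 0 \<le> b \<and>
      lift x = a *\<^sub>R lift (tile_vertex p q i) + b *\<^sub>R lift (tile_vertex p q (i + 1)))" for x i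
    by (auto simp: tile_side_def hyp_hull_def convex_cone_hull_doubleton)
  fix S assume "S \<in> tile_side p q ` {..<p}"
  then obtain i where S: "S = tile_side p q i" by auto
  have v: "2 * real i * A = mid i - A" "2 * real (i + 1) * A = mid i + A"
    by (simp_all add: mid_def algebra_simps)
  show "\<exists>x\<in>S. hyp_dist 0 x = r"
  proof
    let ?x = "of_real (sinh r) * cis (mid i)"
    show "hyp_dist 0 ?x = r"
      using r_pos by (simp add: hyp_dist_0_eq_arsinh norm_mult arsinh_sinh_real)
    obtain a b where ab: "0 \<le> a" "0 \<le> b"
      "?x = (sinh r * a) *\<^sub>R tile_vertex p q i + (sinh r * b) *\<^sub>R tile_vertex p q (i + 1)"
      "a + b = 1 / (sinh R * cos A)"
      using vertices_combination[of "mid i" i "sinh r"] A_pos by auto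
    have "sinh r * (a + b) * cosh R = sinh r / \<tau>"
      using R_pos by (simp add: ab(4) tau_eq tanh_def)
    also have "\<dots> = cosh r" using r_pos by (simp add: \<tau>_def tanh_def)
    finally have c: "sinh r * a * cosh R + sinh r * b * cosh R = cosh r" by (simp add: algebra_simps)
    have "lift ?x = (cosh r, ?x)"
      by (simp add: lift_def norm_mult sqrt_1_plus_sinh_square)
    hence "lift ?x = (sinh r * a) *\<^sub>R lift (tile_vertex p q i) + (sinh r * b) *\<^sub>R lift (tile_vertex p q (i + 1))"
      unfolding lift_tile_vertex tile_vertex_eq[symmetric] using ab(3) c by simp
    thus "?x \<in> S" unfolding S side using ab r_pos by (intro exI[of _ "sinh r * a"] exI[of _ "sinh r * b"]) auto
  qed
  fix x assume "x \<in> S"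
  then obtain a b where ab: "0 \<le> a" "0 \<le> b"
    "lift x = a *\<^sub>R lift (tile_vertex p q i) + b *\<^sub>R lift (tile_vertex p q (i + 1))"
    unfolding S side by auto
  have x: "sqrt (1 + (norm x)\<^sup>2) = (a + b) * cosh R"
    "x = a *\<^sub>R tile_vertex p q i + b *\<^sub>R tile_vertex p q (i + 1)"
    using ab(3) unfolding lift_tile_vertex tile_vertex_eq[symmetric]
    by (auto simp: lift_def algebra_simps)
  have "x \<bullet> cis (mid i) = (a + b) * sinh R * cos A"
    unfolding x(2) tile_vertex_eq v inner_add_left inner_scaleR_left inner_polar_cis
    by (simp add: algebra_simps)
  also have "\<dots> = \<tau> * sqrt (1 + (norm x)\<^sup>2)"
    by (simp add: x(1) tau_eq tanh_def)
  finally have "x \<bullet> cis (mid i) = \<tau> * sqrt (1 + (norm x)\<^sup>2)" .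
  moreover have "x \<bullet> cis (mid i) \<le> norm x"
    using norm_cauchy_schwarz[of x "cis (mid i)"] by simp
  ultimately have "\<tau> * sqrt (1 + (norm x)\<^sup>2) \<le> norm x" by simp
  moreover have "norm x = sinh (arsinh (norm x))" by simp
  moreover have "sqrt (1 + (norm x)\<^sup>2) = cosh (arsinh (norm x))"
    by (simp add: cosh_arsinh_real add.commute)
  ultimately have "tanh r * cosh (arsinh (norm x)) \<le> sinh (arsinh (norm x))"
    by (simp only: \<tau>_def)
  hence "tanh r \<le> tanh (arsinh (norm x))" by (simp add: tanh_def pos_le_divide_eq)
  thus "r \<le> hyp_dist 0 x" by (simp add: hyp_dist_0_eq_arsinh)
qed

section \<open>Densities in the plane and over it\<close>

lemma circle_packing_density: "circle_packing_density p q = 2 * pi * (cosh r - 1) / area"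
  using r_pos
  by (simp add: circle_packing_density_def inscribed_disc_def tile_inradius hyp_vol_disc hyp_vol_tile)

lemma circle_covering_density: "circle_covering_density p q = 2 * pi * (cosh R - 1) / area"
  using R_pos
  by (simp add: circle_covering_density_def circumscribed_disc_def tile_circumradius hyp_vol_disc hyp_vol_tile)

lemma cylinder_densities:
  "h3_packing_density p q = circle_packing_density p q"
  "h2r_packing_density p q = circle_packing_density p q"
  "h3_covering_density p q = circle_covering_density p q"
  "h2r_covering_density p q = circle_covering_density p q"
  using tile_borel
  by (simp_all add: h3_packing_density_def h2r_packing_density_def h3_covering_density_def
      h2r_covering_density_def circle_packing_density_def circle_covering_density_def
      h3_density_eq h2r_density_eq inscribed_disc_def circumscribed_disc_def hyp_disc_eq_cball)

end

section \<open>The base figure in the universal cover of \<open>SL(2,R)\<close>\<close>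

lemma sinh_cosh_half:
  "(sinh (x / 2))\<^sup>2 = (cosh x - 1) / 2" "(cosh (x / 2))\<^sup>2 = (cosh x + 1) / 2" for x :: real
  using cosh_double_cosh[of "x / 2"] sinh_square_eq[of "x / 2"] by simp_all

text \<open>\<open>tanh u\<close> is the Poincare radius and \<open>tanh (2 * u)\<close> the Klein
  radius of the same point; the product form fits the equations of the side curves.\<close>

lemma tanh_double: "2 * tanh u = tanh (2 * u) * (1 + (tanh u)\<^sup>2)" for u :: real
proof -
  have "tanh (2 * u) * (1 + (tanh u)\<^sup>2)
      = 2 * sinh u * cosh u / ((cosh u)\<^sup>2 + (sinh u)\<^sup>2) * (((cosh u)\<^sup>2 + (sinh u)\<^sup>2) / (cosh u)\<^sup>2)"
    by (simp add: tanh_def sinh_double cosh_double power_divide add_divide_distrib)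
  also have "\<dots> = 2 * sinh u * cosh u / (cosh u)\<^sup>2"
  proof -
    have "0 < (cosh u)\<^sup>2 + (sinh u)\<^sup>2" by (intro add_pos_nonneg) simp_all
    thus ?thesis by simp
  qed
  also have "\<dots> = 2 * tanh u" by (simp add: tanh_def power2_eq_square)
  finally show ?thesis ..
qed

text \<open>A connected set that contains \<open>x\<close> and leaves \<open>U\<close> must cross
  the frontier of \<open>U\<close>, which lies in the removed set \<open>S\<close>.\<close>

lemma connected_component_set_eqI:
  assumes "connected U" "x \<in> U" "U \<inter> S = {}" "frontier U \<subseteq> S"
  shows "connected_component_set (- S) x = U"
proof
  show "U \<subseteq> connected_component_set (- S) x"
    using assms by (intro connected_component_maximal) auto
  show "connected_component_set (- S) x \<subseteq> U"
  proof (rule ccontr)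
    assume "\<not> connected_component_set (- S) x \<subseteq> U"
    moreover have "x \<in> connected_component_set (- S) x"
      using assms by auto
    ultimately have "connected_component_set (- S) x \<inter> frontier U \<noteq> {}"
      using assms(2) by (intro connected_Int_frontier connected_connected_component) blast+
    moreover have "connected_component_set (- S) x \<subseteq> - S" by (rule connected_component_subset)
    ultimately show False using assms by blast
  qed
qed

section \<open>Side curves as geodesics of the Poincare disc\<close>

context mosaic
begin

text \<open>The Poincare radius of a point at hyperbolic distance \<open>R\<close>.\<close>

definition b :: real where "b = tanh (R / 2)"

lemma b_pos: "0 < b" and b_less_1: "b < 1"
  using R_pos by (simp_all add: b_def tanh_real_lt_1)

lemma tanh_R: "2 * b = tanh R * (1 + b\<^sup>2)"
  using tanh_double[of "R / 2"] by (simp add: b_def)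

lemma tau_b: "2 * b * cos A = \<tau> * (1 + b\<^sup>2)"
  using tanh_R by (simp add: tau_eq)

lemma tau_half: "2 * tanh (r / 2) = \<tau> * (1 + (tanh (r / 2))\<^sup>2)"
  using tanh_double[of "r / 2"] by (simp add: \<tau>_def)

text \<open>Half-angle formulas give \<open>b^2 = (cosh R - 1) / (cosh R + 1)\<close>, and
  \<open>1 / cosh R\<close> is \<open>tan A * tan B\<close>.\<close>

lemma sl_b: "sl_b p q = b"
proof -
  have t: "tan A * tan B = 1 / cosh R"
    by (simp add: cosh_R tan_def cot_def)
  have "b\<^sup>2 = ((cosh R - 1) / 2) / ((cosh R + 1) / 2)"
    by (simp only: b_def tanh_def power_divide sinh_cosh_half)
  also have "\<dots> = (1 - 1 / cosh R) / (1 + 1 / cosh R)"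
  proof -
    have "1 - 1 / x = (x - 1) / x" "1 + 1 / x = (x + 1) / x" if "0 < x" for x :: real
      using that by (simp_all add: field_simps)
    moreover have "(x / k) / (y / k) = x / y" if "k \<noteq> 0" for x y k :: real
      using that by simp
    ultimately show ?thesis by (simp only: cosh_real_pos cosh_real_nonzero zero_neq_numeral not_False_eq_True)
  qed
  finally have "(1 - tan A * tan B) / (1 + tan A * tan B) = b\<^sup>2" by (simp add: t)
  thus ?thesis using b_pos by (simp add: sl_b_def flip: A_def B_def)
qed

text \<open>Sum-to-product formulas reduce the radicand to
  \<open>((cos B)^2 - (sin A)^2) / (sin A)^2\<close>, which is \<open>(cosh r)^2 - 1\<close>.
  Geometrically, \<open>1 / sinh r\<close> is the Euclidean radius of a geodesic at distance
  \<open>r\<close> from the centre of the Poincare disc.\<close>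

lemma sl_C: "sl_C p q = sinh r"
proof -
  have d: "sin (A + B) \<noteq> 0" using A_pos B_pos AB sin_gt_zero[of "A + B"] by simp
  have c: "(cos A)\<^sup>2 = 1 - (sin A)\<^sup>2" "(cos B)\<^sup>2 = 1 - (sin B)\<^sup>2" by (simp_all add: cos_squared_eq)
  have "sin (2 * A) + sin (2 * B) = 2 * sin (A + B) * cos (A - B)"
  proof -
    have "sin (2 * A) + sin (2 * B) = sin ((A + B) + (A - B)) + sin ((A + B) - (A - B))" by simp
    also have "\<dots> = 2 * sin (A + B) * cos (A - B)" unfolding sin_add[of "A + B"] sin_diff[of "A + B"] by simp
    finally show ?thesis .
  qed
  moreover have "1 - cos (2 * A) = 2 * (sin A)\<^sup>2" by (simp add: cos_double_sin)
  ultimately have "cos (A + B) * (sin (2 * A) + sin (2 * B)) / (sin (A + B) * (1 - cos (2 * A)))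
      = cos (A + B) * cos (A - B) / (sin A)\<^sup>2"
    using d by simp
  also have "cos (A + B) * cos (A - B) = (cos B)\<^sup>2 - (sin A)\<^sup>2"
    using c unfolding cos_add cos_diff by algebra
  also have "((cos B)\<^sup>2 - (sin A)\<^sup>2) / (sin A)\<^sup>2 = (cosh r)\<^sup>2 - 1"
    using trig_pos by (simp add: cosh_r power_divide diff_divide_distrib)
  also have "\<dots> = (sinh r)\<^sup>2" by (simp add: cosh_square_eq)
  finally have e: "cos (A + B) * (sin (2 * A) + sin (2 * B)) / (sin (A + B) * (1 - cos (2 * A))) = (sinh r)\<^sup>2" .
  have "2 * pi / real p = 2 * A" "2 * pi / real q = 2 * B" "pi / real p = A" "pi / real q = B"
    by (simp_all add: A_def B_def)
  thus ?thesis using e r_pos unfolding sl_C_def by (simp only:) simp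
qed

lemma sl_vertex_eq: "sl_vertex p q i = of_real b * cis (2 * real i * A)"
  by (simp add: sl_vertex_def sl_b A_def mult_ac)

text \<open>The centre is at Euclidean distance \<open>1 / \<tau>\<close> from 0 and the squared
  radius is \<open>1 / \<tau>^2 - 1\<close>, so the circle is orthogonal to the unit circle and its
  equation loses the radius. On the circle \<open>z \<bullet> cis (mid i)\<close> grows with
  \<open>norm z\<close>, so cutting along the chord is the same as cutting at the norm
  \<open>b\<close> of the vertices.\<close>

lemma sl_side_eq: "sl_side p q i = {z. 2 * (z \<bullet> cis (mid i)) = \<tau> * (1 + (norm z)\<^sup>2) \<and> norm z \<le> b}"
proof -
  define n where "n = cis (mid i)"
  define k where "k = b * cos A"
  have k: "0 < k" using b_pos trig_pos by (simp add: k_def)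
  have v: "2 * real i * A = mid i - A" "2 * real (i + 1) * A = mid i + A"
    by (simp_all add: mid_def algebra_simps)
  have m: "midpoint (sl_vertex p q i) (sl_vertex p q (i + 1)) = of_real k * n"
    unfolding sl_vertex_eq v midpoint_def n_def k_def
    by (rule complex_eqI) (simp_all add: cos_add cos_diff sin_add sin_diff field_simps)
  have "sl_vertex p q i - of_real k * n = of_real (b * sin A) * cis (mid i - pi / 2)"
    unfolding sl_vertex_eq v n_def k_def
    by (rule complex_eqI) (simp_all add: cos_diff sin_diff algebra_simps)
  hence "cmod (of_real k * n - sl_vertex p q i) = b * sin A"
    using b_pos trig_pos by (subst norm_minus_commute) (simp only:, simp add: norm_mult)
  hence dm: "dist (of_real k * n) (sl_vertex p q i) = b * sin A"
    by (simp add: dist_norm)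
  have sgn: "sgn (of_real k * n) = n" using k by (simp add: sgn_eq n_def norm_mult)
  have rho: "(1 / sl_C p q)\<^sup>2 = (1 / \<tau>)\<^sup>2 - 1"
  proof -
    have "sinh r \<noteq> 0" using r_pos by simp
    thus ?thesis by (simp add: sl_C \<tau>_def tanh_def power_divide cosh_square_eq field_simps)
  qed
  have bk: "1 + b\<^sup>2 = 2 * k / \<tau>" using tau_b tau_pos by (simp add: k_def field_simps)
  have "(1 / \<tau> - k)\<^sup>2 = (1 / \<tau>)\<^sup>2 - 2 * k / \<tau> + k\<^sup>2" by (simp add: power2_eq_square algebra_simps)
  also have "k\<^sup>2 = b\<^sup>2 - (b * sin A)\<^sup>2" by (simp add: k_def power_mult_distrib cos_squared_eq algebra_simps)
  finally have sq: "(1 / sl_C p q)\<^sup>2 - (b * sin A)\<^sup>2 = (1 / \<tau> - k)\<^sup>2"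
    unfolding rho bk[symmetric] by simp
  \<comment> \<open>The square root of a square has to be taken with the right sign: the centre lies
    beyond the chord because \<open>k < 1 < 1 / \<tau>\<close>.\<close>
  have "k \<le> b" unfolding k_def using b_pos by (intro mult_left_le) auto
  hence "k < 1" using b_less_1 by simp
  moreover have "1 < 1 / \<tau>" using tau_pos tau_less_1 by simp
  ultimately have c: "sqrt ((1 / sl_C p q)\<^sup>2 - (b * sin A)\<^sup>2) = 1 / \<tau> - k"
    unfolding sq by simp
  have centre: "of_real k * n + (1 / \<tau> - k) *\<^sub>R n = of_real (1 / \<tau>) * n"
    by (simp add: scaleR_conv_of_real algebra_simps)
  have on_circle: "z \<in> sphere (of_real (1 / \<tau>) * n) (1 / sl_C p q) \<longleftrightarrow> 2 * (z \<bullet> n) = \<tau> * (1 + (norm z)\<^sup>2)" for z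
  proof -
    have "0 \<le> 1 / sl_C p q" using r_pos by (simp add: sl_C)
    hence "z \<in> sphere (of_real (1 / \<tau>) * n) (1 / sl_C p q) \<longleftrightarrow> (norm (of_real (1 / \<tau>) * n - z))\<^sup>2 = (1 / sl_C p q)\<^sup>2"
      by (simp add: dist_norm power2_eq_iff_nonneg)
    also have "(norm (of_real (1 / \<tau>) * n - z))\<^sup>2 = (1 / \<tau>)\<^sup>2 + (norm z)\<^sup>2 - 2 * (1 / \<tau>) * (z \<bullet> n)"
    proof -
      have "n \<bullet> n = 1" by (simp add: n_def dot_square_norm)
      hence "(norm (a *\<^sub>R n - z))\<^sup>2 = a\<^sup>2 + (norm z)\<^sup>2 - 2 * a * (z \<bullet> n)" for a
        unfolding power2_norm_eq_inner inner_diff_left inner_diff_right inner_commute[of n z]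
        by (simp add: power2_eq_square inner_commute algebra_simps)
      thus ?thesis by (simp only: scaleR_conv_of_real)
    qed
    also have "\<dots> = (1 / sl_C p q)\<^sup>2 \<longleftrightarrow> 2 * (z \<bullet> n) = \<tau> * (1 + (norm z)\<^sup>2)"
    proof -
      have "2 * (1 / \<tau>) * (z \<bullet> n) = 2 * (z \<bullet> n) / \<tau>" by simp
      hence "(1 / \<tau>)\<^sup>2 + (norm z)\<^sup>2 - 2 * (1 / \<tau>) * (z \<bullet> n) = (1 / sl_C p q)\<^sup>2
          \<longleftrightarrow> 2 * (z \<bullet> n) / \<tau> = 1 + (norm z)\<^sup>2"
        unfolding rho by linarith
      thus ?thesis using tau_pos by (simp add: divide_eq_eq mult.commute)
    qed
    finally show ?thesis .
  qed
  have minor: "z \<bullet> (of_real k * n) \<le> (of_real k * n) \<bullet> (of_real k * n) \<longleftrightarrow> norm z \<le> b"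
    if "2 * (z \<bullet> n) = \<tau> * (1 + (norm z)\<^sup>2)" for z
  proof -
    have n1: "n \<bullet> n = 1" by (simp add: n_def dot_square_norm)
    have "z \<bullet> (of_real k * n) \<le> (of_real k * n) \<bullet> (of_real k * n) \<longleftrightarrow> k * (z \<bullet> n) \<le> k * k"
      by (simp add: scaleR_conv_of_real[symmetric] n1)
    also have "\<dots> \<longleftrightarrow> 2 * (z \<bullet> n) \<le> 2 * k" using k by simp
    also have "\<dots> \<longleftrightarrow> \<tau> * (1 + (norm z)\<^sup>2) \<le> \<tau> * (1 + b\<^sup>2)"
      by (simp only: that k_def tau_b[symmetric] mult.assoc)
    also have "\<dots> \<longleftrightarrow> (norm z)\<^sup>2 \<le> b\<^sup>2" using tau_pos by simp
    also have "\<dots> \<longleftrightarrow> norm z \<le> b" using b_pos by (simp add: power2_le_iff_abs_le)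
    finally show ?thesis .
  qed
  have "sl_side p q i = {z \<in> sphere (of_real (1 / \<tau>) * n) (1 / sl_C p q).
      z \<bullet> (of_real k * n) \<le> (of_real k * n) \<bullet> (of_real k * n)}"
    unfolding sl_side_def inward_arc_def m Let_def dm sgn c centre ..
  also have "\<dots> = {z. 2 * (z \<bullet> n) = \<tau> * (1 + (norm z)\<^sup>2) \<and> norm z \<le> b}"
    unfolding on_circle using minor by (intro Collect_cong conj_cong refl)
  finally show ?thesis by (simp only: n_def)
qed

text \<open>The side inequalities describe the exteriors of the circles and hold again for all large
  \<open>z\<close>; the bound on the norm selects the inner region.\<close>

definition base :: "complex set" where
  "base = {z. norm z < 1 \<and> (\<forall>i<p. 2 * (z \<bullet> cis (mid i)) < \<tau> * (1 + (norm z)\<^sup>2))}"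

lemma open_base: "open base"
proof -
  have "base = ball 0 1 \<inter> (\<Inter>i\<in>{..<p}. {z. 2 * (z \<bullet> cis (mid i)) < \<tau> * (1 + (norm z)\<^sup>2)})"
    by (auto simp: base_def)
  thus ?thesis by (auto intro!: open_Int open_INT open_Collect_less continuous_intros)
qed

text \<open>The region is star-shaped about 0: shrinking \<open>z\<close> by the factor
  \<open>l\<close> scales the left side of each inequality by \<open>l\<close>, and the right side
  by at least \<open>l\<close>.\<close>

lemma connected_base: "connected base"
proof (rule starlike_imp_connected)
  show "starlike base"
    unfolding starlike_def
  proof (intro bexI ballI subsetI)
    show "0 \<in> base" using tau_pos by (simp add: base_def)
    fix z w assume z: "z \<in> base" and "w \<in> closed_segment 0 z"
    then obtain l where l: "0 \<le> l" "l \<le> 1" "w = l *\<^sub>R z"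
      by (auto simp: closed_segment_def)
    have n: "norm z < 1" using z by (simp add: base_def)
    have "l * norm z \<le> 1 * norm z" using l by (intro mult_right_mono) auto
    hence "norm w < 1" using n l by simp
    moreover have "2 * (w \<bullet> cis (mid i)) < \<tau> * (1 + (norm w)\<^sup>2)" if "i < p" for i
    proof -
      have zi: "2 * (z \<bullet> cis (mid i)) < \<tau> * (1 + (norm z)\<^sup>2)" using z that by (simp add: base_def)
      have "l * (norm z)\<^sup>2 \<le> 1" using l n by (intro mult_le_one) (auto simp: abs_square_le_1)
      \<comment> \<open>This product is exactly the difference of \<open>1 + (norm w)^2\<close> and
        \<open>l * (1 + (norm z)^2)\<close>.\<close>
      hence "0 \<le> (1 - l) * (1 - l * (norm z)\<^sup>2)" using l by simp
      also have "\<dots> = 1 + (norm w)\<^sup>2 - l * (1 + (norm z)\<^sup>2)"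
        using l by (simp add: power_mult_distrib power2_eq_square algebra_simps)
      finally have "l * (1 + (norm z)\<^sup>2) \<le> 1 + (norm w)\<^sup>2" by simp
      hence le: "l * (\<tau> * (1 + (norm z)\<^sup>2)) \<le> \<tau> * (1 + (norm w)\<^sup>2)"
        using tau_pos by (metis mult.left_commute mult_left_mono less_imp_le)
      show ?thesis
      proof (cases "l = 0")
        case True
        thus ?thesis using tau_pos l by simp
      next
        case False
        hence "l * (2 * (z \<bullet> cis (mid i))) < l * (\<tau> * (1 + (norm z)\<^sup>2))"
          using zi l by (intro mult_strict_left_mono) auto
        thus ?thesis using le l by simp
      qed
    qed
    ultimately show "w \<in> base" by (simp add: base_def)
  qed
qed

text \<open>A frontier point satisfies all weak inequalities. The one of its own sector already
  forces the norm to be at most \<open>b\<close>, hence below 1, so some side inequality must be an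
  equality, and the point is on the arc and not merely on the circle.\<close>

lemma frontier_base: "frontier base \<subseteq> (\<Union>i<p. sl_side p q i)"
proof
  fix z assume "z \<in> frontier base"
  hence z: "z \<in> closure base" "z \<notin> base"
    using open_base by (auto simp: frontier_def interior_open)
  let ?C = "cball 0 1 \<inter> (\<Inter>i\<in>{..<p}. {z. 2 * (z \<bullet> cis (mid i)) \<le> \<tau> * (1 + (norm z)\<^sup>2)})"
  have "closed ?C"
    by (intro closed_Int closed_cball closed_INT ballI closed_Collect_le continuous_intros)
  moreover have "base \<subseteq> ?C" by (auto simp: base_def less_imp_le)
  ultimately have "z \<in> ?C" using z(1) closure_minimal by blast
  hence zC: "norm z \<le> 1" "\<And>i. i < p \<Longrightarrow> 2 * (z \<bullet> cis (mid i)) \<le> \<tau> * (1 + (norm z)\<^sup>2)" by auto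
  obtain s \<theta> where s: "0 \<le> s" "\<theta> \<in> {0..2*pi}" "z = of_real s * cis \<theta>" by (rule polar_form)
  have ns: "norm z = s" using s by (simp add: norm_mult)
  obtain i where i: "i < p" "\<bar>\<theta> - mid i\<bar> \<le> A" using s by (metis sector_exists)
  have "cos A \<le> cos (\<theta> - mid i)" using width_ge[OF s(2)] width_sector[OF i] by simp
  hence "2 * (s * cos A) \<le> 2 * (s * cos (\<theta> - mid i))" using s by (simp add: mult_left_mono)
  also have "\<dots> \<le> \<tau> * (1 + s\<^sup>2)" using zC(2)[OF i(1)] by (simp add: ns) (simp add: s(3) inner_polar_cis)
  finally have "(2 * s) * cos A \<le> (tanh R * (1 + s\<^sup>2)) * cos A" by (simp add: tau_eq mult_ac)
  hence "2 * s \<le> tanh R * (1 + s\<^sup>2)" using trig_pos by simp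
  hence "2 * s * (1 + b\<^sup>2) \<le> tanh R * (1 + s\<^sup>2) * (1 + b\<^sup>2)" by (intro mult_right_mono) auto
  also have "\<dots> = 2 * b * (1 + s\<^sup>2)" using tanh_R by (simp add: mult_ac)
  \<comment> \<open>The function \<open>s / (1 + s^2)\<close> increases up to 1; the product is the
    cross-multiplied difference of its values at \<open>b\<close> and \<open>s\<close>.\<close>
  finally have "0 \<le> (b - s) * (1 - s * b)" by (simp add: power2_eq_square algebra_simps)
  moreover have "s * b < 1"
    using mult_right_mono[of s 1 b] zC(1) ns b_pos b_less_1 by linarith
  ultimately have sb: "s \<le> b" by (simp add: zero_le_mult_iff)
  hence "norm z < 1" using b_less_1 ns by simp
  then obtain j where "j < p" "\<not> 2 * (z \<bullet> cis (mid j)) < \<tau> * (1 + (norm z)\<^sup>2)"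
    using z(2) by (auto simp: base_def)
  hence "j < p" "2 * (z \<bullet> cis (mid j)) = \<tau> * (1 + (norm z)\<^sup>2)" using zC(2)[of j] by auto
  thus "z \<in> (\<Union>i<p. sl_side p q i)" using sb ns by (auto simp: sl_side_eq)
qed

lemma sl_base_figure_eq: "sl_base_figure p q = base"
  unfolding sl_base_figure_def
proof (rule connected_component_set_eqI[OF connected_base _ _ frontier_base])
  show "0 \<in> base" using tau_pos by (simp add: base_def)
  show "base \<inter> (\<Union>i<p. sl_side p q i) = {}" by (auto simp: base_def sl_side_eq)
qed

lemma sl_area_base_figure: "sl_area (sl_base_figure p q) = area / 4"
  unfolding sl_base_figure_eq
proof (rule sl_area_star[OF _ reach_nonneg _ _ reach_integral])
  show "base \<in> sets borel" using open_base by simp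
  show "0 \<le> area" using area_pos by simp
  fix \<theta> u :: real assume \<theta>: "\<theta> \<in> {0..2*pi}" and u: "0 \<le> u"
  have "0 \<le> sinh (2 * u)" using u by simp
  note reach = reach_iff(1)[OF \<theta> this, unfolded sqrt_1_plus_sinh_square]
  have n: "norm (sl_point u \<theta>) = tanh u" using u by (simp add: sl_point_def norm_mult)
  \<comment> \<open>Multiplying by \<open>(cosh u)^2\<close> turns the Poincare form of the side
    condition into the hyperboloid form at norm \<open>sinh (2 * u)\<close>.\<close>
  have eq: "2 * (sl_point u \<theta> \<bullet> cis \<phi>) < \<tau> * (1 + (tanh u)\<^sup>2) \<longleftrightarrow> sinh (2 * u) * cos (\<theta> - \<phi>) < \<tau> * cosh (2 * u)" for \<phi>
  proof -
    have "sinh (2 * u) * cos (\<theta> - \<phi>) = (cosh u)\<^sup>2 * (2 * tanh u * cos (\<theta> - \<phi>))"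
      by (simp add: sinh_double tanh_def power2_eq_square)
    moreover have "\<tau> * cosh (2 * u) = (cosh u)\<^sup>2 * (\<tau> * (1 + (tanh u)\<^sup>2))"
      unfolding cosh_double tanh_def power_divide by (simp add: field_simps)
    ultimately have "sinh (2 * u) * cos (\<theta> - \<phi>) < \<tau> * cosh (2 * u) \<longleftrightarrow>
        (cosh u)\<^sup>2 * (2 * tanh u * cos (\<theta> - \<phi>)) < (cosh u)\<^sup>2 * (\<tau> * (1 + (tanh u)\<^sup>2))"
      by (simp only:)
    also have "\<dots> \<longleftrightarrow> 2 * tanh u * cos (\<theta> - \<phi>) < \<tau> * (1 + (tanh u)\<^sup>2)"
      by (rule mult_less_cancel_left_pos) simp
    finally show ?thesis by (simp add: sl_point_def inner_polar_cis mult.assoc)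
  qed
  have "sl_point u \<theta> \<in> base \<longleftrightarrow> sinh (2 * u) < reach \<theta>"
    by (simp add: base_def n eq reach tanh_real_lt_1)
  thus "sinh (2 * u) < reach \<theta> \<Longrightarrow> sl_point u \<theta> \<in> base" "reach \<theta> < sinh (2 * u) \<Longrightarrow> sl_point u \<theta> \<notin> base"
    by auto
qed

text \<open>As for the tile, Cauchy-Schwarz on the side equation gives the lower bound, here
  \<open>\<tau> \<le> tanh (2 * u)\<close> by \<open>tanh_double\<close>; halving \<open>r\<close>
  reflects that \<open>u\<close> is half the hyperbolic distance.\<close>

lemma sl_r_opt: "sl_r_opt p q = r / 2"
  unfolding sl_r_opt_def
proof (rule touching_radius_unique)
  show "sl_side p q ` {..<p} \<noteq> {}" using p_ge_3 by (auto simp: lessThan_empty_iff)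
  show "0 < r / 2" using r_pos by simp
  \<comment> \<open>Needed for the touching point to have norm at most \<open>b\<close>, that is, to
    lie on the arc.\<close>
  have "tanh r \<le> tanh R" using tau_eq trig_pos R_pos cos_le_one[of A]
    by (simp add: \<tau>_def mult_left_le)
  hence rR: "r \<le> R" by simp
  fix S assume "S \<in> sl_side p q ` {..<p}"
  then obtain i where S: "S = sl_side p q i" by auto
  show "\<exists>z\<in>S. artanh (cmod z) = r / 2"
  proof
    let ?z = "of_real (tanh (r / 2)) * cis (mid i)"
    have n: "cmod ?z = tanh (r / 2)" using r_pos by (simp add: norm_mult)
    show "artanh (cmod ?z) = r / 2" unfolding n by (rule artanh_tanh_real)
    show "?z \<in> S"
      unfolding S sl_side_eq mem_Collect_eq n inner_polar_cis using tau_half rR by (simp add: b_def)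
  qed
  fix z assume "z \<in> S"
  hence z: "2 * (z \<bullet> cis (mid i)) = \<tau> * (1 + (norm z)\<^sup>2)" "norm z \<le> b" by (auto simp: S sl_side_eq)
  define u where "u = artanh (cmod z)"
  have u: "tanh u = cmod z" using z b_less_1 by (simp add: u_def tanh_artanh_real)
  have "z \<bullet> cis (mid i) \<le> norm z" using norm_cauchy_schwarz[of z "cis (mid i)"] by simp
  hence "\<tau> * (1 + (norm z)\<^sup>2) \<le> 2 * norm z" using z(1) by simp
  also have "\<dots> = tanh (2 * u) * (1 + (norm z)\<^sup>2)" using tanh_double[of u] by (simp add: u)
  finally have "\<tau> \<le> tanh (2 * u)"
    by (rule mult_right_le_imp_le) (simp add: add_pos_nonneg)
  thus "r / 2 \<le> artanh (cmod z)" by (simp add: \<tau>_def u_def)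
qed

lemma sl_R_opt: "sl_R_opt p q = R / 2"
  by (simp add: sl_R_opt_def sl_b b_def artanh_tanh_real)

lemma sl_densities:
  "sl_packing_density p q = circle_packing_density p q"
  "sl_covering_density p q = circle_covering_density p q"
  using r_pos R_pos
  by (simp_all add: sl_packing_density_def sl_covering_density_def sl_r_opt sl_R_opt sl_area_disc
      sl_area_base_figure circle_packing_density circle_covering_density)

end

section \<open>Trigonometric inequalities\<close>

text \<open>Start of a chain of Taylor bounds: the difference in each one has the difference of its
  predecessor as derivative, beginning with \<open>sin_x_le_x\<close>.\<close>

lemma cos_ge_quadratic: "0 \<le> x \<Longrightarrow> 1 - x\<^sup>2 / 2 \<le> cos x" for x :: real
proof -
  assume x: "0 \<le> x"
  have "cos 0 - (1 - 0\<^sup>2 / 2) \<le> cos x - (1 - x\<^sup>2 / 2)"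
  proof (rule DERIV_nonneg_imp_nondecreasing[OF x])
    fix y :: real assume "0 \<le> y"
    thus "\<exists>d. ((\<lambda>y. cos y - (1 - y\<^sup>2 / 2)) has_real_derivative d) (at y) \<and> 0 \<le> d"
      using sin_x_le_x[of y] by (intro exI[of _ "y - sin y"]) (auto intro!: derivative_eq_intros)
  qed
  thus ?thesis by simp
qed

lemma sin_ge_cubic: "0 \<le> x \<Longrightarrow> x - x^3 / 6 \<le> sin x" for x :: real
proof -
  assume x: "0 \<le> x"
  have "sin 0 - (0 - 0^3 / 6) \<le> sin x - (x - x^3 / 6)"
  proof (rule DERIV_nonneg_imp_nondecreasing[OF x])
    fix y :: real assume "0 \<le> y"
    thus "\<exists>d. ((\<lambda>y. sin y - (y - y^3 / 6)) has_real_derivative d) (at y) \<and> 0 \<le> d"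
      using cos_ge_quadratic[of y]
      by (intro exI[of _ "cos y - (1 - y\<^sup>2 / 2)"]) (auto intro!: derivative_eq_intros)
  qed
  thus ?thesis by simp
qed

lemma cos_le_quartic: "0 \<le> x \<Longrightarrow> cos x \<le> 1 - x\<^sup>2 / 2 + x^4 / 24" for x :: real
proof -
  assume x: "0 \<le> x"
  have "1 - 0\<^sup>2 / 2 + 0^4 / 24 - cos 0 \<le> 1 - x\<^sup>2 / 2 + x^4 / 24 - cos x"
  proof (rule DERIV_nonneg_imp_nondecreasing[OF x])
    fix y :: real assume "0 \<le> y"
    thus "\<exists>d. ((\<lambda>y. 1 - y\<^sup>2 / 2 + y^4 / 24 - cos y) has_real_derivative d) (at y) \<and> 0 \<le> d"
      using sin_ge_cubic[of y]
      by (intro exI[of _ "sin y - (y - y^3 / 6)"]) (auto intro!: derivative_eq_intros)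
  qed
  thus ?thesis by simp
qed

lemma sin_le_quintic: "0 \<le> x \<Longrightarrow> sin x \<le> x - x^3 / 6 + x^5 / 120" for x :: real
proof -
  assume x: "0 \<le> x"
  have "0 - 0^3 / 6 + 0^5 / 120 - sin 0 \<le> x - x^3 / 6 + x^5 / 120 - sin x"
  proof (rule DERIV_nonneg_imp_nondecreasing[OF x])
    fix y :: real assume "0 \<le> y"
    thus "\<exists>d. ((\<lambda>y. y - y^3 / 6 + y^5 / 120 - sin y) has_real_derivative d) (at y) \<and> 0 \<le> d"
      using cos_le_quartic[of y]
      by (intro exI[of _ "1 - y\<^sup>2 / 2 + y^4 / 24 - cos y"]) (auto intro!: derivative_eq_intros)
  qed
  thus ?thesis by simp
qed

text \<open>The derivative of the difference is \<open>x * (x - sin x)\<close>. Divided by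
  \<open>cos x\<close>, the left side is \<open>tan x - x\<close>, which the covering bound
  needs.\<close>

lemma sin_minus_x_cos_le: "0 \<le> x \<Longrightarrow> sin x - x * cos x \<le> x^3 / 3" for x :: real
proof -
  assume x: "0 \<le> x"
  have "0^3 / 3 - (sin 0 - 0 * cos 0) \<le> x^3 / 3 - (sin x - x * cos x)"
  proof (rule DERIV_nonneg_imp_nondecreasing[OF x])
    fix y :: real assume y: "0 \<le> y"
    hence "y * sin y \<le> y * y" using sin_x_le_x[of y] by (intro mult_left_mono) auto
    thus "\<exists>d. ((\<lambda>y. y^3 / 3 - (sin y - y * cos y)) has_real_derivative d) (at y) \<and> 0 \<le> d"
      by (intro exI[of _ "y * y - y * sin y"]) (auto intro!: derivative_eq_intros simp: power2_eq_square)
  qed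
  thus ?thesis by simp
qed

text \<open>Concavity: the slope of a chord is at most the slope at its left end, which below is
  \<open>a\<close> or \<open>pi / 6\<close>. \<open>tan_chord\<close> is the convex
  counterpart.\<close>

lemma sin_chord: "0 \<le> x \<Longrightarrow> x \<le> y \<Longrightarrow> y \<le> pi \<Longrightarrow> sin y - sin x \<le> cos x * (y - x)" for x y :: real
proof -
  assume xy: "0 \<le> x" "x \<le> y" "y \<le> pi"
  have "cos x * x - sin x \<le> cos x * y - sin y"
  proof (rule DERIV_nonneg_imp_nondecreasing[OF xy(2)])
    fix z assume "x \<le> z" "z \<le> y"
    hence "cos z \<le> cos x" using xy by (intro cos_monotone_0_pi_le) auto
    thus "\<exists>d. ((\<lambda>z. cos x * z - sin z) has_real_derivative d) (at z) \<and> 0 \<le> d"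
      by (intro exI[of _ "cos x - cos z"]) (auto intro!: derivative_eq_intros)
  qed
  thus ?thesis by (simp add: algebra_simps)
qed

lemma tan_chord: "0 \<le> x \<Longrightarrow> x \<le> y \<Longrightarrow> y < pi / 2 \<Longrightarrow> (y - x) / (cos x)\<^sup>2 \<le> tan y - tan x" for x y :: real
proof -
  assume xy: "0 \<le> x" "x \<le> y" "y < pi / 2"
  define k where "k = inverse ((cos x)\<^sup>2)"
  have "tan x - k * x \<le> tan y - k * y"
  proof (rule DERIV_nonneg_imp_nondecreasing[OF xy(2)])
    fix z assume z: "x \<le> z" "z \<le> y"
    hence "cos z \<le> cos x" using xy by (intro cos_monotone_0_pi_le) auto
    moreover have c: "0 < cos z" using z xy by (intro cos_gt_zero_pi) auto
    ultimately have "k \<le> inverse ((cos z)\<^sup>2)"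
      unfolding k_def by (intro le_imp_inverse_le power_mono) auto
    thus "\<exists>d. ((\<lambda>z. tan z - k * z) has_real_derivative d) (at z) \<and> 0 \<le> d"
      using c by (intro exI[of _ "inverse ((cos z)\<^sup>2) - k"])
        (auto intro!: derivative_eq_intros)
  qed
  thus ?thesis by (simp add: k_def divide_inverse algebra_simps)
qed

text \<open>Both bounds come from \<open>sin (pi / 6) = 1 / 2\<close>: the cubic lower bound for the
  sine excludes larger values of \<open>pi\<close>, the quintic upper bound smaller ones.\<close>

lemma pi_bounds: "314 / 100 < pi" "pi < 315 / 100"
proof -
  define x where "x = pi / 6"
  have x: "0 < x" "x < 4 / 6" "sin x = 1 / 2" using pi_less_4 by (simp_all add: x_def sin_30)
  show "pi < 315 / 100"
  proof (rule ccontr)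
    assume "\<not> pi < 315 / 100"
    hence y: "0 \<le> x - 525 / 1000" by (simp add: x_def)
    have "x - x^3 / 6 \<le> 1 / 2" using sin_ge_cubic[of x] x by simp
    moreover have "x^3 - k^3 = (x - k) * (x\<^sup>2 + k * x + k\<^sup>2)" for k
      by (simp add: power2_eq_square power3_eq_cube algebra_simps)
    note this[of "525 / 1000"]
    \<comment> \<open>Hence \<open>x - x^3 / 6\<close> is at least its value at
      \<open>525 / 1000\<close>, a sixth of 3.15, and that value exceeds 1/2.\<close>
    moreover have "(x - 525 / 1000) * (x\<^sup>2 + 525 / 1000 * x + (525 / 1000)\<^sup>2) \<le> (x - 525 / 1000) * 6"
    proof (intro mult_left_mono y)
      have "x\<^sup>2 \<le> 1" using x by (simp add: abs_square_le_1)
      thus "x\<^sup>2 + 525 / 1000 * x + (525 / 1000)\<^sup>2 \<le> 6" using x(2) by (simp add: power2_eq_square)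
    qed
    ultimately show False by (simp add: power3_eq_cube)
  qed
  show "314 / 100 < pi"
  proof (rule ccontr)
    define a :: real where "a = 314 / 600"
    assume "\<not> 314 / 100 < pi"
    hence "x \<le> a" by (simp add: x_def a_def)
    hence "sin x \<le> sin a" using x pi_ge_two by (intro sin_monotone_2pi_le) (auto simp: a_def)
    also have "sin a \<le> a - a^3 / 6 + a^5 / 120" by (rule sin_le_quintic) (simp add: a_def)
    also have "\<dots> < 1 / 2" by (simp add: a_def power3_eq_cube eval_nat_numeral)
    finally show False using x by simp
  qed
qed

text \<open>The angle \<open>a\<close> will be \<open>\<pi>/p\<close>, so no value between \<open>\<pi>/7\<close> and \<open>\<pi>/6\<close> occurs.\<close>

lemma packing_inequality:
  assumes a: "0 < a" "a \<le> pi / 7 \<or> pi / 6 \<le> a \<and> a \<le> pi / 3" and c: "pi / 6 \<le> c" "c < pi / 2" "a < c"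
  shows "pi * a * (sin c - sin a) \<le> 3 * sin a * (c - a)"
  using a(2)
proof (elim disjE conjE)
  \<comment> \<open>The chord from \<open>a\<close> to \<open>c\<close> is estimated directly; it
    suffices that its slope bound satisfies \<open>pi * a * cos a \<le> 3 * sin a\<close>.\<close>
  assume "pi / 6 \<le> a" "a \<le> pi / 3"
  hence ab: "52 / 100 \<le> a" "a \<le> 11 / 10" using pi_bounds by linarith+
  define x where "x = a\<^sup>2"
  have "(52 / 100)\<^sup>2 \<le> x" "x \<le> (11 / 10)\<^sup>2" unfolding x_def using ab by (auto intro!: power_mono)
  hence x: "27 / 100 \<le> x" "x \<le> 121 / 100" by (simp_all add: power2_eq_square)
  have "a * cos a * pi \<le> a * (1 - a\<^sup>2 / 2 + a^4 / 24) * (315 / 100)"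
  proof (intro mult_mono)
    show "cos a \<le> 1 - a\<^sup>2 / 2 + a^4 / 24" using a by (intro cos_le_quartic) simp
    have "0 \<le> cos a" using \<open>a < c\<close> \<open>c < pi / 2\<close> a by (intro cos_ge_zero) auto
    hence "0 \<le> 1 - a\<^sup>2 / 2 + a^4 / 24"
      using \<open>cos a \<le> 1 - a\<^sup>2 / 2 + a^4 / 24\<close> by simp
    thus "0 \<le> a * (1 - a\<^sup>2 / 2 + a^4 / 24)" using a by simp
    show "0 \<le> cos a" by fact
  qed (use a pi_bounds in auto)
  also have "\<dots> = a * ((1 - x / 2 + x * x / 24) * (315 / 100))"
    by (simp add: x_def power2_eq_square eval_nat_numeral)
  also have "\<dots> \<le> a * (3 - x / 2)"
  proof (intro mult_left_mono)
    \<comment> \<open>Rearranged, the claim says that the right-hand product is at least 0.15; lower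
      bounds for its two factors give 0.243.\<close>
    have "27 / 100 * (9 / 10) \<le> x * (1075 / 1000 - 13125 / 100000 * x)" using x by (intro mult_mono) auto
    thus "(1 - x / 2 + x * x / 24) * (315 / 100) \<le> 3 - x / 2" by (simp add: algebra_simps)
  qed (use a in simp)
  also have "\<dots> = 3 * (a - a^3 / 6)" by (simp add: x_def power2_eq_square power3_eq_cube algebra_simps)
  also have "\<dots> \<le> 3 * sin a" using sin_ge_cubic[of a] a by simp
  finally have key: "pi * a * cos a \<le> 3 * sin a" by (simp add: mult_ac)
  have "pi * a * (sin c - sin a) \<le> pi * a * (cos a * (c - a))"
    using a c by (intro mult_left_mono sin_chord) auto
  also have "\<dots> \<le> 3 * sin a * (c - a)"
    using mult_right_mono[OF key, of "c - a"] c by (simp add: mult_ac)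
  finally show ?thesis .
next
  assume "a \<le> pi / 7"
  hence a7: "a \<le> 45 / 100" "a < pi / 6" using pi_bounds a by (auto simp: field_simps)
  define x where "x = a\<^sup>2"
  have "x \<le> (45 / 100)\<^sup>2" unfolding x_def using a7 a by (intro power_mono) auto
  hence x: "0 \<le> x" "x \<le> 2025 / 10000" by (simp_all add: x_def power2_eq_square)
  have s: "a * (1 - x / 6) \<le> sin a"
    using sin_ge_cubic[of a] a by (simp add: x_def power2_eq_square power3_eq_cube algebra_simps)
  have sp: "0 < sin a" using a a7 by (intro sin_gt_zero) auto
  have sqrt3: "sqrt 3 \<le> 1733 / 1000" by (rule real_le_lsqrt) (simp_all add: power2_eq_square)
  \<comment> \<open>The increment is split at \<open>pi / 6\<close>: this slope estimate covers the
    part from \<open>pi / 6\<close> to \<open>c\<close>, the next one the part from \<open>a\<close>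
    to \<open>pi / 6\<close>.\<close>
  have i: "pi * a * cos (pi / 6) \<le> 3 * sin a"
  proof -
    have "pi * sqrt 3 \<le> (315 / 100) * (1733 / 1000)"
      using pi_bounds sqrt3 by (intro mult_mono) auto
    hence "a * (pi * sqrt 3 / 2) \<le> a * (3 * (1 - x / 6))" using x a by (intro mult_left_mono) auto
    thus ?thesis using s by (simp add: cos_30 algebra_simps)
  qed
  \<comment> \<open>The case \<open>c = pi / 6\<close> rearranged. Equality holds at
    \<open>a = 0\<close> and \<open>a = pi / 6\<close>, so the upper bound \<open>pi / 7\<close> is
    what gives the crude estimates their room.\<close>
  have ii: "pi * (a - sin a) \<le> 2 * (pi - 3) * a * sin a"
  proof -
    have "pi * (a - sin a) \<le> pi * (a * x / 6)"
      using s by (intro mult_left_mono) (auto simp: algebra_simps)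
    also have "\<dots> = a * a * (pi * a / 6)" by (simp add: x_def power2_eq_square)
    also have "\<dots> \<le> a * a * (2 * (pi - 3) * (1 - x / 6))"
    proof (intro mult_left_mono)
      have "pi * a / 6 \<le> (315 / 100) * (45 / 100) / 6"
        using pi_bounds a7 a by (intro divide_right_mono mult_mono) auto
      also have "\<dots> \<le> 2 * (14 / 100) * (1 - (2025 / 10000) / 6)" by simp
      also have "\<dots> \<le> 2 * (pi - 3) * (1 - x / 6)" using pi_bounds x by (intro mult_mono) auto
      finally show "pi * a / 6 \<le> 2 * (pi - 3) * (1 - x / 6)" .
    qed simp
    also have "\<dots> = 2 * (pi - 3) * a * (a * (1 - x / 6))" by (simp add: mult_ac)
    also have "\<dots> \<le> 2 * (pi - 3) * a * sin a"
      using s a pi_bounds by (intro mult_left_mono) auto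
    finally show ?thesis .
  qed
  have "pi * a * (sin c - sin (pi / 6)) \<le> pi * a * (cos (pi / 6) * (c - pi / 6))"
    using a c by (intro mult_left_mono sin_chord) auto
  also have "\<dots> \<le> 3 * sin a * (c - pi / 6)"
    using mult_right_mono[OF i, of "c - pi / 6"] c by (simp add: mult_ac)
  finally have "pi * a * (sin c - 1 / 2) \<le> 3 * sin a * (c - pi / 6)" by (simp add: sin_30)
  moreover have "pi * a * (1 / 2 - sin a) \<le> 3 * sin a * (pi / 6 - a)"
    using ii by (simp add: algebra_simps)
  ultimately show ?thesis by (simp add: algebra_simps)
qed

text \<open>The same division into cases as for packings, with the tangent in place of the sine:
  chords from \<open>a\<close> when \<open>a\<close> is at least \<open>pi / 6\<close>, and
  otherwise a split at \<open>pi / 6\<close>.\<close>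

lemma covering_inequality:
  assumes a: "0 < a" "a \<le> pi / 7 \<or> pi / 6 \<le> a \<and> a \<le> pi / 3" and c: "pi / 6 \<le> c" "c < pi / 2" "a < c"
  shows "sqrt 12 * tan a * (c - a) \<le> pi * a * (tan c - tan a)"
proof -
  have sqrt12: "sqrt 12 = 2 * sqrt 3" using real_sqrt_mult[of 4 3] by simp
  have ca: "0 < cos a" using a c by (intro cos_gt_zero) auto
  have sa: "0 < sin a" using a c by (intro sin_gt_zero) auto
  show ?thesis using a(2)
  proof (elim disjE conjE)
    assume a6: "pi / 6 \<le> a" "a \<le> pi / 3"
    \<comment> \<open>The slope condition \<open>sqrt 12 * tan a \<le> pi * a / (cos a)^2\<close>
      amounts to \<open>sqrt 3 * sin (2 * a) \<le> pi * a\<close>; the sine is replaced by its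
      tangent line at \<open>pi / 3\<close>.\<close>
    have "sin (2 * a) - sin (pi / 3) \<le> cos (pi / 3) * (2 * a - pi / 3)"
      using a6 by (intro sin_chord) auto
    hence "sin (2 * a) \<le> sqrt 3 / 2 + (a - pi / 6)" by (simp add: sin_60 cos_60)
    hence "sqrt 3 * sin (2 * a) \<le> sqrt 3 * (sqrt 3 / 2 + (a - pi / 6))" by (intro mult_left_mono) auto
    also have "\<dots> = 3 / 2 + sqrt 3 * (a - pi / 6)" by (simp add: algebra_simps)
    also have "\<dots> \<le> pi * (pi / 6) + pi * (a - pi / 6)"
    proof (intro add_mono mult_right_mono)
      have "3 * 3 \<le> pi * pi" using pi_bounds by (intro mult_mono) auto
      thus "3 / 2 \<le> pi * (pi / 6)" by simp
      have "sqrt 3 \<le> 3" by (rule real_le_lsqrt) auto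
      thus "sqrt 3 \<le> pi" using pi_bounds by simp
    qed (use a6 in auto)
    also have "\<dots> = pi * a" by (simp add: algebra_simps)
    finally have "sqrt 3 * sin (2 * a) \<le> pi * a" .
    hence "sqrt 12 * (sin a * cos a) \<le> pi * a" unfolding sin_double sqrt12 by (simp add: mult_ac)
    hence "sqrt 12 * (sin a * cos a) / (cos a)\<^sup>2 \<le> pi * a / (cos a)\<^sup>2" by (intro divide_right_mono) auto
    hence key: "sqrt 12 * tan a \<le> pi * a / (cos a)\<^sup>2"
      using ca by (simp add: tan_def power2_eq_square)
    have "sqrt 12 * tan a * (c - a) \<le> pi * a / (cos a)\<^sup>2 * (c - a)"
      using key c by (intro mult_right_mono) auto
    also have "\<dots> = pi * a * ((c - a) / (cos a)\<^sup>2)" by simp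
    also have "\<dots> \<le> pi * a * (tan c - tan a)"
      using a c by (intro mult_left_mono tan_chord) auto
    finally show ?thesis .
  next
    assume "a \<le> pi / 7"
    hence a7: "a \<le> 45 / 100" "a < pi / 6" using pi_bounds a by (auto simp: field_simps)
    define x where "x = a\<^sup>2"
    have "x \<le> (45 / 100)\<^sup>2" unfolding x_def using a7 a by (intro power_mono) auto
    hence x: "0 \<le> x" "x \<le> 2025 / 10000" by (simp_all add: x_def power2_eq_square)
    have s: "a * (1 - x / 6) \<le> sin a"
      using sin_ge_cubic[of a] a by (simp add: x_def power2_eq_square power3_eq_cube algebra_simps)
    have sqrt3: "sqrt 3 \<le> 1733 / 1000" by (rule real_le_lsqrt) (simp_all add: power2_eq_square)
    \<comment> \<open>The constant 4/3 is the derivative of the tangent at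
      \<open>pi / 6\<close>.\<close>
    have i: "sqrt 12 * tan a \<le> pi * a * (4 / 3)"
    proof -
      have "6 * sqrt 3 * sin a \<le> 4 * (pi * cos a) * a"
      proof (rule mult_mono)
        have "(314 / 100) * (89 / 100) \<le> pi * cos a"
          using pi_bounds cos_ge_quadratic[of a] a x by (intro mult_mono) (auto simp: x_def)
        thus "6 * sqrt 3 \<le> 4 * (pi * cos a)" using sqrt3 by simp
        thus "0 \<le> 4 * (pi * cos a)" using ca by simp
        show "sin a \<le> a" using a by (intro sin_x_le_x) simp
      qed (use sa in auto)
      thus ?thesis using ca by (simp add: tan_def sqrt12 field_simps)
    qed
    \<comment> \<open>The case \<open>c = pi / 6\<close>, multiplied by \<open>sqrt 3\<close> and
      rearranged; again an equality at \<open>a = pi / 6\<close>.\<close>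
    have ii: "pi * (tan a - a) \<le> (6 - sqrt 3 * pi) * a * tan a"
    proof -
      have "pi * (sin a - a * cos a) \<le> pi * (a * x / 3)"
        using sin_minus_x_cos_le[of a] a
        by (intro mult_left_mono) (auto simp: x_def power2_eq_square power3_eq_cube)
      also have "\<dots> = a * a * (pi * a / 3)" by (simp add: x_def power2_eq_square)
      also have "\<dots> \<le> a * a * ((6 - sqrt 3 * pi) * (1 - x / 6))"
      proof (intro mult_left_mono)
        have s3: "sqrt 3 * pi \<le> (1733 / 1000) * (315 / 100)" using pi_bounds sqrt3 by (intro mult_mono) auto
        have "pi * a / 3 \<le> (315 / 100) * (45 / 100) / 3"
          using pi_bounds a7 a by (intro divide_right_mono mult_mono) auto
        \<comment> \<open>By the bound \<open>s3\<close>, 0.54 is below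
          \<open>6 - sqrt 3 * pi\<close>.\<close>
        also have "\<dots> \<le> (54 / 100) * (1 - (2025 / 10000) / 6)" by simp
        also have "\<dots> \<le> (6 - sqrt 3 * pi) * (1 - x / 6)" using s3 x by (intro mult_mono) auto
        finally show "pi * a / 3 \<le> (6 - sqrt 3 * pi) * (1 - x / 6)" .
      qed simp
      also have "\<dots> = (6 - sqrt 3 * pi) * a * (a * (1 - x / 6))" by (simp add: mult_ac)
      also have "\<dots> \<le> (6 - sqrt 3 * pi) * a * sin a"
      proof (intro mult_left_mono s mult_nonneg_nonneg)
        have "sqrt 3 * pi \<le> (1733 / 1000) * (315 / 100)" using pi_bounds sqrt3 by (intro mult_mono) auto
        thus "0 \<le> 6 - sqrt 3 * pi" by simp
      qed (use a in simp)
      finally have "pi * (sin a - a * cos a) / cos a \<le> (6 - sqrt 3 * pi) * a * sin a / cos a"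
        using ca by (intro divide_right_mono) auto
      moreover have "pi * (sin a - a * cos a) / cos a = pi * (tan a - a)"
        using ca by (simp add: tan_def field_simps)
      ultimately show ?thesis by (simp add: tan_def)
    qed
    have "sqrt 12 * tan a * (c - pi / 6) \<le> pi * a * (4 / 3) * (c - pi / 6)"
      using i c by (intro mult_right_mono) auto
    also have "\<dots> = pi * a * ((c - pi / 6) / (cos (pi / 6))\<^sup>2)"
      by (simp add: cos_30 power_divide)
    also have "\<dots> \<le> pi * a * (tan c - tan (pi / 6))"
      using a c by (intro mult_left_mono tan_chord) auto
    finally have 1: "sqrt 12 * tan a * (c - pi / 6) \<le> pi * a * (tan c - 1 / sqrt 3)" by (simp add: tan_30)
    have "sqrt 3 * (sqrt 12 * tan a * (pi / 6 - a)) \<le> sqrt 3 * (pi * a * (1 / sqrt 3 - tan a))"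
    proof -
      have "sqrt 3 * (sqrt 12 * tan a * (pi / 6 - a)) = (sqrt 3 * sqrt 3) * 2 * tan a * (pi / 6 - a)"
        by (simp only: sqrt12 mult_ac)
      also have "\<dots> = pi * tan a - 6 * a * tan a" by (simp add: algebra_simps)
      also have "\<dots> \<le> pi * a - sqrt 3 * pi * a * tan a" using ii by (simp add: algebra_simps)
      also have "\<dots> = sqrt 3 * (pi * a * (1 / sqrt 3 - tan a))" by (simp add: algebra_simps)
      finally show ?thesis .
    qed
    hence 2: "sqrt 12 * tan a * (pi / 6 - a) \<le> pi * a * (1 / sqrt 3 - tan a)" by simp
    show ?thesis using 1 2 by (simp add: algebra_simps)
  qed
qed

section \<open>Optimal densities\<close>

context mosaic
begin

lemma A_cases: "A \<le> pi / 7 \<or> pi / 6 \<le> A \<and> A \<le> pi / 3"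
proof (cases "p \<le> 6")
  case True
  hence "pi / 6 \<le> A" unfolding A_def using p_ge_3 by (intro divide_left_mono) auto
  thus ?thesis using A_le by simp
next
  case False
  hence "A \<le> pi / 7" unfolding A_def by (intro divide_left_mono) auto
  thus ?thesis ..
qed

lemma C_bounds: "pi / 6 \<le> pi / 2 - B" "pi / 2 - B < pi / 2" "A < pi / 2 - B"
  using B_le B_pos AB by simp_all

lemma p_eq: "real p = pi / A"
  using p_A A_pos by (simp add: field_simps)

text \<open>With \<open>c = pi / 2 - B\<close> one has \<open>sin c = cos B\<close>, and dividing
  the inequality by \<open>A * sin A\<close> produces \<open>cosh r - 1\<close> on one side and a
  multiple of the area on the other. \<open>covering_ge\<close> does the same with
  \<open>tan c = cot B\<close> and \<open>cosh R\<close>.\<close>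

lemma packing_le: "circle_packing_density p q \<le> 3 / pi"
proof -
  have commute: "pi / 2 - B - A = pi / 2 - A - B" by simp
  have "pi * A * (cos B - sin A) \<le> 3 * sin A * (pi / 2 - B - A)"
    using packing_inequality[OF A_pos A_cases C_bounds] by (simp add: sin_diff)
  hence "pi * A * (cos B - sin A) / (A * sin A) \<le> 3 * sin A * (pi / 2 - B - A) / (A * sin A)"
    using A_pos trig_pos by (intro divide_right_mono) auto
  moreover have "pi * A * (cos B - sin A) / (A * sin A) = pi * ((cos B - sin A) / sin A)"
    using A_pos by simp
  moreover have "(cos B - sin A) / sin A = cosh r - 1"
    using trig_pos by (simp add: cosh_r diff_divide_distrib)
  moreover have "3 * sin A * (pi / 2 - B - A) / (A * sin A) = 3 * (pi / 2 - A - B) / A"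
    unfolding commute using A_pos trig_pos by simp
  ultimately have "pi * (cosh r - 1) \<le> 3 * (pi / 2 - A - B) / A" by simp
  moreover have "3 / pi * area = 2 * (3 * (pi / 2 - A - B) / A)" by (simp add: area_def p_eq)
  ultimately have "2 * pi * (cosh r - 1) \<le> 3 / pi * area" by linarith
  thus ?thesis using area_pos by (simp add: circle_packing_density pos_divide_le_eq)
qed

lemma covering_ge: "sqrt 12 / pi \<le> circle_covering_density p q"
proof -
  have commute: "pi / 2 - B - A = pi / 2 - A - B" by simp
  have t: "tan (pi / 2 - B) = cot B" by (simp add: tan_def cot_def sin_diff cos_diff)
  have tA: "0 < tan A" using trig_pos by (simp add: tan_def)
  have "sqrt 12 * tan A * (pi / 2 - B - A) \<le> pi * A * (cot B - tan A)"
    using covering_inequality[OF A_pos A_cases C_bounds] by (simp only: t)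
  hence "sqrt 12 * tan A * (pi / 2 - B - A) / (A * tan A) \<le> pi * A * (cot B - tan A) / (A * tan A)"
    using A_pos tA by (intro divide_right_mono) auto
  moreover have "sqrt 12 * tan A * (pi / 2 - B - A) / (A * tan A) = sqrt 12 * (pi / 2 - A - B) / A"
    unfolding commute using A_pos tA by simp
  moreover have "pi * A * (cot B - tan A) / (A * tan A) = pi * (cosh R - 1)"
  proof -
    have "pi * A * (cot B - tan A) / (A * tan A) = pi * ((cot B - tan A) / tan A)"
      using A_pos by simp
    also have "(cot B - tan A) / tan A = cot B / tan A - 1" using tA by (simp add: diff_divide_distrib)
    also have "cot B / tan A = cosh R" by (simp add: cosh_R tan_def cot_def mult.commute)
    finally show ?thesis .
  qed
  ultimately have "sqrt 12 * (pi / 2 - A - B) / A \<le> pi * (cosh R - 1)" by simp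
  moreover have "sqrt 12 / pi * area = 2 * (sqrt 12 * (pi / 2 - A - B) / A)" by (simp add: area_def p_eq)
  ultimately have "sqrt 12 / pi * area \<le> 2 * pi * (cosh R - 1)" by linarith
  thus ?thesis using area_pos by (simp add: circle_covering_density pos_le_divide_eq)
qed

end

section \<open>Sharpness along the mosaics {p, 3}\<close>

lemma mosaic_3: "(p, 3) \<in> schlaefli" if "7 \<le> p"
  using that by (simp add: schlaefli_def pos_divide_less_eq)

text \<open>For q = 3 the density is elementary in \<open>pi / p\<close>; since
  \<open>p * sin (pi / p)\<close> tends to \<open>pi\<close>, the limit is (1/2) / (pi/6). The
  formula is only claimed eventually, as {p, 3} is hyperbolic from p = 7 on.\<close>

lemma packing_density_3_tendsto: "(\<lambda>p. circle_packing_density p 3) \<longlonglongrightarrow> 3 / pi"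
proof (rule Lim_transform_eventually)
  show "(\<lambda>p::nat. pi * ((1 / 2) / sin (pi / real p) - 1) / (real p * (pi / 6 - pi / real p))) \<longlonglongrightarrow> 3 / pi"
    by real_asymp
  show "\<forall>\<^sub>F p in sequentially. pi * ((1 / 2) / sin (pi / real p) - 1) / (real p * (pi / 6 - pi / real p))
      = circle_packing_density p 3"
    using eventually_ge_at_top[of 7]
  proof eventually_elim
    case (elim p)
    interpret mosaic p 3 by unfold_locales (rule mosaic_3[OF elim])
    have "cos B = 1 / 2" by (simp add: B_def cos_60)
    moreover have "pi / 2 - A - B = pi / 6 - A" by (simp add: B_def)
    ultimately show ?case
      by (simp only: circle_packing_density cosh_r area_def) (simp add: A_def)
  qed
qed

lemma covering_density_3_tendsto: "(\<lambda>p. circle_covering_density p 3) \<longlonglongrightarrow> sqrt 12 / pi"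
proof (rule Lim_transform_eventually)
  have "(\<lambda>p::nat. pi * (cos (pi / real p) / sin (pi / real p) / sqrt 3 - 1) / (real p * (pi / 6 - pi / real p)))
      \<longlonglongrightarrow> 6 / (pi * sqrt 3)"
    by (real_asymp simp: field_simps sqrt_def)
  also have "6 / (pi * sqrt 3) = sqrt 12 / pi"
    using real_sqrt_mult[of 4 3] by (simp add: field_simps)
  finally show "(\<lambda>p::nat. pi * (cos (pi / real p) / sin (pi / real p) / sqrt 3 - 1) /
      (real p * (pi / 6 - pi / real p))) \<longlonglongrightarrow> sqrt 12 / pi" .
  show "\<forall>\<^sub>F p in sequentially. pi * (cos (pi / real p) / sin (pi / real p) / sqrt 3 - 1) /
      (real p * (pi / 6 - pi / real p)) = circle_covering_density p 3"
    using eventually_ge_at_top[of 7]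
  proof eventually_elim
    case (elim p)
    interpret mosaic p 3 by unfold_locales (rule mosaic_3[OF elim])
    have "cot B = 1 / sqrt 3" by (simp add: B_def cot_def cos_60 sin_60)
    moreover have "pi / 2 - A - B = pi / 6 - A" by (simp add: B_def)
    moreover have "cot A = cos A / sin A" by (simp add: cot_def)
    ultimately show ?case
      by (simp only: circle_covering_density cosh_R area_def) (simp add: A_def)
  qed
qed

lemma optimal_packing_circle: "optimal_packing circle_packing_density = ereal (3 / pi)"
proof (rule antisym)
  show "optimal_packing circle_packing_density \<le> ereal (3 / pi)"
    unfolding optimal_packing_def
  proof (intro SUP_least, clarify)
    fix p q assume "(p, q) \<in> schlaefli"
    then interpret mosaic p q by unfold_locales
    show "ereal (circle_packing_density p q) \<le> ereal (3 / pi)" using packing_le by simp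
  qed
  have "(\<lambda>p. ereal (circle_packing_density p 3)) \<longlonglongrightarrow> ereal (3 / pi)"
    using packing_density_3_tendsto by simp
  moreover have "ereal (circle_packing_density p 3) \<le> optimal_packing circle_packing_density" if "7 \<le> p" for p
    unfolding optimal_packing_def using mosaic_3[OF that] by (intro SUP_upper2[of "(p, 3)"]) auto
  ultimately show "ereal (3 / pi) \<le> optimal_packing circle_packing_density"
    by (intro LIMSEQ_le_const2) blast+
qed

lemma optimal_covering_circle: "optimal_covering circle_covering_density = ereal (sqrt 12 / pi)"
proof (rule antisym)
  show "ereal (sqrt 12 / pi) \<le> optimal_covering circle_covering_density"
    unfolding optimal_covering_def
  proof (intro INF_greatest, clarify)
    fix p q assume "(p, q) \<in> schlaefli"
    then interpret mosaic p q by unfold_locales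
    show "ereal (sqrt 12 / pi) \<le> ereal (circle_covering_density p q)" using covering_ge by simp
  qed
  have "(\<lambda>p. ereal (circle_covering_density p 3)) \<longlonglongrightarrow> ereal (sqrt 12 / pi)"
    using covering_density_3_tendsto by simp
  moreover have "optimal_covering circle_covering_density \<le> ereal (circle_covering_density p 3)" if "7 \<le> p" for p
    unfolding optimal_covering_def using mosaic_3[OF that] by (intro INF_lower2[of "(p, 3)"]) auto
  ultimately show "optimal_covering circle_covering_density \<le> ereal (sqrt 12 / pi)"
    by (intro LIMSEQ_le_const) blast+
qed

lemma optimal_cong:
  assumes "\<And>p q. (p, q) \<in> schlaefli \<Longrightarrow> \<delta> p q = \<delta>' p q"
  shows "optimal_packing \<delta> = optimal_packing \<delta>'" "optimal_covering \<delta> = optimal_covering \<delta>'"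
  using assms by (auto simp: optimal_packing_def optimal_covering_def intro!: SUP_cong INF_cong)

theorem theorem5p2:
  shows "(optimal_packing h3_packing_density = optimal_packing circle_packing_density
        \<and> optimal_packing h2r_packing_density = optimal_packing circle_packing_density
        \<and> optimal_packing sl_packing_density = optimal_packing circle_packing_density
        \<and> optimal_packing circle_packing_density = ereal (3 / pi))
      \<and> (optimal_covering h3_covering_density = optimal_covering circle_covering_density
        \<and> optimal_covering h2r_covering_density = optimal_covering circle_covering_density
        \<and> optimal_covering sl_covering_density = optimal_covering circle_covering_density
        \<and> optimal_covering circle_covering_density = ereal (sqrt 12 / pi))"
  by (intro conjI optimal_cong optimal_packing_circle optimal_covering_circle
      mosaic.cylinder_densities mosaic.sl_densities mosaic.intro)

end
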